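(* Let $(\Omega,\mathcal{F},\mathbb{P})$ be a countably generated probability space, $F,G,\mathcal{H}_1,\mathcal{H}_2,\mathcal{H}_3$ real separable Hilbert spaces, $r\in\mathbb{N}$, $x\in L^2(\Omega;F)$, $y\in L^2(\Omega;G)$, and $W_x\in\mathcal{B}(F,\mathcal{H}_1)$, $W_A\in\mathcal{B}(\mathcal{H}_2,\mathcal{H}_1)$, $W_y\in\mathcal{B}(G,\mathcal{H}_3)$. Suppose that $W_A$ has closed range. Put $$K:=P_{\overline{\operatorname{ran}(C_y^{1/2}W_y^* )}}\,(C_y^{1/2})^\dagger C_{yx}W_x^*\,P_{\operatorname{ran}W_A}.$$ Then a solution to the problem $$\min\{\mathbb{E}\|W_xx-W_AAW_yy\|^2:\ A\in\mathcal{B}_{00,r}(\mathcal{H}_3,\mathcal{H}_2)\}\qquad(\ast)$$ exists if and only if there exists a rank-$r$ truncated SVD $(K)_r$ of $K$ satisfying $$\operatorname{ran}((K)_r)\subset\operatorname{ran}(C_y^{1/2}W_y^* ).$$ In this case, a solution is given by $$\hat A=W_A^\dagger\Big((C_y^{1/2}W_y^* )^\dagger(K)_r\Big)^*,\qquad(\ast\ast)$$ which also satisfies the minimality property $$P_{(\ker W_A)^\perp}\hat AP_{(\ker(C_y^{1/2}W_y^* ))^\perp}=\hat A.\qquad(\ast{\ast}\ast)$$ Additionally, $(\ast\ast)$ uniquely specifies a solution of $(\ast)$ that also satisfies $(\ast{\ast}\ast)$ if and only if the truncated SVD $(K)_r$ in $(\ast\ast)$ is unique.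
   Context: $L^2(\Omega;E)$ is the Lebesgue--Bochner space of square-integrable $E$-valued random variables. For $z\in L^2(\Omega;E_1)$, $w\in L^2(\Omega;E_2)$ the uncentered covariance $C_{wz}\in\mathcal{B}(E_1,E_2)$ is defined by $\langle C_{wz}e,f\rangle=\int_\Omega\langle w(\omega),f\rangle\langle e,z(\omega)\rangle\,d\mathbb{P}(\omega)$, and $C_z:=C_{zz}$ (positive, self-adjoint). The operator $(C_y^{1/2})^\dagger C_{yx}$ is everywhere defined on $F$, and $(C_y^{1/2})^\dagger C_{yx}W_x^*$ is a Hilbert--Schmidt operator $\mathcal{H}_1\to G$. $\mathcal{B}(\mathcal{H},\mathcal{K})$: bounded everywhere-defined linear operators; $\mathcal{B}_{00,r}(\mathcal{H},\mathcal{K})$: those with range of dimension at most $r$. $P_V$: orthogonal projector onto a closed subspace $V$. Moore--Penrose inverse: for $T\in\mathcal{B}(\mathcal{H},\mathcal{K})$, $T^\dagger$ is the (possibly unbounded) linear operator with $\operatorname{dom}(T^\dagger)=\operatorname{ran}T\oplus(\operatorname{ran}T)^\perp$ and $T^\dagger(h+k)=(T|_{(\ker T)^\perp})^{-1}h$ for $h\in\operatorname{ran}T$, $k\in(\operatorname{ran}T)^\perp$. A compact operator $T$ has an SVD $T=\sum_i\sigma_i\langle\cdot,e_i\rangle f_i$ with nonincreasing singular values $\sigma_i$ and orthonormal systems $(e_i),(f_i)$; a rank-$r$ truncated SVD $(T)_r$ keeps the first $r$ terms (not unique in general). In $(\ast\ast)$, $(K)_r$ is a truncated SVD satisfying the range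 inclusion. *)

theory Defs
  imports "HOL-Probability.Probability"
begin

text \<open>
  A real separable Hilbert space is a type of sort
  \<open>{real_inner, banach, second_countable_topology}\<close>.  Operators are plain functions, and
  membership in \<open>B(H, K)\<close> is \<^const>\<open>bounded_linear\<close>.  The adjoint is the library's \<^const>\<open>adjoint\<close>;
  it is well defined on bounded operators between Hilbert spaces by the Riesz theorem.
\<close>

definition countably_generated :: "'w measure \<Rightarrow> bool" where
  "countably_generated M \<longleftrightarrow>
     (\<exists>E. countable E \<and> E \<subseteq> Pow (space M) \<and> sets M = sigma_sets (space M) E)"

definition square_integrable ::
  "'w measure \<Rightarrow> ('w \<Rightarrow> 'e::{real_inner, banach, second_countable_topology}) \<Rightarrow> bool" where
  "square_integrable M z \<longleftrightarrow>
     z \<in> borel_measurable M \<and> integrable M (\<lambda>\<omega>. (norm (z \<omega>))\<^sup>2)"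

text \<open>The uncentered covariance \<open>C\<^bsub>wz\<^esub>\<close>, mapping the space of \<open>z\<close> to the space of \<open>w\<close>.\<close>

definition covariance ::
  "'w measure \<Rightarrow> ('w \<Rightarrow> 'b::{real_inner, banach, second_countable_topology})
     \<Rightarrow> ('w \<Rightarrow> 'a::{real_inner, banach, second_countable_topology}) \<Rightarrow> 'a \<Rightarrow> 'b" where
  "covariance M w z = (THE C. bounded_linear C \<and>
     (\<forall>e f. C e \<bullet> f = (\<integral>\<omega>. (w \<omega> \<bullet> f) * (e \<bullet> z \<omega>) \<partial>M)))"

text \<open>The positive square root; meant for bounded positive self-adjoint \<open>T\<close>.\<close>

definition sqrt_op :: "('a::{real_inner, banach} \<Rightarrow> 'a) \<Rightarrow> 'a \<Rightarrow> 'a" where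
  "sqrt_op T = (THE S. bounded_linear S \<and> (\<forall>u v. S u \<bullet> v = u \<bullet> S v) \<and>
     (\<forall>u. 0 \<le> S u \<bullet> u) \<and> S \<circ> S = T)"

text \<open>The orthogonal projector onto \<open>V\<close>; meant for closed subspaces \<open>V\<close>.\<close>

definition proj :: "'a::{real_inner, banach} set \<Rightarrow> 'a \<Rightarrow> 'a" where
  "proj V v = (THE p. p \<in> V \<and> v - p \<in> V\<^sup>\<bottom>)"

definition ker :: "('a::real_vector \<Rightarrow> 'b::real_vector) \<Rightarrow> 'a set" where
  "ker T = {v. T v = 0}"

text \<open>
  The Moore--Penrose inverse of a bounded operator is an unbounded operator with domain \<open>mp_dom T\<close>;
  as HOL functions are total, \<open>mp_inv T\<close> takes the dummy value 0 outside its domain.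
\<close>

definition mp_dom :: "('a::{real_inner, banach} \<Rightarrow> 'b::{real_inner, banach}) \<Rightarrow> 'b set" where
  "mp_dom T = {h + k | h k. h \<in> range T \<and> k \<in> (range T)\<^sup>\<bottom>}"

definition mp_inv ::
  "('a::{real_inner, banach} \<Rightarrow> 'b::{real_inner, banach}) \<Rightarrow> 'b \<Rightarrow> 'a" where
  "mp_inv T g =
     (if g \<in> mp_dom T
      then (THE v. v \<in> (ker T)\<^sup>\<bottom> \<and> (\<exists>k\<in>(range T)\<^sup>\<bottom>. g = T v + k))
      else 0)"

text \<open>
  \<open>B\<^sub>0\<^sub>0\<^sub>,\<^sub>r\<close>: bounded operators whose range has a basis of at most \<open>r\<close> vectors.  The library's
  \<^const>\<open>dim\<close> is 0 on infinite-dimensional spaces, so it cannot express this bound.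
\<close>

definition bounded_rank_le ::
  "nat \<Rightarrow> ('a::{real_inner, banach} \<Rightarrow> 'b::{real_inner, banach}) set" where
  "bounded_rank_le r = {A. bounded_linear A \<and>
     (\<exists>B. finite B \<and> card B \<le> r \<and> independent B \<and> span B = range A)}"

text \<open>
  A singular value decomposition with \<open>N \<le> \<infinity>\<close> terms, indexed from 0.  Only nonzero singular values
  are listed, and \<open>\<sigma>\<close> tends to 0 if there are infinitely many, so that the series converges in
  operator norm and only compact operators have a decomposition.  The values of \<open>\<sigma>\<close>, \<open>e\<close>, \<open>f\<close>
  at indices \<open>\<ge> N\<close> are irrelevant.
\<close>

definition orthonormal_upto :: "enat \<Rightarrow> (nat \<Rightarrow> 'a::real_inner) \<Rightarrow> bool" where
  "orthonormal_upto N e \<longleftrightarrow>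
     (\<forall>i j. enat i < N \<longrightarrow> enat j < N \<longrightarrow> e i \<bullet> e j = (if i = j then 1 else 0))"

definition is_svd ::
  "('a::{real_inner, banach} \<Rightarrow> 'b::{real_inner, banach}) \<Rightarrow> enat
     \<Rightarrow> (nat \<Rightarrow> real) \<Rightarrow> (nat \<Rightarrow> 'a) \<Rightarrow> (nat \<Rightarrow> 'b) \<Rightarrow> bool" where
  "is_svd T N \<sigma> e f \<longleftrightarrow>
     (\<forall>i. enat i < N \<longrightarrow> 0 < \<sigma> i) \<and>
     (\<forall>i j. i \<le> j \<longrightarrow> enat j < N \<longrightarrow> \<sigma> j \<le> \<sigma> i) \<and>
     (N = \<infinity> \<longrightarrow> \<sigma> \<longlonglongrightarrow> 0) \<and>
     orthonormal_upto N e \<and> orthonormal_upto N f \<and>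
     (\<forall>v. ((\<lambda>i. (\<sigma> i * (v \<bullet> e i)) *\<^sub>R f i) has_sum T v) {i. enat i < N})"

text \<open>\<open>R\<close> is a rank-\<open>r\<close> truncated SVD of \<open>T\<close>, regarded as an operator.\<close>

definition is_truncated_svd ::
  "nat \<Rightarrow> ('a::{real_inner, banach} \<Rightarrow> 'b::{real_inner, banach}) \<Rightarrow> ('a \<Rightarrow> 'b) \<Rightarrow> bool" where
  "is_truncated_svd r T R \<longleftrightarrow>
     (\<exists>N \<sigma> e f. is_svd T N \<sigma> e f \<and>
        R = (\<lambda>v. \<Sum>i | i < r \<and> enat i < N. (\<sigma> i * (v \<bullet> e i)) *\<^sub>R f i))"

end

theory Submission
  imports Defs
begin

text \<open>
  Writing \<open>C\<close> for the covariance of \<open>y\<close>, the Cauchy--Schwarz inequality and Douglas' lemma give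
  \<open>C\<^bsub>yx\<^esub> = C\<^sup>1\<^sup>/\<^sup>2 D\<close> with \<open>D\<close> bounded, and completing the square turns the expected loss of \<open>A\<close> into
  a constant plus the squared Hilbert--Schmidt distance of \<open>S A\<^sup>* W\<^sub>A\<^sup>*\<close> from the compact operator \<open>K\<close>, where
  \<open>S = C\<^sup>1\<^sup>/\<^sup>2 W\<^sub>y\<^sup>*\<close>.  As \<open>K\<close> maps into the closure of \<open>ran S\<close>, the infimum over admissible ranges is the
  unconstrained one of the Eckart--Young theorem, so it is attained exactly by a truncated SVD of \<open>K\<close>
  with range in \<open>ran S\<close>.  To avoid traces, the Hilbert--Schmidt norm is only ever compared on finite
  orthonormal systems: a minimizer is \<open>K\<close> composed with the projector onto the span of a system maximizing
  \<open>\<Sum>i. (norm (K (h i)))\<^sup>2\<close>, and the SVDs of \<open>K\<close> on that span and on its complement join to an SVD of \<open>K\<close>.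
\<close>

section \<open>Orthogonal projections, adjoints and the Moore--Penrose inverse\<close>

text \<open>\<open>range S\<close> need not be closed, and this is the only obstruction to
  existence: \<open>K (h i)\<close> can always be approximated by vectors \<open>S (p i)\<close>,
  but a minimum requires that it be hit exactly. Since \<open>range WA\<close> is closed, the
  directions \<open>h i\<close> can be taken inside it as exact images of \<open>WA\<close>, so only
  they and their targets \<open>p i\<close> remain to be chosen.

  The factor \<open>C^{1/2}\<close> enters because the second moment of \<open>y\<close> along
  \<open>u\<close> is the squared norm of \<open>C^{1/2} u\<close>. Its possibly unbounded inverse
  is harmless after the cross-covariance, since Cauchy-Schwarz bounds the latter by just this norm.

  A truncated SVD is the head of a complete SVD of \<open>K\<close>, so knowing an optimal span is
  not enough. Maximality is therefore used at first order, by rotating one singular vector: images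
  of the tail become orthogonal to images of the head, and no longer than these. Uniqueness is
  transported by \<open>reduced\<close> and \<open>Ahat\<close>, which are inverse to each other
  between solutions with the minimality property and admissible truncations.\<close>

lemma linear_term_zero:
  fixes a b :: real
  assumes "\<And>t. 0 \<le> t * a + t\<^sup>2 * b"
  shows "a = 0"
proof (rule ccontr)
  assume "a \<noteq> 0"
  define c where "c = 1 + \<bar>b\<bar>"
  have "0 < c" unfolding c_def by linarith
  \<comment> \<open>At \<open>t = -a/c\<close> the quadratic equals
    \<open>(a/c)^2 * (b - c)\<close>, which is negative because \<open>c\<close> was chosen larger
    than \<open>b\<close>.\<close>
  have "0 \<le> (-a/c) * a + (-a/c)\<^sup>2 * b" by (rule assms)
  also have "\<dots> = a\<^sup>2 / c\<^sup>2 * (b - c)"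
    using \<open>0 < c\<close> by (simp add: field_simps power2_eq_square)
  also have "\<dots> < 0"
    using \<open>a \<noteq> 0\<close> \<open>0 < c\<close> by (intro mult_pos_neg) (auto simp: c_def)
  finally show False by simp
qed

text \<open>The Riesz theorem and the projection theorem in one: the representing vector is the limit of
  a minimizing sequence of \<open>(norm w)\<^sup>2 / 2 - \<phi> w\<close>.\<close>

lemma riesz_on_subspace:
  fixes \<phi> :: "'a::{real_inner, banach} \<Rightarrow> real"
  assumes W: "subspace W"
    and add: "\<And>u v. u \<in> W \<Longrightarrow> v \<in> W \<Longrightarrow> \<phi> (u + v) = \<phi> u + \<phi> v"
    and scale: "\<And>c u. u \<in> W \<Longrightarrow> \<phi> (c *\<^sub>R u) = c * \<phi> u"
    and bound: "\<And>u. u \<in> W \<Longrightarrow> \<bar>\<phi> u\<bar> \<le> \<kappa> * norm u"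
  shows "\<exists>v\<in>closure W. \<forall>w\<in>W. v \<bullet> w = \<phi> w"
proof -
  define q where "q w = (norm w)\<^sup>2 / 2 - \<phi> w" for w
  define m where "m = Inf (q ` W)"
  have q_ge: "- \<kappa>\<^sup>2 / 2 \<le> q w" if "w \<in> W" for w
  proof -
    have "0 \<le> (norm w - \<kappa>)\<^sup>2" by simp
    then show ?thesis using bound[OF that] by (simp add: q_def power2_diff algebra_simps)
  qed
  have bdd: "bdd_below (q ` W)" using q_ge by (auto intro!: bdd_belowI)
  have ne: "q ` W \<noteq> {}" using subspace_0[OF W] by auto
  have m_le: "m \<le> q w" if "w \<in> W" for w
    unfolding m_def using bdd that by (simp add: cINF_lower)
  have "\<exists>w\<in>W. q w < m + inverse (real (Suc n))" for n
    using cINF_less_iff[of W q "m + inverse (real (Suc n))"] ne bdd by (auto simp: m_def)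
  then obtain w where w: "\<And>n. w n \<in> W" and qw: "\<And>n. q (w n) < m + inverse (real (Suc n))"
    by metis
  \<comment> \<open>The midpoint of \<open>u\<close> and \<open>v\<close> has value at least
    \<open>m\<close>, and the parallelogram identity turns this into a bound on \<open>u - v\<close>
    by the two excesses over \<open>m\<close>. The factor 4 explains the threshold
    \<open>\<epsilon>\<^sup>2 / 8\<close> per excess below.\<close>
  have par: "(norm (u - v))\<^sup>2 \<le> 4 * (q u - m + (q v - m))" if "u \<in> W" "v \<in> W" for u v
  proof -
    have uv: "u + v \<in> W" using that W by (simp add: subspace_add)
    then have "m \<le> q ((1/2) *\<^sub>R (u + v))" using W by (intro m_le subspace_scale)
    also have "q ((1/2) *\<^sub>R (u + v)) = (norm (u + v))\<^sup>2 / 8 - (\<phi> u + \<phi> v) / 2"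
      using scale[OF uv, of "1/2"] add[OF that] by (simp add: q_def power_mult_distrib power2_eq_square)
    finally show ?thesis
      by (simp add: q_def power2_norm_eq_inner algebra_simps inner_commute add_divide_distrib)
  qed
  have "Cauchy w"
  proof (rule metric_CauchyI)
    fix \<epsilon> :: real assume "0 < \<epsilon>"
    then obtain N where N: "inverse (real (Suc N)) < \<epsilon>\<^sup>2 / 8"
      using reals_Archimedean[of "\<epsilon>\<^sup>2 / 8"] by auto
    have "dist (w a) (w b) < \<epsilon>" if "N \<le> a" "N \<le> b" for a b
    proof -
      have "inverse (real (Suc a)) \<le> inverse (real (Suc N))" "inverse (real (Suc b)) \<le> inverse (real (Suc N))"
        using that by (simp_all add: field_simps)
      then have "q (w a) - m + (q (w b) - m) < \<epsilon>\<^sup>2 / 4"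
        using qw[of a] qw[of b] N by linarith
      then have "(norm (w a - w b))\<^sup>2 < \<epsilon>\<^sup>2"
        by (intro order.strict_trans1[OF par[OF w w]]) simp
      then show ?thesis using \<open>0 < \<epsilon>\<close> by (simp add: dist_norm power_less_imp_less_base)
    qed
    then show "\<exists>N. \<forall>a\<ge>N. \<forall>b\<ge>N. dist (w a) (w b) < \<epsilon>" by blast
  qed
  then obtain v where v: "w \<longlonglongrightarrow> v" using Cauchy_convergent convergentD by blast
  have "v \<in> closure W" using v w closure_sequential by blast
  moreover have "v \<bullet> h = \<phi> h" if h: "h \<in> W" for h
  proof -
    \<comment> \<open>First-order condition, obtained in the limit: moving \<open>w n\<close> by
      \<open>t *\<^sub>R h\<close> cannot bring \<open>q\<close> below \<open>m\<close>, and
      \<open>q (w n)\<close> exceeds \<open>m\<close> by less than \<open>1/(n+1)\<close>.\<close>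
    have "0 \<le> t * (v \<bullet> h - \<phi> h) + t\<^sup>2 * ((norm h)\<^sup>2 / 2)" for t
    proof (rule LIMSEQ_le_const)
      show "(\<lambda>n. inverse (real (Suc n)) + t * (w n \<bullet> h - \<phi> h) + t\<^sup>2 * ((norm h)\<^sup>2 / 2))
          \<longlonglongrightarrow> t * (v \<bullet> h - \<phi> h) + t\<^sup>2 * ((norm h)\<^sup>2 / 2)"
        by (rule tendsto_eq_intros v LIMSEQ_inverse_real_of_nat refl | simp)+
      have "0 \<le> inverse (real (Suc n)) + t * (w n \<bullet> h - \<phi> h) + t\<^sup>2 * ((norm h)\<^sup>2 / 2)" for n
      proof -
        have th: "t *\<^sub>R h \<in> W" using h W by (simp add: subspace_scale)
        then have "m \<le> q (w n + t *\<^sub>R h)" using w W by (intro m_le subspace_add)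
        also have "\<dots> = q (w n) + t * (w n \<bullet> h - \<phi> h) + t\<^sup>2 * ((norm h)\<^sup>2 / 2)"
          unfolding q_def add[OF w th] scale[OF h] power2_norm_eq_inner
          by (simp add: algebra_simps inner_commute power2_eq_square)
        finally show ?thesis using qw[of n] by linarith
      qed
      then show "\<exists>N. \<forall>n\<ge>N. 0 \<le> inverse (real (Suc n)) + t * (w n \<bullet> h - \<phi> h) + t\<^sup>2 * ((norm h)\<^sup>2 / 2)"
        by blast
    qed
    then show ?thesis using linear_term_zero by fastforce
  qed
  ultimately show ?thesis by blast
qed

lemma orthogonal_comp_iff: "v \<in> W\<^sup>\<bottom> \<longleftrightarrow> (\<forall>w\<in>W. v \<bullet> w = 0)"
  by (auto simp: orthogonal_comp_def orthogonal_def inner_commute)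

lemma closed_orthogonal_comp: "closed (W\<^sup>\<bottom>)"
proof -
  have "W\<^sup>\<bottom> = (\<Inter>w\<in>W. {v. v \<bullet> w = 0})" by (auto simp: orthogonal_comp_iff)
  then show ?thesis by (auto intro!: closed_Collect_eq continuous_intros)
qed

lemma inner_closure_zero:
  assumes "v \<in> closure W" and "\<And>w. w \<in> W \<Longrightarrow> w \<bullet> k = 0"
  shows "v \<bullet> k = 0"
proof -
  have "closure W \<subseteq> {v. v \<bullet> k = 0}"
    using assms(2) by (intro closure_minimal closed_Collect_eq continuous_intros) auto
  then show ?thesis using assms(1) by auto
qed

lemma proj_unique:
  assumes "subspace V" "p \<in> V" "v - p \<in> V\<^sup>\<bottom>"
  shows "proj V v = p"
  unfolding proj_def
proof (rule the_equality)
  fix p' assume p': "p' \<in> V \<and> v - p' \<in> V\<^sup>\<bottom>"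
  then have d: "p - p' \<in> V" using assms by (simp add: subspace_diff)
  have "(p - p') \<bullet> (p - p') = (v - p') \<bullet> (p - p') - (v - p) \<bullet> (p - p')"
    by (simp add: inner_diff_left inner_diff_right)
  also have "\<dots> = 0" using d p' assms(3) by (simp add: orthogonal_comp_iff)
  finally show "p' = p" by simp
qed (use assms in auto)

lemma
  fixes V :: "'a::{real_inner, banach} set"
  assumes V: "subspace V" "closed V"
  shows proj_in: "proj V v \<in> V" and proj_diff: "v - proj V v \<in> V\<^sup>\<bottom>"
proof -
  \<comment> \<open>The projection of \<open>v\<close> is the Riesz representative, within
    \<open>V\<close>, of the functional \<open>\<lambda>w. v \<bullet> w\<close>.\<close>
  have "\<exists>p\<in>closure V. \<forall>w\<in>V. p \<bullet> w = v \<bullet> w"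
    using V(1) by (rule riesz_on_subspace[where \<kappa> = "norm v"])
      (auto simp: inner_add_right Cauchy_Schwarz_ineq2)
  then obtain p where "p \<in> V" "\<forall>w\<in>V. p \<bullet> w = v \<bullet> w" using V(2) by auto
  then have p: "p \<in> V" "v - p \<in> V\<^sup>\<bottom>" by (auto simp: orthogonal_comp_iff inner_diff_left)
  with proj_unique[OF V(1) p] show "proj V v \<in> V" "v - proj V v \<in> V\<^sup>\<bottom>" by auto
qed

lemma proj_id: "subspace V \<Longrightarrow> v \<in> V \<Longrightarrow> proj V v = v"
  by (intro proj_unique) (auto simp: orthogonal_comp_iff)

lemma proj_zero: "subspace V \<Longrightarrow> v \<in> V\<^sup>\<bottom> \<Longrightarrow> proj V v = 0"
  by (intro proj_unique) (auto simp: subspace_0)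

lemma inner_proj_left:
  fixes V :: "'a::{real_inner, banach} set"
  assumes "subspace V" "closed V" "w \<in> V"
  shows "proj V v \<bullet> w = v \<bullet> w"
  using proj_diff[OF assms(1,2), of v] assms(3) by (simp add: orthogonal_comp_iff inner_diff_left)

lemma norm_proj_le:
  fixes V :: "'a::{real_inner, banach} set"
  assumes "subspace V" "closed V"
  shows "norm (proj V v) \<le> norm v"
proof -
  have "norm (proj V v) * norm (proj V v) = v \<bullet> proj V v"
    using inner_proj_left[OF assms proj_in[OF assms], of v v]
    by (simp flip: power2_norm_eq_inner power2_eq_square)
  also have "\<dots> \<le> norm v * norm (proj V v)" by (rule norm_cauchy_schwarz)
  finally show ?thesis by (cases "proj V v = 0") auto
qed

lemma bounded_linear_proj:
  fixes V :: "'a::{real_inner, banach} set"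
  assumes "subspace V" "closed V"
  shows "bounded_linear (proj V)"
proof (rule bounded_linear_intro[where K = 1])
  note mem = proj_in[OF assms] proj_diff[OF assms]
  show "proj V (u + v) = proj V u + proj V v" for u v
    using mem(1) subspace_add[OF subspace_orthogonal_comp mem(2)[of u] mem(2)[of v]] assms(1)
    by (intro proj_unique) (auto simp: subspace_add algebra_simps)
  show "proj V (c *\<^sub>R v) = c *\<^sub>R proj V v" for c v
    using mem(1) subspace_scale[OF subspace_orthogonal_comp mem(2)[of v], of c] assms(1)
    by (intro proj_unique) (auto simp: subspace_scale algebra_simps)
qed (use norm_proj_le[OF assms] in auto)

lemma orthogonal_comp_comp:
  fixes V :: "'a::{real_inner, banach} set"
  assumes "subspace V" "closed V"
  shows "V\<^sup>\<bottom>\<^sup>\<bottom> = V"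
proof
  show "V\<^sup>\<bottom>\<^sup>\<bottom> \<subseteq> V"
  proof
    fix v assume v: "v \<in> V\<^sup>\<bottom>\<^sup>\<bottom>"
    have "(v - proj V v) \<bullet> (v - proj V v) = v \<bullet> (v - proj V v) - (v - proj V v) \<bullet> proj V v"
      by (simp add: inner_diff_right inner_diff_left inner_commute)
    also have "\<dots> = 0" using v proj_diff[OF assms] proj_in[OF assms] by (simp add: orthogonal_comp_iff)
    finally show "v \<in> V" using proj_in[OF assms, of v] by simp
  qed
qed (rule orthogonal_comp_subset)

text \<open>For fixed \<open>u\<close> the Riesz theorem represents \<open>a u\<close>; uniqueness
  of the representative makes it linear in \<open>u\<close>, and testing with \<open>w = T u\<close>
  bounds it. Adjoints, covariances and square roots are all obtained from their forms in this
  way.\<close>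

lemma bounded_form_representation:
  fixes a :: "'a::{real_inner, banach} \<Rightarrow> 'b::{real_inner, banach} \<Rightarrow> real"
  assumes add_left: "\<And>u v w. a (u + v) w = a u w + a v w"
    and scale_left: "\<And>c u w. a (c *\<^sub>R u) w = c * a u w"
    and add_right: "\<And>u v w. a u (v + w) = a u v + a u w"
    and scale_right: "\<And>c u w. a u (c *\<^sub>R w) = c * a u w"
    and bound: "\<And>u w. \<bar>a u w\<bar> \<le> \<kappa> * norm u * norm w"
  obtains T where "bounded_linear T" "\<And>u w. T u \<bullet> w = a u w"
proof -
  have "\<exists>v. \<forall>w. v \<bullet> w = a u w" for u
    using riesz_on_subspace[of UNIV "a u" "\<kappa> * norm u"] add_right scale_right bound by auto
  then obtain T where T: "\<And>u w. T u \<bullet> w = a u w" by metis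
  have "bounded_linear T"
  proof (rule bounded_linear_intro[where K = "\<bar>\<kappa>\<bar>"])
    show "T (u + v) = T u + T v" for u v
      by (subst vector_eq_rdot[symmetric]) (simp add: T inner_add_left add_left)
    show "T (c *\<^sub>R u) = c *\<^sub>R T u" for c u
      by (subst vector_eq_rdot[symmetric]) (simp add: T scale_left)
    show "norm (T u) \<le> norm u * \<bar>\<kappa>\<bar>" for u
    proof (cases "T u = 0")
      case False
      have "norm (T u) * norm (T u) = a u (T u)"
        by (simp flip: T power2_norm_eq_inner power2_eq_square)
      also have "\<dots> \<le> \<kappa> * norm u * norm (T u)" using bound[of u "T u"] by simp
      finally have "norm (T u) \<le> \<kappa> * norm u" using False by simp
      also have "\<dots> \<le> norm u * \<bar>\<kappa>\<bar>" by (simp add: mult.commute[of "norm u"] mult_right_mono)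
      finally show ?thesis .
    qed simp
  qed
  with T show ?thesis using that by blast
qed

text \<open>\<open>adjoint\<close> is a choice operator and has its defining property only once some
  adjoint is exhibited. The form \<open>v \<bullet> T u\<close> supplies one, and uniqueness
  identifies it with \<open>adjoint T\<close>.\<close>

lemma
  fixes T :: "'a::{real_inner, banach} \<Rightarrow> 'b::{real_inner, banach}"
  assumes "bounded_linear T"
  shows inner_adjoint: "T u \<bullet> v = u \<bullet> adjoint T v"
    and bounded_linear_adjoint: "bounded_linear (adjoint T)"
proof -
  interpret T: bounded_linear T by fact
  obtain K where K: "\<And>x. norm (T x) \<le> norm x * K" using T.bounded by blast
  have "\<bar>v \<bullet> T u\<bar> \<le> K * norm v * norm u" for u v
    using order_trans[OF Cauchy_Schwarz_ineq2 mult_left_mono[OF K norm_ge_zero]]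
    by (simp add: algebra_simps)
  then obtain T' where T': "bounded_linear T'" "\<And>v u. T' v \<bullet> u = v \<bullet> T u"
    using bounded_form_representation[of "\<lambda>v u. v \<bullet> T u" K]
    by (auto simp: inner_add_left inner_add_right T.add T.scaleR)
  then have "adjoint T = T'" by (intro adjoint_unique) (simp add: inner_commute)
  then show "T u \<bullet> v = u \<bullet> adjoint T v" "bounded_linear (adjoint T)"
    using T' by (simp_all add: inner_commute)
qed

lemma adjoint_inner:
  fixes T :: "'a::{real_inner, banach} \<Rightarrow> 'b::{real_inner, banach}"
  shows "bounded_linear T \<Longrightarrow> adjoint T v \<bullet> u = v \<bullet> T u"
  using inner_adjoint[of T u v] by (simp add: inner_commute)

lemma subspace_ker: "bounded_linear T \<Longrightarrow> subspace (ker T)"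
  unfolding ker_def
  by (simp add: subspace_def bounded_linear.linear linear_add linear_scale linear_0)

lemma closed_ker: "bounded_linear T \<Longrightarrow> closed (ker T)"
  unfolding ker_def
  by (intro closed_Collect_eq linear_continuous_on continuous_on_const)

lemma subspace_range: "bounded_linear T \<Longrightarrow> subspace (range T)"
  by (simp add: bounded_linear.linear linear_subspace_image)

lemma ker_comp_eq_zero:
  assumes "v \<in> (ker T)\<^sup>\<bottom>" "T v = 0"
  shows "v = 0"
  using assms by (auto simp: orthogonal_comp_iff ker_def)

lemma ker_comp_inj:
  assumes "bounded_linear T" "u \<in> (ker T)\<^sup>\<bottom>" "v \<in> (ker T)\<^sup>\<bottom>" "T u = T v"
  shows "u = v"
proof -
  interpret T: bounded_linear T by fact
  have "u - v \<in> (ker T)\<^sup>\<bottom>" using assms by (simp add: subspace_diff subspace_orthogonal_comp)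
  then show ?thesis using ker_comp_eq_zero[of "u - v" T] assms(4) by (simp add: T.diff)
qed

lemma mp_inv_eq:
  fixes T :: "'a::{real_inner, banach} \<Rightarrow> 'b::{real_inner, banach}"
  assumes T: "bounded_linear T" and v: "v \<in> (ker T)\<^sup>\<bottom>" and k: "k \<in> (range T)\<^sup>\<bottom>"
  shows "mp_inv T (T v + k) = v"
proof -
  interpret T: bounded_linear T by fact
  have "T v + k \<in> mp_dom T" using k by (auto simp: mp_dom_def)
  moreover have "(THE v'. v' \<in> (ker T)\<^sup>\<bottom> \<and> (\<exists>k'\<in>(range T)\<^sup>\<bottom>. T v + k = T v' + k')) = v"
  proof (rule the_equality)
    fix v' assume "v' \<in> (ker T)\<^sup>\<bottom> \<and> (\<exists>k'\<in>(range T)\<^sup>\<bottom>. T v + k = T v' + k')"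
    then obtain k' where v': "v' \<in> (ker T)\<^sup>\<bottom>" and k': "k' \<in> (range T)\<^sup>\<bottom>"
      and eq: "T v + k = T v' + k'" by auto
    \<comment> \<open>This vector lies in \<open>range T\<close> and in its orthogonal complement,
      hence vanishes.\<close>
    have "T (v - v') = k' - k" using eq by (simp add: T.diff algebra_simps)
    moreover have "(k' - k) \<bullet> T (v - v') = 0"
      using k k' by (auto simp: orthogonal_comp_iff inner_diff_left)
    ultimately have "T (v - v') = 0" by simp
    then show "v' = v" using ker_comp_inj[OF T v v'] by (simp add: T.diff)
  qed (use v k in auto)
  ultimately show ?thesis by (simp add: mp_inv_def)
qed

lemma mp_inv_apply:
  fixes T :: "'a::{real_inner, banach} \<Rightarrow> 'b::{real_inner, banach}"
  assumes "bounded_linear T" "v \<in> (ker T)\<^sup>\<bottom>"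
  shows "mp_inv T (T v) = v"
  using mp_inv_eq[OF assms, of 0] by (simp add: subspace_0 subspace_orthogonal_comp)

lemma
  fixes T :: "'a::{real_inner, banach} \<Rightarrow> 'b::{real_inner, banach}"
  assumes T: "bounded_linear T" and g: "g \<in> range T"
  shows apply_mp_inv: "T (mp_inv T g) = g" and mp_inv_in: "mp_inv T g \<in> (ker T)\<^sup>\<bottom>"
proof -
  interpret T: bounded_linear T by fact
  obtain u where u: "g = T u" using g by auto
  \<comment> \<open>Removing the kernel component of an arbitrary preimage yields the one preimage
    that is orthogonal to the kernel.\<close>
  define v where "v = u - proj (ker T) u"
  have v: "v \<in> (ker T)\<^sup>\<bottom>"
    unfolding v_def by (rule proj_diff[OF subspace_ker[OF T] closed_ker[OF T]])
  have "T v = g"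
    using proj_in[OF subspace_ker[OF T] closed_ker[OF T], of u] by (simp add: v_def T.diff ker_def u)
  then show "T (mp_inv T g) = g" "mp_inv T g \<in> (ker T)\<^sup>\<bottom>" using mp_inv_apply[OF T v] v by auto
qed

text \<open>Vectors of \<open>(ker T)\<^sup>\<bottom>\<close> are determined by their images under
  \<open>T\<close>, so linearity can be checked after applying \<open>T\<close>. Staying inside
  \<open>range T\<close> keeps the dummy value of \<open>mp_inv\<close> out of play.\<close>

lemma linear_mp_inv:
  fixes T :: "'a::{real_inner, banach} \<Rightarrow> 'b::{real_inner, banach}"
  assumes T: "bounded_linear T" and L: "linear L" "range L \<subseteq> range T"
  shows "linear (mp_inv T \<circ> L)"
proof -
  interpret T: bounded_linear T by fact
  have mem: "L v \<in> range T" for v using L(2) by auto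
  have eq: "T (mp_inv T (L v)) = L v" and perp: "mp_inv T (L v) \<in> (ker T)\<^sup>\<bottom>" for v
    using apply_mp_inv[OF T mem] mp_inv_in[OF T mem] by auto
  show ?thesis
  proof (rule linearI)
    show "(mp_inv T \<circ> L) (u + v) = (mp_inv T \<circ> L) u + (mp_inv T \<circ> L) v" for u v
      unfolding comp_apply
      by (rule ker_comp_inj[OF T])
        (simp_all add: perp eq T.add subspace_add subspace_orthogonal_comp flip: linear_add[OF L(1)])
    show "(mp_inv T \<circ> L) (c *\<^sub>R v) = c *\<^sub>R (mp_inv T \<circ> L) v" for c v
      unfolding comp_apply
      by (rule ker_comp_inj[OF T])
        (simp_all add: perp eq T.scaleR subspace_scale subspace_orthogonal_comp flip: linear_scale[OF L(1)])
  qed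
qed

section \<open>Orthonormal systems and Gram-Schmidt\<close>

definition orthonormal_on :: "'i set \<Rightarrow> ('i \<Rightarrow> 'a::real_inner) \<Rightarrow> bool" where
  "orthonormal_on I e \<longleftrightarrow> (\<forall>i\<in>I. \<forall>j\<in>I. e i \<bullet> e j = (if i = j then 1 else 0))"

lemma orthonormal_onD: "orthonormal_on I e \<Longrightarrow> i \<in> I \<Longrightarrow> j \<in> I \<Longrightarrow> e i \<bullet> e j = (if i = j then 1 else 0)"
  by (auto simp: orthonormal_on_def)

lemma orthonormal_on_mono: "orthonormal_on I e \<Longrightarrow> J \<subseteq> I \<Longrightarrow> orthonormal_on J e"
  unfolding orthonormal_on_def by blast

lemma orthonormal_upto_iff: "orthonormal_upto N e \<longleftrightarrow> orthonormal_on {i. enat i < N} e"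
  by (auto simp: orthonormal_on_def orthonormal_upto_def)

lemma orthonormal_on_norm: "orthonormal_on I e \<Longrightarrow> i \<in> I \<Longrightarrow> norm (e i) = 1"
  by (simp add: orthonormal_on_def norm_eq_1)

lemma inner_sum_orthonormal:
  assumes "orthonormal_on I e" "finite I" "j \<in> I"
  shows "(\<Sum>i\<in>I. c i *\<^sub>R e i) \<bullet> e j = c j"
proof -
  have "(\<Sum>i\<in>I. c i *\<^sub>R e i) \<bullet> e j = (\<Sum>i\<in>I. if i = j then c i else 0)"
    unfolding inner_sum_left using assms(1,3) by (intro sum.cong) (auto simp: orthonormal_on_def)
  then show ?thesis using assms by simp
qed

lemma norm_sum_orthonormal:
  assumes "orthonormal_on I e" "finite I"
  shows "(norm (\<Sum>i\<in>I. c i *\<^sub>R e i))\<^sup>2 = (\<Sum>i\<in>I. (c i)\<^sup>2)"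
  unfolding power2_norm_eq_inner inner_sum_right
  by (intro sum.cong) (simp_all add: inner_sum_orthonormal[OF assms] power2_eq_square)

lemma orthonormal_remainder:
  assumes "orthonormal_on I e" "finite I" "j \<in> I"
  shows "(v - (\<Sum>i\<in>I. (v \<bullet> e i) *\<^sub>R e i)) \<bullet> e j = 0"
  using inner_sum_orthonormal[OF assms, of "\<lambda>i. v \<bullet> e i"] by (simp add: inner_diff_left)

lemma norm_orthonormal_remainder:
  assumes "orthonormal_on I e" "finite I"
  shows "(norm (v - (\<Sum>i\<in>I. (v \<bullet> e i) *\<^sub>R e i)))\<^sup>2 = (norm v)\<^sup>2 - (\<Sum>i\<in>I. (v \<bullet> e i)\<^sup>2)"
proof -
  define p where "p = (\<Sum>i\<in>I. (v \<bullet> e i) *\<^sub>R e i)"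
  have "v \<bullet> p = (\<Sum>i\<in>I. (v \<bullet> e i)\<^sup>2)" by (simp add: p_def inner_sum_right power2_eq_square)
  moreover have "p \<bullet> p = (\<Sum>i\<in>I. (v \<bullet> e i)\<^sup>2)"
    using norm_sum_orthonormal[OF assms] by (simp add: p_def power2_norm_eq_inner)
  ultimately show ?thesis
    unfolding p_def[symmetric] by (simp add: power2_norm_eq_inner inner_diff_left inner_diff_right inner_commute)
qed

lemma bessel:
  assumes "orthonormal_on I e" "finite I"
  shows "(\<Sum>i\<in>I. (v \<bullet> e i)\<^sup>2) \<le> (norm v)\<^sup>2"
  using norm_orthonormal_remainder[OF assms, of v] by (metis diff_ge_0_iff_ge zero_le_power2)

lemma norm_orthonormal_remainder_le:
  assumes "orthonormal_on I e" "finite I"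
  shows "norm (v - (\<Sum>i\<in>I. (v \<bullet> e i) *\<^sub>R e i)) \<le> norm v"
proof (rule power2_le_imp_le)
  show "(norm (v - (\<Sum>i\<in>I. (v \<bullet> e i) *\<^sub>R e i)))\<^sup>2 \<le> (norm v)\<^sup>2"
    using norm_orthonormal_remainder[OF assms, of v] sum_nonneg[of I "\<lambda>i. (v \<bullet> e i)\<^sup>2"] by simp
qed simp

lemma orthonormal_on_extend:
  fixes h :: "nat \<Rightarrow> 'a::real_inner"
  assumes "orthonormal_on {..<m} h" "norm c = 1" "\<And>i. i < m \<Longrightarrow> c \<bullet> h i = 0"
  shows "orthonormal_on {..<Suc m} (h(m := c))"
  using assms by (auto simp: orthonormal_on_def less_Suc_eq inner_commute norm_eq_1)

text \<open>Gram-Schmidt by induction on \<open>F\<close>: a new vector is dropped if its remainder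
  \<open>w\<close> vanishes and contributes \<open>w / norm w\<close> otherwise. \<open>F\<close>
  may be dependent, hence only \<open>m \<le> card F\<close>.\<close>

lemma orthonormal_basis_of_span:
  fixes F :: "'a::real_inner set"
  assumes "finite F"
  obtains m h where "m \<le> card F" "orthonormal_on {..<m} h" "h ` {..<m} \<subseteq> span F"
    "\<forall>v\<in>span F. (\<Sum>i<m. (v \<bullet> h i) *\<^sub>R h i) = v"
proof -
  have "\<exists>m h. m \<le> card F \<and> orthonormal_on {..<m} h \<and> (\<forall>i<m. h i \<in> span F) \<and>
    (\<forall>v\<in>F. (\<Sum>i<m. (v \<bullet> h i) *\<^sub>R h i) = v)"
    using assms
  proof (induction F)
    case empty
    then show ?case by (auto simp: orthonormal_on_def)
  next
    case (insert u F)
    then obtain m h where m: "m \<le> card F" and h: "orthonormal_on {..<m} h"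
      and span: "\<And>i. i < m \<Longrightarrow> h i \<in> span F"
      and exp: "\<And>v. v \<in> F \<Longrightarrow> (\<Sum>i<m. (v \<bullet> h i) *\<^sub>R h i) = v" by auto
    define w where "w = u - (\<Sum>i<m. (u \<bullet> h i) *\<^sub>R h i)"
    have span': "\<And>i. i < m \<Longrightarrow> h i \<in> span (insert u F)"
      using span span_mono[of F "insert u F"] by auto
    show ?case
    proof (cases "w = 0")
      case True
      then show ?thesis using m h span' exp insert.hyps
        by (intro exI[of _ m] exI[of _ h]) (auto simp: w_def)
    next
      case False
      define c where "c = (1 / norm w) *\<^sub>R w"
      have w0: "w \<bullet> h i = 0" if "i < m" for i
        unfolding w_def using that orthonormal_remainder[OF h] by simp
      have c: "norm c = 1" "\<And>i. i < m \<Longrightarrow> c \<bullet> h i = 0" using False w0 by (auto simp: c_def)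
      have w_span: "w \<in> span (insert u F)"
        unfolding w_def using span' by (intro span_diff span_sum span_scale) (auto simp: span_base)
      have "v \<bullet> c = 0" if "v \<in> F" for v
        by (subst exp[OF that, symmetric])
          (simp add: inner_sum_left inner_sum_right inner_commute[of _ c] c(2))
      moreover have "(u \<bullet> c) *\<^sub>R c = w"
      proof -
        have "u \<bullet> w = w \<bullet> w"
        proof -
          have "u \<bullet> w = (w + (\<Sum>i<m. (u \<bullet> h i) *\<^sub>R h i)) \<bullet> w" by (simp add: w_def)
          also have "\<dots> = w \<bullet> w" by (simp add: inner_add_left inner_sum_left inner_commute[of "h _" w] w0)
          finally show ?thesis .
        qed
        then have "u \<bullet> w = norm w * norm w" by (metis power2_eq_square power2_norm_eq_inner)
        then have "u \<bullet> c = norm w" using False by (simp add: c_def)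
        then show ?thesis using False by (simp add: c_def)
      qed
      ultimately have "(\<Sum>i<Suc m. (v \<bullet> (h(m := c)) i) *\<^sub>R (h(m := c)) i) = v"
        if "v \<in> insert u F" for v
        using that exp by (auto simp: w_def)
      moreover have "(h(m := c)) i \<in> span (insert u F)" if "i < Suc m" for i
        using that span' w_span by (auto simp: less_Suc_eq c_def span_scale)
      ultimately show ?thesis
        using m insert.hyps orthonormal_on_extend[OF h c]
        by (intro exI[of _ "Suc m"] exI[of _ "h(m := c)"]) (simp del: sum.lessThan_Suc fun_upd_apply)
    qed
  qed
  then obtain m h where mh: "m \<le> card F" "orthonormal_on {..<m} h" "h ` {..<m} \<subseteq> span F"
    and exp: "\<And>v. v \<in> F \<Longrightarrow> (\<Sum>i<m. (v \<bullet> h i) *\<^sub>R h i) = v" by auto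
  have "(\<Sum>i<m. (v \<bullet> h i) *\<^sub>R h i) = v" if "v \<in> span F" for v
    using that
  proof (induction rule: span_induct_alt)
    case (step c x y)
    have "(\<Sum>i<m. ((c *\<^sub>R x + y) \<bullet> h i) *\<^sub>R h i)
        = c *\<^sub>R (\<Sum>i<m. (x \<bullet> h i) *\<^sub>R h i) + (\<Sum>i<m. (y \<bullet> h i) *\<^sub>R h i)"
      by (simp add: inner_add_left scaleR_add_left sum.distrib scaleR_sum_right)
    then show ?case by (simp only: exp[OF step(1)] step(2))
  qed simp
  with mh show ?thesis using that by blast
qed

section \<open>Compact operators and their singular value decomposition\<close>

text \<open>Compactness, in the form in which it is verified for covariance operators: up to \<open>\<epsilon>\<close>, the
  operator vanishes on a subspace of finite codimension.\<close>

definition compact_op :: "('a::{real_inner, banach} \<Rightarrow> 'b::{real_inner, banach}) \<Rightarrow> bool" where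
  "compact_op T \<longleftrightarrow> bounded_linear T \<and>
     (\<forall>\<epsilon>>0. \<exists>F. finite F \<and> (\<forall>v. (\<forall>u\<in>F. v \<bullet> u = 0) \<longrightarrow> norm (T v) \<le> \<epsilon> * norm v))"

lemma compact_opD:
  assumes "compact_op T" "0 < \<epsilon>"
  obtains F where "finite F" "\<And>v. (\<And>u. u \<in> F \<Longrightarrow> v \<bullet> u = 0) \<Longrightarrow> norm (T v) \<le> \<epsilon> * norm v"
  using assms unfolding compact_op_def by metis

text \<open>The set is a Minkowski sum of \<open>m\<close> segments, built up one compact summand at
  a time. It will contain the images of the finite-dimensional components of vectors in the unit
  ball.\<close>

lemma compact_bounded_combinations:
  fixes u :: "nat \<Rightarrow> 'a::real_normed_vector"
  shows "compact {\<Sum>i<m. c i *\<^sub>R u i | c. \<forall>i<m. \<bar>c i\<bar> \<le> (1::real)}"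
proof (induction m)
  case (Suc m)
  let ?S = "\<lambda>m. {\<Sum>i<m. c i *\<^sub>R u i | c. \<forall>i<m. \<bar>c i\<bar> \<le> (1::real)}"
  let ?L = "(\<lambda>t. t *\<^sub>R u m) ` {-1..1::real}"
  have "compact ?L" by (intro compact_continuous_image continuous_intros) auto
  then have "compact {x + y | x y. x \<in> ?S m \<and> y \<in> ?L}" by (rule compact_sums[OF Suc])
  also have "{x + y | x y. x \<in> ?S m \<and> y \<in> ?L} = ?S (Suc m)"
  proof (intro equalityI subsetI)
    fix z assume "z \<in> {x + y | x y. x \<in> ?S m \<and> y \<in> ?L}"
    then obtain c t where z: "z = (\<Sum>i<m. c i *\<^sub>R u i) + t *\<^sub>R u m" and c: "\<forall>i<m. \<bar>c i\<bar> \<le> 1"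
      and t: "\<bar>t\<bar> \<le> 1" by auto
    have "z = (\<Sum>i<Suc m. (c(m := t)) i *\<^sub>R u i)" unfolding z by simp
    moreover have "\<forall>i<Suc m. \<bar>(c(m := t)) i\<bar> \<le> 1" using c t by (auto simp: less_Suc_eq)
    ultimately show "z \<in> ?S (Suc m)" by blast
  next
    fix z assume "z \<in> ?S (Suc m)"
    then obtain c where z: "z = (\<Sum>i<m. c i *\<^sub>R u i) + c m *\<^sub>R u m" and c: "\<forall>i<Suc m. \<bar>c i\<bar> \<le> 1"
      by auto
    have "c m *\<^sub>R u m \<in> ?L" using c by (intro imageI) (auto simp: abs_le_iff dest!: spec[of _ m])
    moreover have "(\<Sum>i<m. c i *\<^sub>R u i) \<in> ?S m" using c by auto
    ultimately show "z \<in> {x + y | x y. x \<in> ?S m \<and> y \<in> ?L}" unfolding z by blast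
  qed
  finally show ?case .
qed simp

text \<open>Total boundedness in three thirds of \<open>e\<close>: one for a finite net of the
  images of components in \<open>span F\<close>, one for the remainder, which \<open>T\<close>
  shrinks, and one to pass from closed balls, needed for the closure, back to open ones.\<close>

lemma compact_closure_image:
  assumes "compact_op T"
  shows "compact (closure (T ` cball 0 1))"
proof -
  have tb: "\<exists>k. finite k \<and> closure (T ` cball 0 1) \<subseteq> (\<Union>x\<in>k. ball x e)" if "0 < e" for e
  proof -
  interpret T: bounded_linear T using assms by (simp add: compact_op_def)
  obtain F where "finite F" and F: "\<And>v. (\<And>u. u \<in> F \<Longrightarrow> v \<bullet> u = 0) \<Longrightarrow> norm (T v) \<le> e / 3 * norm v"
    using compact_opD[OF assms, of "e / 3"] \<open>0 < e\<close> by auto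
  obtain m :: nat and h where h: "orthonormal_on {..<m} h"
    and exp: "\<forall>v\<in>span F. (\<Sum>i<m. (v \<bullet> h i) *\<^sub>R h i) = v"
    by (rule orthonormal_basis_of_span[OF \<open>finite F\<close>]) (rule that)
  let ?C = "{\<Sum>i<m. c i *\<^sub>R T (h i) | c. \<forall>i<m. \<bar>c i\<bar> \<le> (1::real)}"
  obtain k where k: "finite k" "?C \<subseteq> (\<Union>x\<in>k. ball x (e / 3))"
    using compact_bounded_combinations[of "\<lambda>i. T (h i)" m, unfolded compact_eq_totally_bounded,
        THEN conjunct2, rule_format, of "e / 3"] \<open>0 < e\<close> by auto
  have "T v \<in> (\<Union>x\<in>k. cball x (2 * e / 3))" if v: "norm v \<le> 1" for v
  proof -
    define p where "p = (\<Sum>i<m. (v \<bullet> h i) *\<^sub>R h i)"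
    have "\<bar>v \<bullet> h i\<bar> \<le> 1" if "i < m" for i
      using Cauchy_Schwarz_ineq2[of v "h i"] orthonormal_on_norm[OF h, of i] v that by simp
    then have "T p \<in> ?C" by (auto simp: p_def T.sum T.scaleR)
    then obtain x where x: "x \<in> k" "dist x (T p) < e / 3" using k(2) by auto
    have "(v - p) \<bullet> u = 0" if "u \<in> F" for u
    proof -
      have "(v - p) \<bullet> (\<Sum>i<m. (u \<bullet> h i) *\<^sub>R h i) = 0"
        unfolding inner_sum_right p_def using orthonormal_remainder[OF h] by simp
      then show ?thesis using exp span_base[OF that] by simp
    qed
    then have "norm (T (v - p)) \<le> e / 3 * norm (v - p)" using F by blast
    also have "\<dots> \<le> e / 3 * 1"
      using norm_orthonormal_remainder_le[OF h, of v] v \<open>0 < e\<close>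
      by (intro mult_left_mono) (auto simp: p_def)
    finally have "dist (T p) (T v) \<le> e / 3" by (simp add: dist_norm norm_minus_commute T.diff)
    then have "dist x (T v) \<le> 2 * e / 3" using dist_triangle[of x "T v" "T p"] x(2) by linarith
    then show ?thesis using x(1) by auto
  qed
  then have "T ` cball 0 1 \<subseteq> (\<Union>x\<in>k. cball x (2 * e / 3))" by auto
  then have "closure (T ` cball 0 1) \<subseteq> (\<Union>x\<in>k. cball x (2 * e / 3))"
    using k(1) by (intro closure_minimal closed_UN) auto
  also have "\<dots> \<subseteq> (\<Union>x\<in>k. ball x e)" using \<open>0 < e\<close> by (intro UN_mono) (auto)
  finally show ?thesis using k(1) by blast
  qed
  then show ?thesis by (simp add: compact_eq_totally_bounded complete_eq_closed)
qed

lemma compact_op_convergent_subseq: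
  assumes "compact_op T" "\<And>n. norm (v n) \<le> 1"
  obtains s l where "strict_mono (s :: nat \<Rightarrow> nat)" "(\<lambda>n. T (v (s n))) \<longlonglongrightarrow> l"
proof -
  have "\<forall>n. T (v n) \<in> closure (T ` cball 0 1)"
    using assms(2) closure_subset by (metis image_eqI mem_cball_0 subsetD)
  then obtain l s where "strict_mono (s :: nat \<Rightarrow> nat)" "((\<lambda>n. T (v n)) \<circ> s) \<longlonglongrightarrow> l"
    using compact_closure_image[OF assms(1)] unfolding compact_eq_seq_compact_metric seq_compact_def by metis
  then show ?thesis using that by (simp add: comp_def)
qed

text \<open>Compactness makes the images of a norming sequence converge along a subsequence. The
  parallelogram law then makes the vectors themselves converge, so that weak compactness of the ball
  is avoided.\<close>

lemma compact_op_norm_attained: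
  assumes T: "compact_op T" and V: "subspace V" "closed V" and "z \<in> V" "T z \<noteq> 0"
  shows "\<exists>e\<in>V. norm e = 1 \<and> T e \<noteq> 0 \<and> (\<forall>v\<in>V. norm (T v) \<le> norm (T e) * norm v)"
proof -
  interpret T: bounded_linear T using T by (simp add: compact_op_def)
  obtain K where K: "\<And>x. norm (T x) \<le> norm x * K" "0 \<le> K" using T.nonneg_bounded by blast
  define B where "B = {v\<in>V. norm v \<le> 1}"
  define M where "M = (SUP v\<in>B. norm (T v))"
  have "norm (T v) \<le> K" if "v \<in> B" for v
    using order_trans[OF K(1) mult_right_mono[of "norm v" 1 K]] that K(2) by (simp add: B_def)
  then have bdd: "bdd_above ((\<lambda>v. norm (T v)) ` B)" by (auto intro!: bdd_aboveI)
  have B0: "0 \<in> B" using V(1) by (simp add: B_def subspace_0)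
  have M_ub: "norm (T v) \<le> M * norm v" if "v \<in> V" for v
  proof (cases "v = 0")
    case False
    have "(1 / norm v) *\<^sub>R v \<in> B" using that V(1) False by (simp add: B_def subspace_scale)
    then have "norm (T ((1 / norm v) *\<^sub>R v)) \<le> M" unfolding M_def using bdd by (rule cSUP_upper)
    then show ?thesis using False by (simp add: T.scaleR field_simps)
  qed (simp add: T.zero)
  have "z \<noteq> 0" using assms(5) T.zero by auto
  then have "0 < M" using M_ub[OF assms(4)] assms(5)
    by (metis linorder_not_le mult_nonpos_nonneg norm_ge_zero norm_le_zero_iff order_trans)
  have "\<exists>v\<in>B. M - inverse (real (Suc n)) < norm (T v)" for n
    using less_cSUP_iff[of B "\<lambda>v. norm (T v)" "M - inverse (real (Suc n))"] bdd B0
    by (auto simp: M_def)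
  then obtain v where v: "\<And>n. v n \<in> B" "\<And>n. M - inverse (real (Suc n)) < norm (T (v n))" by metis
  have "norm (v n) \<le> 1" for n using v(1) by (simp add: B_def)
  then obtain s l where s: "strict_mono s" and l: "(\<lambda>n. T (v (s n))) \<longlonglongrightarrow> l"
    using compact_op_convergent_subseq[OF T] by metis
  define w where "w n = v (s n)" for n
  have w: "w n \<in> V" "norm (w n) \<le> 1" for n using v(1) by (auto simp: w_def B_def)
  have "M - inverse (real (Suc n)) \<le> norm (T (w n))" for n
  proof -
    have "inverse (real (Suc (s n))) \<le> inverse (real (Suc n))"
      using seq_suble[OF s, of n] by (intro le_imp_inverse_le) auto
    then show ?thesis using v(2)[of "s n"] unfolding w_def by linarith
  qed
  moreover have "(\<lambda>n. M - inverse (real (Suc n))) \<longlonglongrightarrow> M"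
    by (rule tendsto_eq_intros LIMSEQ_inverse_real_of_nat refl | simp)+
  moreover have lw: "(\<lambda>n. T (w n)) \<longlonglongrightarrow> l" using l by (simp add: w_def)
  ultimately have "M \<le> norm l" by (intro LIMSEQ_le[OF _ tendsto_norm]) auto
  have "Cauchy w"
  proof (rule metric_CauchyI)
    fix \<epsilon> :: real assume "0 < \<epsilon>"
    \<comment> \<open>\<open>\<delta> \<le> M\<close> keeps \<open>2 - 2 * \<delta> / M\<close>
      nonnegative, so that it may be squared; the other bound makes the final estimate
      \<open>8 * \<delta> / M\<close> smaller than \<open>\<epsilon>\<^sup>2\<close>.\<close>
    define \<delta> where "\<delta> = min M (\<epsilon>\<^sup>2 * M / 9)"
    have "0 < \<delta>" using \<open>0 < M\<close> \<open>0 < \<epsilon>\<close> by (simp add: \<delta>_def)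
    then obtain n0 where n0: "\<And>n. n \<ge> n0 \<Longrightarrow> dist (T (w n)) l < \<delta>"
      using lw unfolding lim_sequentially by metis
    have "dist (w a) (w b) < \<epsilon>" if "n0 \<le> a" "n0 \<le> b" for a b
    proof -
      \<comment> \<open>Both images are close to \<open>l\<close>, whose norm is at least
        \<open>M\<close>. Hence \<open>w a + w b\<close> has norm close to 2, and two vectors of the
        unit ball with such a sum are close to each other.\<close>
      have "2 *\<^sub>R l = T (w a + w b) + (l - T (w a)) + (l - T (w b))" by (simp add: T.add scaleR_2)
      then have "norm (2 *\<^sub>R l) \<le> norm (T (w a + w b)) + norm (l - T (w a)) + norm (l - T (w b))"
        by (metis norm_triangle_mono norm_triangle_ineq order_refl)
      then have "2 * M - 2 * \<delta> \<le> norm (T (w a + w b))"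
        using n0[OF that(1)] n0[OF that(2)] \<open>M \<le> norm l\<close> by (simp add: dist_norm norm_minus_commute)
      also have "\<dots> \<le> M * norm (w a + w b)" using w V(1) by (intro M_ub subspace_add)
      finally have "2 - 2 * \<delta> / M \<le> norm (w a + w b)" using \<open>0 < M\<close> by (simp add: field_simps)
      moreover have "0 \<le> 2 - 2 * \<delta> / M" using \<open>0 < M\<close> by (simp add: \<delta>_def field_simps)
      ultimately have "(2 - 2 * \<delta> / M)\<^sup>2 \<le> (norm (w a + w b))\<^sup>2" by (rule power_mono)
      moreover have "4 - 8 * (\<delta> / M) \<le> (2 - 2 * \<delta> / M)\<^sup>2" by (simp add: power2_diff)
      moreover have "(norm (w a + w b))\<^sup>2 + (norm (w a - w b))\<^sup>2 = 2 * (norm (w a))\<^sup>2 + 2 * (norm (w b))\<^sup>2"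
        by (simp add: power2_norm_eq_inner inner_add_left inner_add_right inner_diff_left inner_diff_right)
      moreover have "(norm (w a))\<^sup>2 \<le> 1" "(norm (w b))\<^sup>2 \<le> 1" using w(2) by (simp_all add: power_le_one)
      moreover have "\<delta> / M \<le> \<epsilon>\<^sup>2 / 9" using \<open>0 < M\<close> by (simp add: \<delta>_def field_simps)
      moreover have "0 < \<epsilon>\<^sup>2" using \<open>0 < \<epsilon>\<close> by simp
      ultimately have "(norm (w a - w b))\<^sup>2 < \<epsilon>\<^sup>2" by linarith
      then show ?thesis using \<open>0 < \<epsilon>\<close> by (simp add: dist_norm power_less_imp_less_base)
    qed
    then show "\<exists>n0. \<forall>a\<ge>n0. \<forall>b\<ge>n0. dist (w a) (w b) < \<epsilon>" by blast
  qed
  then obtain e where e: "w \<longlonglongrightarrow> e" using Cauchy_convergent convergentD by blast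
  have "e \<in> V" using closed_sequentially[OF V(2)] w(1) e by blast
  have "norm e \<le> 1" using LIMSEQ_le_const2[OF tendsto_norm[OF e]] w(2) by blast
  have "T e = l" using LIMSEQ_unique[OF T.tendsto[OF e] lw] .
  have "M * 1 \<le> M * norm e" using M_ub[OF \<open>e \<in> V\<close>] \<open>T e = l\<close> \<open>M \<le> norm l\<close> by simp
  then have "norm e = 1" using \<open>0 < M\<close> \<open>norm e \<le> 1\<close> by auto
  moreover have "norm (T e) = M" using M_ub[OF \<open>e \<in> V\<close>] \<open>T e = l\<close> \<open>M \<le> norm l\<close> \<open>norm e = 1\<close> by simp
  ultimately show ?thesis using \<open>e \<in> V\<close> M_ub \<open>0 < M\<close> by (intro bexI[of _ e]) auto
qed

text \<open>Primitive recursion accumulates the set of earlier values. The greedy choice of singular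
  vectors depends on nothing but this set.\<close>

lemma course_of_values_recursion: "\<exists>e :: nat \<Rightarrow> 'a. \<forall>n. e n = G (e ` {..<n})"
proof -
  define A where "A = rec_nat {} (\<lambda>n S. insert (G S) S)"
  have "A n = (\<lambda>k. G (A k)) ` {..<n}" for n
    by (induction n) (simp_all add: A_def lessThan_Suc)
  then have "G (A n) = G ((\<lambda>k. G (A k)) ` {..<n})" for n by (rule arg_cong)
  then show ?thesis by (intro exI[of _ "\<lambda>n. G (A n)"]) blast
qed

text \<open>Converts the stopping condition of the greedy construction into the length
  \<open>N\<close> of the decomposition: the first failure of \<open>D\<close>, or
  \<open>\<infinity>\<close> if there is none.\<close>

lemma enat_initial_segment:
  assumes "\<And>n. D (Suc n) \<Longrightarrow> D n"
  shows "\<exists>N. \<forall>n. enat n < N \<longleftrightarrow> D n"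
proof (cases "\<forall>n. D n")
  case True
  then show ?thesis by (intro exI[of _ \<infinity>]) simp
next
  case False
  define L where "L = (LEAST n. \<not> D n)"
  have "\<not> D L" using False unfolding L_def by (metis (mono_tags, lifting) LeastI)
  have "\<not> D n" if "L \<le> n" for n
    using that by (induction rule: dec_induct) (use \<open>\<not> D L\<close> assms in auto)
  moreover have "D n" if "n < L" for n using that not_less_Least unfolding L_def by blast
  ultimately show ?thesis by (intro exI[of _ "enat L"]) (metis enat_ord_simps(2) not_le)
qed

text \<open>Greedy construction: \<open>e n\<close> maximizes \<open>norm (T v)\<close> over unit
  vectors orthogonal to its predecessors, until \<open>T\<close> vanishes on what is left. The
  \<open>f n\<close> are the normalized images; their orthogonality is the first-order condition of
  the maximum, so no spectral theorem is needed.\<close>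

theorem compact_op_svd:
  assumes T: "compact_op T"
  shows "\<exists>N \<sigma> e f. is_svd T N \<sigma> e f"
proof -
  interpret T: bounded_linear T using T by (simp add: compact_op_def)
  define V where "V E = {v. \<forall>u\<in>E. v \<bullet> u = 0}" for E :: "'a set"
  have V: "subspace (V E)" "closed (V E)" for E
  proof -
    have "V E = E\<^sup>\<bottom>" by (auto simp: V_def orthogonal_comp_iff)
    then show "subspace (V E)" "closed (V E)"
      by (simp_all add: subspace_orthogonal_comp closed_orthogonal_comp)
  qed
  define P where "P E e \<longleftrightarrow> e \<in> V E \<and> norm e = 1 \<and> T e \<noteq> 0 \<and> (\<forall>v\<in>V E. norm (T v) \<le> norm (T e) * norm v)" for E e
  obtain e :: "nat \<Rightarrow> 'a" where e_rec: "\<And>n. e n = (SOME x. P (e ` {..<n}) x)"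
    using course_of_values_recursion[of "\<lambda>E. SOME x. P E x"] by auto
  define D where "D n \<longleftrightarrow> (\<exists>z\<in>V (e ` {..<n}). T z \<noteq> 0)" for n
  have V_iff: "v \<in> V (e ` {..<n}) \<longleftrightarrow> (\<forall>i<n. v \<bullet> e i = 0)" for v n by (auto simp: V_def)
  have P: "P (e ` {..<n}) (e n)" if "D n" for n
  proof -
    obtain z where "z \<in> V (e ` {..<n})" "T z \<noteq> 0" using \<open>D n\<close> D_def by auto
    then have "\<exists>x. P (e ` {..<n}) x"
      using compact_op_norm_attained[OF T V] unfolding P_def by blast
    then show ?thesis unfolding e_rec[of n] by (rule someI_ex)
  qed
  have "V (e ` {..<Suc n}) \<subseteq> V (e ` {..<n})" for n unfolding V_def by auto
  then have "D n" if "D (Suc n)" for n using that unfolding D_def by blast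
  then obtain N where N: "\<And>n. enat n < N \<longleftrightarrow> D n" using enat_initial_segment[of D] by blast
  define \<sigma> where "\<sigma> n = norm (T (e n))" for n
  define f where "f n = (1 / \<sigma> n) *\<^sub>R T (e n)" for n
  have \<sigma>_pos: "0 < \<sigma> n" if "D n" for n using P[OF that] by (simp add: P_def \<sigma>_def)
  have Te: "T (e n) = \<sigma> n *\<^sub>R f n" if "D n" for n using \<sigma>_pos[OF that] by (simp add: f_def)
  have e_perp: "e j \<bullet> e i = 0" if "D j" "i < j" for i j
    using P[OF that(1)] that(2) by (simp add: P_def V_iff)
  have e_norm: "e n \<bullet> e n = 1" if "D n" for n using P[OF that] by (simp add: P_def norm_eq_1)
  have bound: "norm (T v) \<le> \<sigma> n * norm v" if "D n" "\<forall>i<n. v \<bullet> e i = 0" for v n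
    using P[OF that(1)] that(2) by (simp add: P_def V_iff \<sigma>_def)
  have vanish: "T v = 0" if "\<not> D n" "\<forall>i<n. v \<bullet> e i = 0" for v n
    using that by (auto simp: D_def V_iff)
  have ortho: "T (e n) \<bullet> T v = 0" if n: "D n" and v: "\<forall>i\<le>n. v \<bullet> e i = 0" for n v
  proof -
    \<comment> \<open>Moving \<open>e n\<close> by \<open>t *\<^sub>R v\<close> stays in the
      subspace where \<open>e n\<close> is maximal; comparing the squared norms leaves this
      quadratic in \<open>t\<close>.\<close>
    have "0 \<le> t * (- (2 * (T (e n) \<bullet> T v))) + t\<^sup>2 * ((\<sigma> n)\<^sup>2 * (norm v)\<^sup>2 - (norm (T v))\<^sup>2)" for t
    proof -
      have "norm (T (e n + t *\<^sub>R v)) \<le> \<sigma> n * norm (e n + t *\<^sub>R v)"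
        using n v e_perp by (intro bound) (auto simp: inner_add_left)
      then have "(norm (T (e n + t *\<^sub>R v)))\<^sup>2 \<le> (\<sigma> n)\<^sup>2 * (norm (e n + t *\<^sub>R v))\<^sup>2"
        by (metis norm_ge_zero power_mono power_mult_distrib)
      also have "(norm (e n + t *\<^sub>R v))\<^sup>2 = 1 + t\<^sup>2 * (norm v)\<^sup>2"
        using v e_norm[OF n] inner_commute[of "e n" v] unfolding power2_norm_eq_inner
        by (simp add: inner_add_left inner_add_right power2_eq_square)
      also have "(norm (T (e n + t *\<^sub>R v)))\<^sup>2 = (\<sigma> n)\<^sup>2 + t * (2 * (T (e n) \<bullet> T v)) + t\<^sup>2 * (norm (T v))\<^sup>2"
        unfolding power2_norm_eq_inner \<sigma>_def
        by (simp add: inner_add_left inner_add_right inner_commute T.add T.scaleR algebra_simps power2_eq_square)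
      finally show ?thesis by (simp add: algebra_simps)
    qed
    then show ?thesis using linear_term_zero by fastforce
  qed
  have D_mono: "D i" if "D j" "i \<le> j" for i j
    using that N by (metis enat_ord_simps(1) order.strict_trans1)
  have on_e: "orthonormal_upto N e"
    unfolding orthonormal_upto_def N
    by (metis e_norm e_perp inner_commute linorder_neqE_nat)
  have f_perp: "f i \<bullet> f j = 0" if "D j" "i < j" for i j
    using ortho[of i "e j"] D_mono[OF that(1), of i] that e_perp by (simp add: f_def)
  have on_f: "orthonormal_upto N f"
    unfolding orthonormal_upto_def N
  proof (intro allI impI)
    fix i j assume "D i" "D j"
    have "norm (f i) = 1" using \<sigma>_pos[OF \<open>D i\<close>] by (simp add: f_def \<sigma>_def)
    then have "f i \<bullet> f i = 1" by (simp only: norm_eq_1)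
    then show "f i \<bullet> f j = (if i = j then 1 else 0)"
      using f_perp \<open>D i\<close> \<open>D j\<close> by (metis inner_commute linorder_neqE_nat)
  qed
  have anti: "\<sigma> j \<le> \<sigma> i" if "i \<le> j" "D j" for i j
    using bound[of i "e j"] D_mono[OF that(2,1)] that e_perp e_norm[OF that(2)]
    by (simp add: \<sigma>_def norm_eq_1[symmetric])
  \<comment> \<open>Otherwise a subsequence of the images would converge, although orthogonal
    vectors of norm at least \<open>\<epsilon>\<close> stay at distance at least
    \<open>\<epsilon>\<close> from each other.\<close>
  have small: "\<exists>n. \<sigma> n < \<epsilon>" if "N = \<infinity>" "0 < \<epsilon>" for \<epsilon>
  proof (rule ccontr)
    assume "\<nexists>n. \<sigma> n < \<epsilon>"
    then have ge: "\<epsilon> \<le> \<sigma> n" for n by (simp add: not_less)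
    have D: "D n" for n using N that(1) by (metis enat_ord_code(4))
    have "norm (e n) \<le> 1" for n using e_norm[OF D] by (simp add: norm_eq_1[symmetric])
    then obtain s l where s: "strict_mono (s :: nat \<Rightarrow> nat)" and l: "(\<lambda>n. T (e (s n))) \<longlonglongrightarrow> l"
      using compact_op_convergent_subseq[OF T] by metis
    then obtain n0 where n0: "\<And>a b. n0 \<le> a \<Longrightarrow> n0 \<le> b \<Longrightarrow> dist (T (e (s a))) (T (e (s b))) < \<epsilon>"
      using LIMSEQ_imp_Cauchy[OF l] \<open>0 < \<epsilon>\<close> unfolding Cauchy_def by metis
    let ?a = "s n0" and ?b = "s (Suc n0)"
    have ab: "?a < ?b" using s by (simp add: strict_mono_def)
    then have "T (e ?a) \<bullet> T (e ?b) = 0" using f_perp[OF D ab] Te[OF D] by simp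
    then have "(norm (T (e ?a) - T (e ?b)))\<^sup>2 = (\<sigma> ?a)\<^sup>2 + (\<sigma> ?b)\<^sup>2"
      by (simp add: power2_norm_eq_inner inner_diff_left inner_diff_right inner_commute \<sigma>_def)
    moreover have "\<epsilon>\<^sup>2 \<le> (\<sigma> ?a)\<^sup>2" using ge[of ?a] \<open>0 < \<epsilon>\<close> by (intro power_mono) auto
    ultimately have "\<epsilon>\<^sup>2 \<le> (norm (T (e ?a) - T (e ?b)))\<^sup>2" by (simp add: add_increasing2)
    from power2_le_imp_le[OF this norm_ge_zero]
    have "\<epsilon> \<le> dist (T (e ?a)) (T (e ?b))" by (simp add: dist_norm)
    then show False using n0[of n0 "Suc n0"] by simp
  qed
  have lim: "\<sigma> \<longlonglongrightarrow> 0" if "N = \<infinity>"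
  proof (rule LIMSEQ_I)
    fix \<epsilon> :: real assume "0 < \<epsilon>"
    then obtain n where n: "\<sigma> n < \<epsilon>" using small[OF \<open>N = \<infinity>\<close>] by blast
    have "\<sigma> k < \<epsilon>" if "n \<le> k" for k using anti[OF that] N \<open>N = \<infinity>\<close> n by fastforce
    then show "\<exists>n. \<forall>k\<ge>n. norm (\<sigma> k - 0) < \<epsilon>" by (intro exI[of _ n]) (simp add: \<sigma>_def)
  qed
  have sum: "((\<lambda>i. (\<sigma> i * (v \<bullet> e i)) *\<^sub>R f i) has_sum T v) {i. enat i < N}" for v
    unfolding has_sum_def
  proof (rule tendstoI)
    fix \<epsilon> :: real assume "0 < \<epsilon>"
    define p where "p F = (\<Sum>i\<in>F. (v \<bullet> e i) *\<^sub>R e i)" for F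
    \<comment> \<open>The partial sum is \<open>T (p F)\<close>, so the error is \<open>T\<close> at
      a vector orthogonal to the first \<open>n\<close> singular vectors as soon as \<open>F\<close>
      contains their indices. There \<open>T\<close> vanishes or is bounded by
      \<open>\<sigma> n\<close>.\<close>
    have Tp: "(\<Sum>i\<in>F. (\<sigma> i * (v \<bullet> e i)) *\<^sub>R f i) = T v - T (v - p F)" if "F \<subseteq> {i. enat i < N}" for F
      using that N Te by (auto simp: T.diff p_def T.sum T.scaleR mult.commute intro!: sum.cong)
    have on: "orthonormal_on F e" if "F \<subseteq> {i. enat i < N}" for F
      using on_e that orthonormal_on_mono by (auto simp: orthonormal_upto_iff)
    have "\<exists>X. finite X \<and> X \<subseteq> {i. enat i < N} \<and>
        (\<forall>F. finite F \<longrightarrow> X \<subseteq> F \<longrightarrow> F \<subseteq> {i. enat i < N} \<longrightarrow> norm (T (v - p F)) < \<epsilon>)"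
    proof (cases N)
      case (enat n)
      have "T (v - p F) = 0" if "finite F" "{..<n} \<subseteq> F" "F \<subseteq> {i. enat i < N}" for F
      proof (rule vanish)
        show "\<not> D n" using N enat by (metis order_less_irrefl)
        show "\<forall>i<n. (v - p F) \<bullet> e i = 0"
          using orthonormal_remainder[OF on that(1)] that by (auto simp: p_def)
      qed
      then show ?thesis using enat \<open>0 < \<epsilon>\<close> by (intro exI[of _ "{..<n}"]) auto
    next
      case infinity
      \<comment> \<open>Adding 1 covers \<open>v = 0\<close>.\<close>
      have "0 < \<epsilon> / (norm v + 1)" using \<open>0 < \<epsilon>\<close> by (simp add: add_nonneg_pos)
      then obtain n where n: "\<sigma> n < \<epsilon> / (norm v + 1)" using small infinity by blast
      have "norm (T (v - p F)) < \<epsilon>" if F: "finite F" "{..<n} \<subseteq> F" "F \<subseteq> {i. enat i < N}" for F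
      proof -
        have "norm (T (v - p F)) \<le> \<sigma> n * norm (v - p F)"
          using orthonormal_remainder[OF on F(1)] F N infinity
          by (intro bound) (auto simp: p_def simp flip: N)
        also have "\<dots> \<le> \<sigma> n * (norm v + 1)"
          using norm_orthonormal_remainder_le[OF on F(1), of v] F
          by (intro mult_left_mono) (auto simp: p_def \<sigma>_def)
        also have "\<dots> < \<epsilon>"
          using n by (simp only: pos_less_divide_eq[OF add_nonneg_pos[OF norm_ge_zero zero_less_one]])
        finally show ?thesis .
      qed
      then show ?thesis using infinity by (intro exI[of _ "{..<n}"]) auto
    qed
    then obtain X where X: "finite X" "X \<subseteq> {i. enat i < N}"
      "\<And>F. finite F \<Longrightarrow> X \<subseteq> F \<Longrightarrow> F \<subseteq> {i. enat i < N} \<Longrightarrow> norm (T (v - p F)) < \<epsilon>" by blast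
    have "dist (\<Sum>i\<in>F. (\<sigma> i * (v \<bullet> e i)) *\<^sub>R f i) (T v) < \<epsilon>"
      if "finite F" "X \<subseteq> F" "F \<subseteq> {i. enat i < N}" for F
      unfolding Tp[OF that(3)] dist_norm using X(3)[OF that] by simp
    then show "\<forall>\<^sub>F F in finite_subsets_at_top {i. enat i < N}.
        dist (\<Sum>i\<in>F. (\<sigma> i * (v \<bullet> e i)) *\<^sub>R f i) (T v) < \<epsilon>"
      unfolding eventually_finite_subsets_at_top using X(1,2) by blast
  qed
  have "is_svd T N \<sigma> e f"
    unfolding is_svd_def using \<sigma>_pos anti lim on_e on_f sum by (simp add: N)
  then show ?thesis by blast
qed

section \<open>The positive square root\<close>

lemma is_svd_apply:
  assumes T: "bounded_linear T" and svd: "is_svd T N \<sigma> e f" and i: "enat i < N"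
  shows "T (e i) = \<sigma> i *\<^sub>R f i"
proof -
  have "((\<lambda>j. (\<sigma> j * (e i \<bullet> e j)) *\<^sub>R f j) has_sum T (e i)) {j. enat j < N}"
    using svd by (simp add: is_svd_def)
  moreover have "((\<lambda>j. (\<sigma> j * (e i \<bullet> e j)) *\<^sub>R f j) has_sum T (e i)) {j. enat j < N}
      \<longleftrightarrow> ((\<lambda>j. (\<sigma> j * (e i \<bullet> e j)) *\<^sub>R f j) has_sum T (e i)) {i}"
    using svd i by (intro has_sum_cong_neutral) (auto simp: is_svd_def orthonormal_upto_def)
  ultimately have "((\<lambda>j. (\<sigma> j * (e i \<bullet> e j)) *\<^sub>R f j) has_sum T (e i)) {i}" by simp
  then have "T (e i) = (\<Sum>j\<in>{i}. (\<sigma> j * (e i \<bullet> e j)) *\<^sub>R f j)"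
    using has_sum_unique has_sum_finite by blast
  then show ?thesis using svd i by (simp add: is_svd_def orthonormal_upto_def)
qed

lemma is_svd_inner:
  assumes "is_svd T N \<sigma> e f"
  shows "((\<lambda>i. \<sigma> i * (v \<bullet> e i) * (w \<bullet> f i)) has_sum (T v \<bullet> w)) {i. enat i < N}"
proof -
  have "((\<lambda>i. (\<sigma> i * (v \<bullet> e i)) *\<^sub>R f i) has_sum T v) {i. enat i < N}"
    using assms by (simp add: is_svd_def)
  from has_sum_bounded_linear[OF bounded_linear_inner_left[of w] this]
  show ?thesis by (simp add: comp_def inner_commute)
qed

lemma is_svd_inner_left:
  assumes svd: "is_svd T N \<sigma> e f" and i: "enat i < N"
  shows "T v \<bullet> f i = \<sigma> i * (v \<bullet> e i)"
proof -
  have "((\<lambda>j. \<sigma> j * (v \<bullet> e j) * (f i \<bullet> f j)) has_sum T v \<bullet> f i) {j. enat j < N}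
      \<longleftrightarrow> ((\<lambda>j. \<sigma> j * (v \<bullet> e j) * (f i \<bullet> f j)) has_sum T v \<bullet> f i) {i}"
    using svd i by (intro has_sum_cong_neutral) (auto simp: is_svd_def orthonormal_upto_def)
  then have "((\<lambda>j. \<sigma> j * (v \<bullet> e j) * (f i \<bullet> f j)) has_sum T v \<bullet> f i) {i}"
    using is_svd_inner[OF svd] by simp
  then have "T v \<bullet> f i = (\<Sum>j\<in>{i}. \<sigma> j * (v \<bullet> e j) * (f i \<bullet> f j))"
    using has_sum_unique has_sum_finite by blast
  then show ?thesis using svd i by (simp add: is_svd_def orthonormal_upto_def)
qed

text \<open>By positivity, \<open>T (f i - e i) = - \<sigma> i *\<^sub>R (f i - e i)\<close> forces \<open>f i = e i\<close>.\<close>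

lemma positive_svd:
  assumes T: "bounded_linear T" and sa: "\<And>u v. T u \<bullet> v = u \<bullet> T v" and pos: "\<And>u. 0 \<le> T u \<bullet> u"
    and svd: "is_svd T N \<sigma> e f" and i: "enat i < N"
  shows "f i = e i"
proof -
  interpret T: bounded_linear T by fact
  have "T (f i) = \<sigma> i *\<^sub>R e i"
    by (subst vector_eq_rdot[symmetric]) (simp add: sa is_svd_inner_left[OF svd i, symmetric] inner_commute)
  then have "T (f i - e i) = - (\<sigma> i *\<^sub>R (f i - e i))"
    by (simp add: T.diff is_svd_apply[OF T svd i] algebra_simps)
  then have "\<sigma> i * ((f i - e i) \<bullet> (f i - e i)) \<le> 0" using pos[of "f i - e i"] by simp
  moreover have "0 < \<sigma> i" using svd i by (simp add: is_svd_def)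
  ultimately have "(f i - e i) \<bullet> (f i - e i) \<le> 0" by (simp add: mult_le_0_iff)
  then show ?thesis by (metis inner_gt_zero_iff linorder_not_le right_minus_eq)
qed

text \<open>Cauchy-Schwarz for the coefficient sequences, followed by Bessel. It bounds the form
  that defines the square root.\<close>

lemma sum_orthonormal_coeffs_le:
  assumes "orthonormal_on I e" "finite I"
  shows "(\<Sum>i\<in>I. \<bar>v \<bullet> e i\<bar> * \<bar>w \<bullet> e i\<bar>) \<le> norm v * norm w"
proof -
  have L2: "L2_set (\<lambda>i. z \<bullet> e i) I \<le> norm z" for z
    unfolding L2_set_def using bessel[OF assms, of z] by (intro real_le_lsqrt) (auto simp: sum_nonneg)
  have "(\<Sum>i\<in>I. \<bar>v \<bullet> e i\<bar> * \<bar>w \<bullet> e i\<bar>) \<le> L2_set (\<lambda>i. v \<bullet> e i) I * L2_set (\<lambda>i. w \<bullet> e i) I"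
    by (rule L2_set_mult_ineq)
  also have "\<dots> \<le> norm v * norm w" using L2 by (intro mult_mono) (auto simp: L2_set_nonneg)
  finally show ?thesis .
qed

text \<open>Positivity makes left and right singular vectors agree, so \<open>T\<close> is diagonal
  in \<open>e\<close> and its root has eigenvalues \<open>sqrt (\<sigma> i)\<close>. Uniqueness
  rests on two facts: any positive root has these eigenvectors, and it vanishes wherever the form of
  \<open>T\<close> does.\<close>

theorem positive_sqrt_ex1:
  assumes T: "compact_op T" and sa: "\<And>u v. T u \<bullet> v = u \<bullet> T v" and pos: "\<And>u. 0 \<le> T u \<bullet> u"
  shows "\<exists>!S. bounded_linear S \<and> (\<forall>u v. S u \<bullet> v = u \<bullet> S v) \<and> (\<forall>u. 0 \<le> S u \<bullet> u) \<and> S \<circ> S = T"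
proof -
  have bl: "bounded_linear T" using T by (simp add: compact_op_def)
  interpret T: bounded_linear T by fact
  obtain N \<sigma> e f where svd: "is_svd T N \<sigma> e f" using compact_op_svd[OF T] by blast
  define I where "I = {i. enat i < N}"
  have \<sigma>: "0 < \<sigma> i" if "i \<in> I" for i using svd that by (simp add: is_svd_def I_def)
  have on: "orthonormal_on I e" using svd by (simp add: is_svd_def I_def orthonormal_upto_iff)
  have fe: "f i = e i" if "i \<in> I" for i using positive_svd[OF bl sa pos svd] that by (simp add: I_def)
  have Te: "T (e i) = \<sigma> i *\<^sub>R e i" if "i \<in> I" for i
    using is_svd_apply[OF bl svd, of i] fe[OF that] that by (simp add: I_def)
  have Tvw: "((\<lambda>i. \<sigma> i * (v \<bullet> e i) * (w \<bullet> e i)) has_sum (T v \<bullet> w)) I" for v w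
    using is_svd_inner[OF svd, of v w] fe by (subst has_sum_cong[where g = "\<lambda>i. \<sigma> i * (v \<bullet> e i) * (w \<bullet> f i)"]) (auto simp: I_def)
  define s where "s v w i = sqrt (\<sigma> i) * (v \<bullet> e i) * (w \<bullet> e i)" for v w i
  \<comment> \<open>\<open>\<sigma> 0\<close> is the largest singular value unless \<open>I\<close>
    is empty. In that case it is arbitrary and \<open>B\<close> may be negative, hence the absolute
    values below.\<close>
  define B where "B = sqrt (\<sigma> 0)"
  have \<sigma>_le: "sqrt (\<sigma> i) \<le> B" if "i \<in> I" for i
    using svd that by (auto simp: is_svd_def I_def B_def)
  have fin_bound: "(\<Sum>i\<in>F. \<bar>s v w i\<bar>) \<le> \<bar>B\<bar> * norm v * norm w" if "finite F" "F \<subseteq> I" for F v w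
  proof -
    have "(\<Sum>i\<in>F. \<bar>s v w i\<bar>) \<le> (\<Sum>i\<in>F. \<bar>B\<bar> * (\<bar>v \<bullet> e i\<bar> * \<bar>w \<bullet> e i\<bar>))"
      using that \<sigma>_le \<sigma>
      by (intro sum_mono) (force simp: s_def abs_mult mult.assoc intro!: mult_right_mono)
    also have "\<dots> \<le> \<bar>B\<bar> * (norm v * norm w)"
      unfolding sum_distrib_left[symmetric]
      using sum_orthonormal_coeffs_le[OF orthonormal_on_mono[OF on] that(1)] that(2)
      by (intro mult_left_mono) auto
    finally show ?thesis by (simp add: mult.assoc)
  qed
  have abs_summable: "s v w summable_on I" for v w
  proof (rule abs_summable_summable)
    show "(\<lambda>i. norm (s v w i)) summable_on I"
      using fin_bound[of _ v w]
      by (intro nonneg_bdd_above_summable_on bdd_aboveI[of _ "\<bar>B\<bar> * norm v * norm w"]) auto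
  qed
  have form_bound: "\<bar>infsum (s v w) I\<bar> \<le> \<bar>B\<bar> * norm v * norm w" for v w
  proof -
    have "norm (infsum (s v w) I) \<le> infsum (\<lambda>i. norm (s v w i)) I"
      using fin_bound[of _ v w]
      by (intro norm_infsum_bound nonneg_bdd_above_summable_on bdd_aboveI[of _ "\<bar>B\<bar> * norm v * norm w"]) auto
    also have "\<dots> \<le> \<bar>B\<bar> * norm v * norm w"
      using fin_bound[of _ v w]
      by (intro infsum_le_finite_sums nonneg_bdd_above_summable_on bdd_aboveI[of _ "\<bar>B\<bar> * norm v * norm w"]) auto
    finally show ?thesis by simp
  qed
  obtain S where S: "bounded_linear S" and Sv: "\<And>v w. S v \<bullet> w = infsum (s v w) I"
  proof (rule bounded_form_representation[of "\<lambda>v w. infsum (s v w) I" "\<bar>B\<bar>"])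
    show "infsum (s (u + v) w) I = infsum (s u w) I + infsum (s v w) I" for u v w
      by (subst infsum_add[OF abs_summable abs_summable, symmetric]) (intro infsum_cong, simp add: s_def algebra_simps)
    show "infsum (s u (v + w)) I = infsum (s u v) I + infsum (s u w) I" for u v w
      by (subst infsum_add[OF abs_summable abs_summable, symmetric]) (intro infsum_cong, simp add: s_def algebra_simps)
    show "infsum (s (c *\<^sub>R v) w) I = c * infsum (s v w) I" for c v w
      by (subst infsum_cmult_right'[symmetric]) (intro infsum_cong, simp add: s_def algebra_simps)
    show "infsum (s v (c *\<^sub>R w)) I = c * infsum (s v w) I" for c v w
      by (subst infsum_cmult_right'[symmetric]) (intro infsum_cong, simp add: s_def algebra_simps)
  qed (use form_bound in auto)
  have S_sa: "S u \<bullet> v = u \<bullet> S v" for u v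
    by (subst inner_commute[of u], unfold Sv, rule infsum_cong) (simp add: s_def)
  have S_pos: "0 \<le> S u \<bullet> u" for u
    unfolding Sv using \<sigma> by (intro infsum_nonneg) (auto simp: s_def mult.assoc less_imp_le)
  have Se: "S (e i) = sqrt (\<sigma> i) *\<^sub>R e i" if i: "i \<in> I" for i
  proof (subst vector_eq_rdot[symmetric], intro allI)
    fix w
    have "infsum (s (e i) w) I = infsum (s (e i) w) {i}"
      using i on by (intro infsum_cong_neutral) (auto simp: s_def orthonormal_on_def)
    then show "S (e i) \<bullet> w = sqrt (\<sigma> i) *\<^sub>R e i \<bullet> w"
      using orthonormal_onD[OF on i i] by (simp add: Sv) (simp add: s_def inner_commute)
  qed
  have "S (S v) = T v" for v
  proof (subst vector_eq_rdot[symmetric], intro allI)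
    fix w
    have Sve: "S v \<bullet> e i = sqrt (\<sigma> i) * (v \<bullet> e i)" if "i \<in> I" for i v
      using Se[OF that] by (simp add: S_sa)
    have "S (S v) \<bullet> w = infsum (\<lambda>i. \<sigma> i * (v \<bullet> e i) * (w \<bullet> e i)) I"
      unfolding Sv by (intro infsum_cong) (simp add: s_def Sve abs_of_pos \<sigma>)
    also have "\<dots> = T v \<bullet> w" using Tvw by (rule infsumI)
    finally show "S (S v) \<bullet> w = T v \<bullet> w" .
  qed
  then have S_ok: "bounded_linear S \<and> (\<forall>u v. S u \<bullet> v = u \<bullet> S v) \<and> (\<forall>u. 0 \<le> S u \<bullet> u) \<and> S \<circ> S = T"
    using S S_sa S_pos by auto
  have eigen: "R (e i) = sqrt (\<sigma> i) *\<^sub>R e i"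
    if R: "bounded_linear R" "\<forall>u. 0 \<le> R u \<bullet> u" "R \<circ> R = T" and i: "i \<in> I" for R i
  proof -
    interpret R: bounded_linear R by fact
    \<comment> \<open>The factorization of \<open>R\<^sup>2 - \<sigma> i\<close> shows that
      \<open>u\<close> would be an eigenvector of the positive operator \<open>R\<close> for
      \<open>- sqrt (\<sigma> i)\<close>, which forces \<open>u = 0\<close>.\<close>
    define u where "u = R (e i) - sqrt (\<sigma> i) *\<^sub>R e i"
    have "R (R (e i)) = \<sigma> i *\<^sub>R e i" using R(3) Te[OF i] by (metis comp_apply)
    then have "R u = - (sqrt (\<sigma> i) *\<^sub>R u)"
      using \<sigma>[OF i] by (simp add: u_def R.diff R.scaleR algebra_simps)
    then have "sqrt (\<sigma> i) * (u \<bullet> u) \<le> 0" using R(2)[rule_format, of u] by simp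
    then have "u \<bullet> u \<le> 0" using \<sigma>[OF i] by (simp add: mult_le_0_iff)
    then have "u = 0" by (metis inner_gt_zero_iff linorder_not_le)
    then show ?thesis by (simp add: u_def)
  qed
  show ?thesis
  proof (rule ex1I)
    show "bounded_linear S \<and> (\<forall>u v. S u \<bullet> v = u \<bullet> S v) \<and> (\<forall>u. 0 \<le> S u \<bullet> u) \<and> S \<circ> S = T" by (rule S_ok)
  next
    fix R assume "bounded_linear R \<and> (\<forall>u v. R u \<bullet> v = u \<bullet> R v) \<and> (\<forall>u. 0 \<le> R u \<bullet> u) \<and> R \<circ> R = T"
    then have R: "bounded_linear R" "\<And>u v. R u \<bullet> v = u \<bullet> R v" "\<forall>u. 0 \<le> R u \<bullet> u" "R \<circ> R = T" by auto
    show "R = S"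
    proof
      fix v
      \<comment> \<open>As \<open>d\<close> is orthogonal to every \<open>e i\<close>, the form of
        \<open>T\<close> vanishes at \<open>d\<close>. Its value is the squared norm of both
        \<open>R d\<close> and \<open>S d\<close>, and self-adjointness then moves \<open>R\<close>
        and \<open>S\<close> onto \<open>d\<close> in \<open>d \<bullet> d\<close>.\<close>
      define d where "d = R v - S v"
      have "d \<bullet> e i = 0" if "i \<in> I" for i
        using eigen[OF R(1,3,4) that] Se[OF that] by (simp add: d_def inner_diff_left R(2) S_sa)
      then have "((\<lambda>i. 0) has_sum (T d \<bullet> d)) I"
        using Tvw[of d d] by (subst has_sum_cong[where g = "\<lambda>i. \<sigma> i * (d \<bullet> e i) * (d \<bullet> e i)"]) auto
      then have Td: "T d \<bullet> d = 0" using has_sum_0_simp has_sum_unique by blast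
      have "R d \<bullet> R d = T d \<bullet> d" using R(2)[of "R d" d] R(4) by (metis comp_apply)
      moreover have "S d \<bullet> S d = T d \<bullet> d" using S_sa[of "S d" d] S_ok by (metis comp_apply)
      ultimately have "R d = 0" "S d = 0" using Td by simp_all
      moreover have "d \<bullet> d = v \<bullet> R d - v \<bullet> S d"
        by (subst d_def) (simp add: inner_diff_left R(2) S_sa)
      ultimately show "R v = S v" by (simp add: d_def)
    qed
  qed
qed

lemma
  assumes "compact_op T" "\<And>u v. T u \<bullet> v = u \<bullet> T v" "\<And>u. 0 \<le> T u \<bullet> u"
  shows bounded_linear_sqrt_op: "bounded_linear (sqrt_op T)"
    and sqrt_op_self_adjoint: "sqrt_op T u \<bullet> v = u \<bullet> sqrt_op T v"
    and sqrt_op_square: "sqrt_op T (sqrt_op T u) = T u"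
  using theI'[OF positive_sqrt_ex1[OF assms], folded sqrt_op_def] by (auto dest: fun_cong)

section \<open>Low-rank approximation\<close>

lemma bounded_rank_leI:
  assumes A: "bounded_linear A" and F: "range A \<subseteq> span F" "finite F" "card F \<le> r"
  shows "A \<in> bounded_rank_le r"
proof -
  obtain B where B: "B \<subseteq> range A" "independent B" "range A \<subseteq> span B"
    using maximal_independent_subset[of "range A"] by metis
  have "finite B \<and> card B \<le> card F"
    using B F by (intro independent_span_bound) auto
  moreover have "span B = range A"
    using B subspace_range[OF A] by (intro equalityI span_minimal)
  ultimately show ?thesis using A B F unfolding bounded_rank_le_def by auto
qed

lemma has_sum_inner_self:
  assumes svd: "is_svd T N \<sigma> e f"
  shows "((\<lambda>i. (\<sigma> i)\<^sup>2 * (v \<bullet> e i)\<^sup>2) has_sum (norm (T v))\<^sup>2) {i. enat i < N}"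
  using is_svd_inner[OF svd, of v "T v"] unfolding power2_norm_eq_inner
  by (subst has_sum_cong[where g = "\<lambda>i. \<sigma> i * (v \<bullet> e i) * (T v \<bullet> f i)"])
    (auto simp: is_svd_inner_left[OF svd] power2_eq_square)

text \<open>Ky Fan's maximum principle. Splitting off a threshold \<open>s\<close> leaves
  nonnegative weights \<open>(\<sigma> i)\<^sup>2 - s\<close> on the leading coefficients only, and
  Bessel bounds the total weight that the \<open>h k\<close> can put on one \<open>e i\<close> by
  1.\<close>

lemma ky_fan:
  assumes svd: "is_svd T N \<sigma> e f" and h: "orthonormal_on {..<m} h" and "m \<le> r"
  shows "(\<Sum>k<m. (norm (T (h k)))\<^sup>2) \<le> (\<Sum>i | i < r \<and> enat i < N. (\<sigma> i)\<^sup>2)"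
proof -
  define J where "J = {i. i < r \<and> enat i < N}"
  \<comment> \<open>The square of the first omitted singular value, or 0 if none is omitted: it
    separates the values inside \<open>J\<close> from those outside.\<close>
  define s where "s = (if enat r < N then (\<sigma> r)\<^sup>2 else 0)"
  have finJ: "finite J" by (simp add: J_def)
  have on: "orthonormal_on {i. enat i < N} e" using svd by (simp add: is_svd_def orthonormal_upto_iff)
  have pos: "0 < \<sigma> i" if "enat i < N" for i using svd that by (simp add: is_svd_def)
  have s_ge: "(\<sigma> i)\<^sup>2 \<le> s" if "enat i < N" "i \<notin> J" for i
  proof -
    have "r \<le> i" using that by (simp add: J_def)
    then have "enat r < N" using that(1) by (metis enat_ord_simps(1) order.strict_trans1)
    moreover have "\<sigma> i \<le> \<sigma> r" using svd \<open>r \<le> i\<close> that(1) by (simp add: is_svd_def)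
    ultimately show ?thesis using pos[OF that(1)] by (simp add: s_def power_mono)
  qed
  have s_le: "s \<le> (\<sigma> i)\<^sup>2" if "i \<in> J" for i
  proof (cases "enat r < N")
    case True
    then have "\<sigma> r \<le> \<sigma> i" using svd that by (simp add: is_svd_def J_def)
    then show ?thesis using pos[OF True] by (simp add: s_def power_mono)
  qed (simp add: s_def)
  have s0: "0 \<le> s" by (simp add: s_def)
  have bound: "(norm (T v))\<^sup>2 \<le> s * (norm v)\<^sup>2 + (\<Sum>i\<in>J. ((\<sigma> i)\<^sup>2 - s) * (v \<bullet> e i)\<^sup>2)" for v
  proof (rule has_sum_le_finite_sums[OF has_sum_inner_self[OF svd]])
    fix F assume F: "finite F" "F \<subseteq> {i. enat i < N}"
    have "(\<Sum>i\<in>F. (\<sigma> i)\<^sup>2 * (v \<bullet> e i)\<^sup>2)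
        \<le> (\<Sum>i\<in>F. s * (v \<bullet> e i)\<^sup>2 + (if i \<in> J then ((\<sigma> i)\<^sup>2 - s) * (v \<bullet> e i)\<^sup>2 else 0))"
      using F s_ge by (intro sum_mono) (auto simp: algebra_simps intro!: mult_right_mono)
    also have "\<dots> = s * (\<Sum>i\<in>F. (v \<bullet> e i)\<^sup>2) + (\<Sum>i\<in>F \<inter> J. ((\<sigma> i)\<^sup>2 - s) * (v \<bullet> e i)\<^sup>2)"
      using F(1) by (simp add: sum.distrib sum_distrib_left sum.inter_restrict)
    also have "\<dots> \<le> s * (norm v)\<^sup>2 + (\<Sum>i\<in>J. ((\<sigma> i)\<^sup>2 - s) * (v \<bullet> e i)\<^sup>2)"
      using s0 s_le finJ
      by (intro add_mono mult_left_mono bessel[OF orthonormal_on_mono[OF on F(2)] F(1)] sum_mono2) auto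
    finally show "(\<Sum>i\<in>F. (\<sigma> i)\<^sup>2 * (v \<bullet> e i)\<^sup>2)
        \<le> s * (norm v)\<^sup>2 + (\<Sum>i\<in>J. ((\<sigma> i)\<^sup>2 - s) * (v \<bullet> e i)\<^sup>2)" .
  qed
  have le1: "(\<Sum>k<m. (h k \<bullet> e i)\<^sup>2) \<le> 1" if "i \<in> J" for i
    using bessel[OF h, of "e i"] orthonormal_on_norm[OF on, of i] that by (simp add: J_def inner_commute)
  have "(\<Sum>k<m. (norm (T (h k)))\<^sup>2) \<le> (\<Sum>k<m. s * (norm (h k))\<^sup>2 + (\<Sum>i\<in>J. ((\<sigma> i)\<^sup>2 - s) * (h k \<bullet> e i)\<^sup>2))"
    by (intro sum_mono bound)
  also have "\<dots> = s * real m + (\<Sum>i\<in>J. ((\<sigma> i)\<^sup>2 - s) * (\<Sum>k<m. (h k \<bullet> e i)\<^sup>2))"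
    using orthonormal_on_norm[OF h] by (simp add: sum.distrib sum_distrib_left sum.swap[of _ J])
  also have "\<dots> \<le> s * real m + (\<Sum>i\<in>J. ((\<sigma> i)\<^sup>2 - s) * 1)"
    using le1 s_le by (intro add_left_mono sum_mono mult_left_mono) auto
  also have "\<dots> = (\<Sum>i\<in>J. (\<sigma> i)\<^sup>2) + s * (real m - real (card J))"
    by (simp add: sum_subtractf algebra_simps)
  \<comment> \<open>If a value is omitted, \<open>J\<close> has exactly \<open>r\<close> elements
    and \<open>m \<le> r\<close> applies; otherwise \<open>s = 0\<close>.\<close>
  also have "s * (real m - real (card J)) \<le> 0"
  proof (cases "enat r < N")
    case True
    then have "J = {..<r}" unfolding J_def by (auto intro: order.strict_trans simp flip: enat_ord_simps(2))
    then show ?thesis using \<open>m \<le> r\<close> s0 by (simp add: mult_nonneg_nonpos)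
  qed (simp add: s_def)
  finally show ?thesis by (simp add: J_def)
qed

text \<open>The error \<open>loss A\<close> is, up to a constant, the squared Hilbert--Schmidt norm of \<open>R - K\<close> for
  \<open>R = S \<circ> adjoint A \<circ> adjoint WA\<close>.  As \<open>R\<close> vanishes on the orthogonal complement of a finite orthonormal
  system \<open>h\<close> spanning the range of \<open>WA \<circ> A\<close>, only finitely many terms of \<open>norm (R - K)\<^sup>2 - norm K\<^sup>2\<close> matter.\<close>

locale reduced_rank_problem =
  fixes K :: "'h1::{real_inner, banach} \<Rightarrow> 'g::{real_inner, banach}"
    and S :: "'h3::{real_inner, banach} \<Rightarrow> 'g"
    and WA :: "'h2::{real_inner, banach} \<Rightarrow> 'h1"
    and loss :: "('h3 \<Rightarrow> 'h2) \<Rightarrow> real"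
    and c\<^sub>0 :: real
    and r :: nat
  assumes K: "compact_op K" and S: "bounded_linear S" and WA: "bounded_linear WA"
    and closed_range: "closed (range WA)"
    and K_closure: "\<And>v. K v \<in> closure (range S)"
    and K_perp: "\<And>v. v \<in> (range WA)\<^sup>\<bottom> \<Longrightarrow> K v = 0"
    and loss_eq: "\<And>A (m::nat) h. bounded_linear A \<Longrightarrow> orthonormal_on {..<m} h \<Longrightarrow> h ` {..<m} \<subseteq> range WA \<Longrightarrow>
      (\<And>z. (\<Sum>i<m. (WA (A z) \<bullet> h i) *\<^sub>R h i) = WA (A z)) \<Longrightarrow>
      loss A = c\<^sub>0 + (\<Sum>i<m. (norm (S (adjoint A (adjoint WA (h i))) - K (h i)))\<^sup>2 - (norm (K (h i)))\<^sup>2)"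
begin

sublocale K: bounded_linear K using K by (simp add: compact_op_def)
sublocale S: bounded_linear S by (rule S)
sublocale WA: bounded_linear WA by (rule WA)

definition frame :: "nat \<Rightarrow> (nat \<Rightarrow> 'h1) \<Rightarrow> bool" where
  "frame m h \<longleftrightarrow> orthonormal_on {..<m} h \<and> h ` {..<m} \<subseteq> range WA"

text \<open>The part of the squared Hilbert-Schmidt norm of \<open>K\<close> that is carried by the
  span of \<open>h\<close>, for orthonormal \<open>h\<close>: the largest decrease of the loss that
  these directions allow.\<close>

definition energy :: "nat \<Rightarrow> (nat \<Rightarrow> 'h1) \<Rightarrow> real" where
  "energy m h = (\<Sum>i<m. (norm (K (h i)))\<^sup>2)"

definition reduced :: "('h3 \<Rightarrow> 'h2) \<Rightarrow> 'h1 \<Rightarrow> 'g" where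
  "reduced A = S \<circ> adjoint A \<circ> adjoint WA"

text \<open>Built so that, for a frame \<open>h\<close>, the reduced operator maps each
  \<open>h i\<close> to \<open>S (p i)\<close> and vanishes orthogonally to the frame. Both the
  approximate minimizers and \<open>Ahat R\<close> have this form.\<close>

definition synthesis :: "nat \<Rightarrow> (nat \<Rightarrow> 'h1) \<Rightarrow> (nat \<Rightarrow> 'h3) \<Rightarrow> 'h3 \<Rightarrow> 'h2" where
  "synthesis m h p z = (\<Sum>i<m. (z \<bullet> p i) *\<^sub>R mp_inv WA (h i))"

abbreviation solution :: "('h3 \<Rightarrow> 'h2) \<Rightarrow> bool" where
  "solution \<equiv> is_arg_min loss (\<lambda>A. A \<in> bounded_rank_le r)"

abbreviation minimal :: "('h3 \<Rightarrow> 'h2) \<Rightarrow> bool" where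
  "minimal A \<equiv> proj ((ker WA)\<^sup>\<bottom>) \<circ> A \<circ> proj ((ker S)\<^sup>\<bottom>) = A"

abbreviation admissible :: "('h1 \<Rightarrow> 'g) \<Rightarrow> bool" where
  "admissible R \<equiv> is_truncated_svd r K R \<and> range R \<subseteq> range S"

abbreviation Ahat :: "('h1 \<Rightarrow> 'g) \<Rightarrow> 'h3 \<Rightarrow> 'h2" where
  "Ahat R \<equiv> mp_inv WA \<circ> adjoint (mp_inv S \<circ> R)"

lemma frame_apply_mp_inv:
  assumes "frame m h" "i < m"
  shows "WA (mp_inv WA (h i)) = h i" "mp_inv WA (h i) \<in> (ker WA)\<^sup>\<bottom>"
  using apply_mp_inv[OF WA] mp_inv_in[OF WA] assms unfolding frame_def by blast+

lemma WA_synthesis: "frame m h \<Longrightarrow> WA (synthesis m h p z) = (\<Sum>i<m. (z \<bullet> p i) *\<^sub>R h i)"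
  by (simp add: synthesis_def WA.sum WA.scaleR frame_apply_mp_inv)

lemma bounded_linear_synthesis: "bounded_linear (synthesis m h p)"
  unfolding synthesis_def
  by (intro bounded_linear_sum bounded_linear_scaleR_left[THEN bounded_linear_compose] bounded_linear_inner_left)

lemma mp_inv_combination:
  assumes "frame m h"
  shows "mp_inv WA (\<Sum>i<m. (z \<bullet> p i) *\<^sub>R h i) = synthesis m h p z"
proof -
  have "synthesis m h p z \<in> (ker WA)\<^sup>\<bottom>"
    unfolding synthesis_def
    by (intro subspace_sum subspace_scale subspace_orthogonal_comp frame_apply_mp_inv[OF assms]) simp
  from mp_inv_apply[OF WA this] show ?thesis by (simp add: WA_synthesis[OF assms])
qed

lemma adjoint_synthesis:
  assumes "frame m h"
  shows "adjoint (synthesis m h p) (adjoint WA v) = (\<Sum>i<m. (v \<bullet> h i) *\<^sub>R p i)"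
proof (subst vector_eq_rdot[symmetric], intro allI)
  fix z
  have "adjoint (synthesis m h p) (adjoint WA v) \<bullet> z = v \<bullet> WA (synthesis m h p z)"
    by (simp add: adjoint_inner[OF WA] adjoint_inner[OF bounded_linear_synthesis])
  also have "\<dots> = (\<Sum>i<m. (v \<bullet> h i) *\<^sub>R p i) \<bullet> z"
    by (simp add: WA_synthesis[OF assms] inner_sum_left inner_sum_right inner_commute[of z] mult.commute)
  finally show "adjoint (synthesis m h p) (adjoint WA v) \<bullet> z = (\<Sum>i<m. (v \<bullet> h i) *\<^sub>R p i) \<bullet> z" .
qed

lemma synthesis_rank:
  assumes "m \<le> r"
  shows "synthesis m h p \<in> bounded_rank_le r"
proof (rule bounded_rank_leI)
  let ?F = "(\<lambda>i. mp_inv WA (h i)) ` {..<m}"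
  show "range (synthesis m h p) \<subseteq> span ?F"
    unfolding synthesis_def by (intro image_subsetI span_sum span_scale span_base) auto
  show "card ?F \<le> r" using card_image_le[of "{..<m}"] assms by (metis card_lessThan finite_lessThan order_trans)
qed (auto intro: bounded_linear_synthesis)

lemma loss_synthesis:
  assumes "frame m h"
  shows "loss (synthesis m h p) = c\<^sub>0 + (\<Sum>i<m. (norm (S (p i) - K (h i)))\<^sup>2) - energy m h"
proof -
  have on: "orthonormal_on {..<m} h" using assms by (simp add: frame_def)
  have p: "(\<Sum>j<m. (h i \<bullet> h j) *\<^sub>R p j) = p i" if "i < m" for i
  proof -
    have "(\<Sum>j<m. (h i \<bullet> h j) *\<^sub>R p j) = (\<Sum>j<m. if j = i then p j else 0)"
      using that orthonormal_onD[OF on] by (intro sum.cong) auto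
    then show ?thesis using that by simp
  qed
  have "loss (synthesis m h p) = c\<^sub>0 + (\<Sum>i<m. (norm (S (adjoint (synthesis m h p) (adjoint WA (h i))) - K (h i)))\<^sup>2 - (norm (K (h i)))\<^sup>2)"
    using assms inner_sum_orthonormal[OF on]
    by (intro loss_eq[of "synthesis m h p" m h] bounded_linear_synthesis)
      (auto simp: frame_def WA_synthesis[OF assms])
  then show ?thesis by (simp add: adjoint_synthesis[OF assms] p energy_def sum_subtractf)
qed

text \<open>The frame orthonormalizes the image under \<open>WA\<close> of a basis of
  \<open>range A\<close>. The vector \<open>adjoint A (adjoint WA v)\<close> depends only on the
  component of \<open>v\<close> in this span, so the frame determines
  \<open>reduced A\<close>.\<close>

lemma bounded_rank_frame:
  assumes "A \<in> bounded_rank_le r"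
  obtains m h where "m \<le> r" "frame m h"
    "\<forall>v. reduced A v = (\<Sum>i<m. (v \<bullet> h i) *\<^sub>R reduced A (h i))"
    "loss A = c\<^sub>0 + (\<Sum>i<m. (norm (reduced A (h i) - K (h i)))\<^sup>2) - energy m h"
proof -
  obtain B where A: "bounded_linear A" and B: "finite B" "card B \<le> r" "span B = range A"
    using assms by (auto simp: bounded_rank_le_def)
  let ?F = "WA ` B"
  obtain m :: nat and h where m: "m \<le> card ?F" and h: "orthonormal_on {..<m} h" and hF: "h ` {..<m} \<subseteq> span ?F"
    and exp: "\<forall>v\<in>span ?F. (\<Sum>i<m. (v \<bullet> h i) *\<^sub>R h i) = v"
    by (rule orthonormal_basis_of_span[of ?F]) (use B in auto)
  have "m \<le> r" using m card_image_le[OF B(1), of WA] B(2) by linarith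
  have span: "span ?F = range (\<lambda>z. WA (A z))"
    using linear_span_image[OF WA.linear, of B] B(3) by (simp add: image_image)
  then have frame: "frame m h" using h hF by (auto simp: frame_def)
  have WAA: "(\<Sum>i<m. (WA (A z) \<bullet> h i) *\<^sub>R h i) = WA (A z)" for z using exp span by blast
  have adj: "adjoint A (adjoint WA v) \<bullet> z = v \<bullet> WA (A z)" for v z
    by (simp add: adjoint_inner[OF A] adjoint_inner[OF WA])
  have expand: "adjoint A (adjoint WA v) = (\<Sum>i<m. (v \<bullet> h i) *\<^sub>R adjoint A (adjoint WA (h i)))" for v
  proof (subst vector_eq_rdot[symmetric], intro allI)
    fix z
    have "v \<bullet> WA (A z) = v \<bullet> (\<Sum>i<m. (WA (A z) \<bullet> h i) *\<^sub>R h i)" by (simp only: WAA)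
    then show "adjoint A (adjoint WA v) \<bullet> z = (\<Sum>i<m. (v \<bullet> h i) *\<^sub>R adjoint A (adjoint WA (h i))) \<bullet> z"
      by (simp add: adj inner_sum_left inner_sum_right inner_commute[of "WA (A z)"] mult.commute)
  qed
  have "reduced A v = (\<Sum>i<m. (v \<bullet> h i) *\<^sub>R reduced A (h i))" for v
    unfolding reduced_def comp_apply by (subst expand) (simp add: S.sum S.scaleR)
  moreover have "loss A = c\<^sub>0 + (\<Sum>i<m. (norm (reduced A (h i) - K (h i)))\<^sup>2) - energy m h"
    using loss_eq[OF A h _ WAA] frame by (simp add: frame_def reduced_def energy_def sum_subtractf)
  ultimately show ?thesis using that \<open>m \<le> r\<close> frame by blast
qed

text \<open>\<open>K (h i)\<close> is only known to lie in the closure of \<open>range S\<close>.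
  Approximating it from \<open>range S\<close> produces competitors whose loss comes within any
  \<open>\<epsilon>\<close> of the bound, and a solution is no worse than each of them.\<close>

lemma loss_solution_le:
  assumes "solution A" "frame m h" "m \<le> r"
  shows "loss A \<le> c\<^sub>0 - energy m h"
proof (rule field_le_epsilon)
  fix \<epsilon> :: real assume "0 < \<epsilon>"
  \<comment> \<open>The \<open>m\<close> errors add up to at most
    \<open>m * \<delta>\<^sup>2 = \<epsilon> * m / (m + 1)\<close>; the 1 covers
    \<open>m = 0\<close>.\<close>
  define \<delta> where "\<delta> = sqrt (\<epsilon> / (real m + 1))"
  have "0 < \<delta>" using \<open>0 < \<epsilon>\<close> by (simp add: \<delta>_def)
  have "\<exists>p. dist (S p) (K (h i)) < \<delta>" for i
    using K_closure[of "h i"] \<open>0 < \<delta>\<close> unfolding closure_approachable by auto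
  then obtain p where p: "\<And>i. dist (S (p i)) (K (h i)) < \<delta>" by metis
  have "(\<Sum>i<m. (norm (S (p i) - K (h i)))\<^sup>2) \<le> (\<Sum>i<m. \<delta>\<^sup>2)"
    using p by (intro sum_mono power_mono) (auto simp: dist_norm less_imp_le)
  also have "\<dots> \<le> \<epsilon>" using \<open>0 < \<epsilon>\<close> by (simp add: \<delta>_def field_simps)
  finally have "loss (synthesis m h p) \<le> c\<^sub>0 - energy m h + \<epsilon>"
    by (simp add: loss_synthesis[OF assms(2)])
  moreover have "loss A \<le> loss (synthesis m h p)"
    using assms(1) synthesis_rank[OF assms(3)] by (meson is_arg_min_def not_le)
  ultimately show "loss A \<le> c\<^sub>0 - energy m h + \<epsilon>" by simp
qed

text \<open>Applying \<open>loss_solution_le\<close> to the solution's own frame leaves no room for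
  a fitting error, so \<open>reduced A\<close> agrees with \<open>K\<close> there. Applying it to
  other frames then shows that the energy is maximal.\<close>

lemma solution_frame:
  assumes "solution A"
  obtains m h where "m \<le> r" "frame m h" "\<forall>v. reduced A v = (\<Sum>i<m. (v \<bullet> h i) *\<^sub>R K (h i))"
    "\<forall>m' h'. frame m' h' \<longrightarrow> m' \<le> r \<longrightarrow> energy m' h' \<le> energy m h"
proof -
  have "A \<in> bounded_rank_le r" using assms by (simp add: is_arg_min_def)
  then obtain m h where h: "m \<le> r" "frame m h"
    and red: "\<forall>v. reduced A v = (\<Sum>i<m. (v \<bullet> h i) *\<^sub>R reduced A (h i))"
    and loss: "loss A = c\<^sub>0 + (\<Sum>i<m. (norm (reduced A (h i) - K (h i)))\<^sup>2) - energy m h"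
    by (rule bounded_rank_frame)
  have "(\<Sum>i<m. (norm (reduced A (h i) - K (h i)))\<^sup>2) \<le> 0"
    using loss_solution_le[OF assms h(2,1)] loss by simp
  then have zero: "(\<Sum>i<m. (norm (reduced A (h i) - K (h i)))\<^sup>2) = 0"
    by (intro antisym sum_nonneg) auto
  then have eq: "reduced A (h i) = K (h i)" if "i < m" for i
    using that by (simp add: sum_nonneg_eq_0_iff)
  have "reduced A v = (\<Sum>i<m. (v \<bullet> h i) *\<^sub>R K (h i))" for v
    using red eq by (metis (no_types, lifting) lessThan_iff sum.cong)
  moreover have "energy m' h' \<le> energy m h" if "frame m' h'" "m' \<le> r" for m' h'
    using loss_solution_le[OF assms that] loss zero by simp
  ultimately show ?thesis using that h by blast
qed

end

section \<open>Truncated decompositions and frames of maximal energy\<close>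

lemma truncation_index_set:
  obtains k where "k \<le> r" "{i. i < r \<and> enat i < N} = {..<k}"
proof (cases N)
  case (enat n)
  then show ?thesis by (intro that[of "min r n"]) auto
qed (use that[of r] in auto)

text \<open>The first block is finite, so the second, possibly infinite one can be shifted by
  \<open>n\<close>. The ordering and the orthogonality between the blocks are what maximality of the
  energy will provide.\<close>

lemma is_svd_append:
  assumes K: "\<And>v. K v = R v + T v"
    and svd1: "is_svd R (enat n) \<sigma>\<^sub>1 e\<^sub>1 f\<^sub>1" and svd2: "is_svd T N \<sigma>\<^sub>2 e\<^sub>2 f\<^sub>2"
    and le: "\<And>i j. i < n \<Longrightarrow> enat j < N \<Longrightarrow> \<sigma>\<^sub>2 j \<le> \<sigma>\<^sub>1 i"
    and e_perp: "\<And>i j. i < n \<Longrightarrow> enat j < N \<Longrightarrow> e\<^sub>1 i \<bullet> e\<^sub>2 j = 0"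
    and f_perp: "\<And>i j. i < n \<Longrightarrow> enat j < N \<Longrightarrow> f\<^sub>1 i \<bullet> f\<^sub>2 j = 0"
  shows "is_svd K (enat n + N) (\<lambda>i. if i < n then \<sigma>\<^sub>1 i else \<sigma>\<^sub>2 (i - n))
    (\<lambda>i. if i < n then e\<^sub>1 i else e\<^sub>2 (i - n)) (\<lambda>i. if i < n then f\<^sub>1 i else f\<^sub>2 (i - n))"
    (is "is_svd K ?N ?\<sigma> ?e ?f")
proof -
  have N: "enat i < ?N \<longleftrightarrow> i < n \<or> enat (i - n) < N" for i by (cases N) auto
  have ortho: "orthonormal_upto ?N (\<lambda>i. if i < n then u i else w (i - n))"
    if "orthonormal_upto (enat n) u" "orthonormal_upto N w"
      "\<And>i j. i < n \<Longrightarrow> enat j < N \<Longrightarrow> u i \<bullet> w j = 0" for u w :: "nat \<Rightarrow> 'c::real_inner"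
    using that by (auto simp: orthonormal_upto_def N inner_commute[of "w _" "u _"])
  have lim: "?\<sigma> \<longlonglongrightarrow> 0" if "?N = \<infinity>"
  proof (rule LIMSEQ_offset[where k = n])
    have "N = \<infinity>" using that by (cases N) auto
    then show "(\<lambda>i. ?\<sigma> (i + n)) \<longlonglongrightarrow> 0" using svd2 by (simp add: is_svd_def)
  qed
  have sum: "((\<lambda>i. (?\<sigma> i * (v \<bullet> ?e i)) *\<^sub>R ?f i) has_sum K v) {i. enat i < ?N}" for v
  proof -
    let ?g = "\<lambda>i. (?\<sigma> i * (v \<bullet> ?e i)) *\<^sub>R ?f i"
    have "((\<lambda>i. (\<sigma>\<^sub>1 i * (v \<bullet> e\<^sub>1 i)) *\<^sub>R f\<^sub>1 i) has_sum R v) {i. enat i < enat n}"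
      using svd1 unfolding is_svd_def by blast
    then have 1: "(?g has_sum R v) {i. enat i < enat n}"
      by (subst has_sum_cong[where g = "\<lambda>i. (\<sigma>\<^sub>1 i * (v \<bullet> e\<^sub>1 i)) *\<^sub>R f\<^sub>1 i"]) auto
    have "((\<lambda>i. (\<sigma>\<^sub>2 i * (v \<bullet> e\<^sub>2 i)) *\<^sub>R f\<^sub>2 i) has_sum T v) {i. enat i < N}"
      using svd2 unfolding is_svd_def by blast
    then have "((?g \<circ> (\<lambda>i. i + n)) has_sum T v) {i. enat i < N}" by (simp add: comp_def)
    then have 2: "(?g has_sum T v) ((\<lambda>i. i + n) ` {i. enat i < N})"
      by (subst has_sum_reindex) (auto simp: inj_on_def)
    have "(?g has_sum R v + T v) ({i. enat i < enat n} \<union> (\<lambda>i. i + n) ` {i. enat i < N})"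
      by (rule has_sum_Un_disjoint[OF 1 2]) auto
    also have "{i. enat i < enat n} \<union> (\<lambda>i. i + n) ` {i. enat i < N} = {i. enat i < ?N}"
    proof -
      have "i \<in> (\<lambda>i. i + n) ` {i. enat i < N}" if "\<not> i < n" "enat (i - n) < N" for i
        using that by (intro image_eqI[of _ _ "i - n"]) auto
      then show ?thesis by (auto simp: N)
    qed
    finally show ?thesis by (simp add: K)
  qed
  show ?thesis
    unfolding is_svd_def
  proof (intro conjI allI impI)
    show "0 < ?\<sigma> i" if "enat i < ?N" for i
      using that svd1 svd2 by (auto simp: N is_svd_def)
    show "?\<sigma> j \<le> ?\<sigma> i" if "i \<le> j" "enat j < ?N" for i j
      using that svd1 svd2 le by (auto simp: N is_svd_def)
    show "orthonormal_upto ?N ?e"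
      by (rule ortho[OF _ _ e_perp]) (use svd1 svd2 in \<open>simp_all add: is_svd_def\<close>)
    show "orthonormal_upto ?N ?f"
      by (rule ortho[OF _ _ f_perp]) (use svd1 svd2 in \<open>simp_all add: is_svd_def\<close>)
  qed (use lim sum in auto)
qed

context reduced_rank_problem
begin

text \<open>A vector orthogonal to \<open>range WA\<close> is killed by \<open>K\<close>, hence
  orthogonal to each singular vector \<open>e i\<close>; closedness of the range then puts
  \<open>e i\<close> inside it. Maximality of the energy is Ky Fan's principle.\<close>

lemma admissible_frame:
  assumes "admissible R"
  obtains k e where "k \<le> r" "frame k e" "\<forall>v. R v = (\<Sum>i<k. (v \<bullet> e i) *\<^sub>R K (e i))"
    "\<forall>m h. frame m h \<longrightarrow> m \<le> r \<longrightarrow> energy m h \<le> energy k e"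
proof -
  obtain N \<sigma> e f where svd: "is_svd K N \<sigma> e f"
    and R: "R = (\<lambda>v. \<Sum>i | i < r \<and> enat i < N. (\<sigma> i * (v \<bullet> e i)) *\<^sub>R f i)"
    using assms by (auto simp: is_truncated_svd_def)
  obtain k where k: "k \<le> r" and J: "{i. i < r \<and> enat i < N} = {..<k}" by (rule truncation_index_set)
  have N: "enat i < N" if "i < k" for i using J that by auto
  have Ke: "K (e i) = \<sigma> i *\<^sub>R f i" if "i < k" for i
    using is_svd_apply[OF K.bounded_linear_axioms svd N[OF that]] .
  have on: "orthonormal_on {i. enat i < N} e" "orthonormal_on {i. enat i < N} f"
    using svd by (simp_all add: is_svd_def orthonormal_upto_iff)
  have "e i \<in> range WA" if "i < k" for i
  proof -
    have "e i \<bullet> w = 0" if w: "w \<in> (range WA)\<^sup>\<bottom>" for w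
      using is_svd_inner_left[OF svd N[OF \<open>i < k\<close>], of w] K_perp[OF w] svd N[OF \<open>i < k\<close>]
      by (simp add: is_svd_def inner_commute less_le)
    then have "e i \<in> (range WA)\<^sup>\<bottom>\<^sup>\<bottom>" by (simp add: orthogonal_comp_iff)
    then show ?thesis using orthogonal_comp_comp[OF subspace_range[OF WA] closed_range] by simp
  qed
  moreover have "{..<k} \<subseteq> {i. enat i < N}" using N by auto
  ultimately have frame: "frame k e"
    using orthonormal_on_mono[OF on(1)] unfolding frame_def by blast
  have "R v = (\<Sum>i<k. (v \<bullet> e i) *\<^sub>R K (e i))" for v
    unfolding R J by (intro sum.cong) (auto simp: Ke)
  moreover have "energy m h \<le> energy k e" if "frame m h" "m \<le> r" for m h
  proof -
    have "energy m h \<le> (\<Sum>i<k. (\<sigma> i)\<^sup>2)"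
      using ky_fan[OF svd _ that(2), of h] that(1) by (simp add: J energy_def frame_def)
    also have "\<dots> = energy k e"
      unfolding energy_def using orthonormal_on_norm[OF on(2)] N
      by (intro sum.cong) (auto simp: Ke)
    finally show ?thesis .
  qed
  ultimately show ?thesis using that k frame by blast
qed

text \<open>Since each \<open>K (e i)\<close> lies in \<open>range S\<close>, the Moore-Penrose
  inverse is only evaluated inside its domain. So \<open>mp_inv S \<circ> R\<close> has an explicit
  finite-rank formula, from which the adjoint is read off.\<close>

lemma Ahat_eq_synthesis:
  assumes R: "\<forall>v. R v = (\<Sum>i<k. (v \<bullet> e i) *\<^sub>R K (e i))" and frame: "frame k e"
    and range: "\<And>i. i < k \<Longrightarrow> K (e i) \<in> range S"
  shows "Ahat R = synthesis k e (\<lambda>i. mp_inv S (K (e i)))"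
proof -
  let ?p = "\<lambda>i. mp_inv S (K (e i))"
  have "mp_inv S (R v) = (\<Sum>i<k. (v \<bullet> e i) *\<^sub>R ?p i)" for v
  proof -
    have "(\<Sum>i<k. (v \<bullet> e i) *\<^sub>R ?p i) \<in> (ker S)\<^sup>\<bottom>"
      using mp_inv_in[OF S range] by (intro subspace_sum subspace_scale subspace_orthogonal_comp) auto
    moreover have "S (\<Sum>i<k. (v \<bullet> e i) *\<^sub>R ?p i) = R v"
      unfolding R[rule_format] S.sum S.scaleR using apply_mp_inv[OF S range] by (intro sum.cong) auto
    ultimately show ?thesis using mp_inv_apply[OF S] by metis
  qed
  then have "adjoint (mp_inv S \<circ> R) = (\<lambda>z. \<Sum>i<k. (z \<bullet> ?p i) *\<^sub>R e i)"
    by (intro adjoint_unique) (simp add: inner_sum_left inner_sum_right inner_commute mult.commute)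
  then show ?thesis by (auto simp: mp_inv_combination[OF frame])
qed

text \<open>Rotating a singular vector of a maximizing frame towards an orthogonal direction cannot increase
  the energy; the first-order condition gives the orthogonality of the images.\<close>

lemma energy_maximal_rotate:
  assumes frame: "frame n a" and max: "\<And>h. frame n h \<Longrightarrow> energy n h \<le> energy n a"
    and i: "i < n" and c: "norm c = 1" "c \<in> range WA" "\<And>j. j < n \<Longrightarrow> a j \<bullet> c = 0"
  shows "K (a i) \<bullet> K c = 0" "norm (K c) \<le> norm (K (a i))"
proof -
  have on: "orthonormal_on {..<n} a" and a_in: "a j \<in> range WA" if "j < n" for j
    using frame that by (auto simp: frame_def)
  have aa: "a j \<bullet> a k = (if j = k then 1 else 0)" if "j < n" "k < n" for j k
    using orthonormal_onD[OF on[OF i]] that by simp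
  have cc: "c \<bullet> c = 1" using c(1) by (simp add: norm_eq_1)
  have key: "0 \<le> t * (- (2 * (K (a i) \<bullet> K c))) + t\<^sup>2 * ((norm (K (a i)))\<^sup>2 - (norm (K c))\<^sup>2)" for t
  proof -
    define q where "q = 1 + t\<^sup>2"
    define w where "w = (1 / sqrt q) *\<^sub>R (a i + t *\<^sub>R c)"
    have q: "0 < q" by (simp add: q_def add_pos_nonneg)
    have "(a i + t *\<^sub>R c) \<bullet> (a i + t *\<^sub>R c) = q"
      using aa[OF i i] cc c(3)[OF i]
      by (simp add: q_def inner_add_left inner_add_right inner_commute power2_eq_square)
    then have "w \<bullet> w = 1" using q by (simp add: w_def)
    moreover have "a j \<bullet> w = 0" if "j < n" "j \<noteq> i" for j
      using that aa[of j i] i c(3)[of j] by (simp add: w_def inner_add_right)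
    ultimately have "orthonormal_on {..<n} (a(i := w))"
      using aa by (auto simp: orthonormal_on_def inner_commute[of w "a _"])
    moreover have "w \<in> range WA"
      unfolding w_def using a_in[OF i] c(2) subspace_range[OF WA]
      by (intro subspace_scale subspace_add) auto
    ultimately have "frame n (a(i := w))" using a_in by (auto simp: frame_def)
    then have "energy n (a(i := w)) \<le> energy n a" by (rule max)
    moreover have "energy n (a(i := w)) = (norm (K w))\<^sup>2 + (\<Sum>j\<in>{..<n} - {i}. (norm (K (a j)))\<^sup>2)"
      unfolding energy_def using i by (subst sum.remove[of _ i]) auto
    moreover have "energy n a = (norm (K (a i)))\<^sup>2 + (\<Sum>j\<in>{..<n} - {i}. (norm (K (a j)))\<^sup>2)"
      unfolding energy_def using i by (subst sum.remove[of _ i]) auto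
    ultimately have "(norm (K w))\<^sup>2 \<le> (norm (K (a i)))\<^sup>2" by simp
    moreover have "(norm (K w))\<^sup>2 = (norm (K (a i + t *\<^sub>R c)))\<^sup>2 / q"
      using q by (simp add: w_def K.scaleR power_divide)
    ultimately have "(norm (K (a i + t *\<^sub>R c)))\<^sup>2 \<le> (norm (K (a i)))\<^sup>2 * q"
      using q by (simp add: divide_le_eq)
    moreover have "(norm (K (a i + t *\<^sub>R c)))\<^sup>2
        = (norm (K (a i)))\<^sup>2 + t * (2 * (K (a i) \<bullet> K c)) + t\<^sup>2 * (norm (K c))\<^sup>2"
      unfolding power2_norm_eq_inner
      by (simp add: K.add K.scaleR inner_add_left inner_add_right inner_commute algebra_simps power2_eq_square)
    ultimately show ?thesis by (simp add: q_def algebra_simps)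
  qed
  show zero: "K (a i) \<bullet> K c = 0" using linear_term_zero[OF key] by simp
  show "norm (K c) \<le> norm (K (a i))"
  proof (rule power2_le_imp_le)
    show "(norm (K c))\<^sup>2 \<le> (norm (K (a i)))\<^sup>2" using key[of 1] zero by simp
  qed simp
qed

text \<open>With \<open>P\<close> the projector onto the span of \<open>h\<close>, \<open>R\<close>
  is \<open>K P\<close> and \<open>T\<close> below is \<open>K (1 - P)\<close>. Maximality orders
  and separates the decompositions of \<open>R\<close> and \<open>T\<close>, so they join to one of
  \<open>K\<close> with head \<open>R\<close>. If the head is shorter than \<open>r\<close>,
  maximality also forces \<open>T = 0\<close>, so cutting at \<open>r\<close> returns exactly
  \<open>R\<close>.\<close>

lemma maximal_frame_truncated_svd:
  assumes m: "m \<le> r" and frame: "frame m h" and R: "\<forall>v. R v = (\<Sum>i<m. (v \<bullet> h i) *\<^sub>R K (h i))"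
    and max: "\<And>m' h'. frame m' h' \<Longrightarrow> m' \<le> r \<Longrightarrow> energy m' h' \<le> energy m h"
  shows "is_truncated_svd r K R"
proof -
  have on: "orthonormal_on {..<m} h" and h_in: "\<And>i. i < m \<Longrightarrow> h i \<in> range WA"
    using frame by (auto simp: frame_def)
  have R_perp: "R v = 0" if "\<And>i. i < m \<Longrightarrow> v \<bullet> h i = 0" for v
    using that by (simp add: R)
  have R_lin: "bounded_linear R"
  proof -
    have "bounded_linear (\<lambda>v. \<Sum>i<m. (v \<bullet> h i) *\<^sub>R K (h i))"
      by (intro bounded_linear_sum bounded_linear_scaleR_left[THEN bounded_linear_compose] bounded_linear_inner_left)
    also have "(\<lambda>v. \<Sum>i<m. (v \<bullet> h i) *\<^sub>R K (h i)) = R" using R by auto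
    finally show ?thesis .
  qed
  interpret R: bounded_linear R by fact
  have Rh: "R (h i) = K (h i)" if "i < m" for i
  proof -
    have "R (h i) = (\<Sum>j<m. if j = i then K (h j) else 0)"
      unfolding R[rule_format] using orthonormal_onD[OF on] that by (intro sum.cong) auto
    then show ?thesis using that by simp
  qed
  have "compact_op R"
    unfolding compact_op_def using R_lin R_perp by (auto intro!: exI[of _ "h ` {..<m}"])
  then obtain N\<^sub>1 \<tau> a b where svd1: "is_svd R N\<^sub>1 \<tau> a b" using compact_op_svd by blast
  have on_a: "orthonormal_on {i. enat i < N\<^sub>1} a" and on_b: "orthonormal_on {i. enat i < N\<^sub>1} b"
    using svd1 by (simp_all add: is_svd_def orthonormal_upto_iff)
  have \<tau>: "0 < \<tau> i" if "enat i < N\<^sub>1" for i using svd1 that by (simp add: is_svd_def)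
  have a_span: "(\<Sum>j<m. (a i \<bullet> h j) *\<^sub>R h j) = a i" if i: "enat i < N\<^sub>1" for i
  proof -
    \<comment> \<open>The remainder of \<open>a i\<close> outside the span of \<open>h\<close> is
      killed by \<open>R\<close>, hence orthogonal to \<open>a i\<close> and to every
      \<open>h j\<close>, hence to itself.\<close>
    define d where "d = a i - (\<Sum>j<m. (a i \<bullet> h j) *\<^sub>R h j)"
    have dh: "d \<bullet> h j = 0" if "j < m" for j
      unfolding d_def using orthonormal_remainder[OF on, of j] that by simp
    then have "R d = 0" by (rule R_perp)
    then have "d \<bullet> a i = 0" using is_svd_inner_left[OF svd1 i, of d] \<tau>[OF i] by simp
    then have "d \<bullet> d = 0" by (subst (2) d_def) (simp add: inner_diff_right inner_sum_right dh)
    then show ?thesis by (simp add: d_def)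
  qed
  have Ra: "R (a i) = \<tau> i *\<^sub>R b i" if "enat i < N\<^sub>1" for i by (rule is_svd_apply[OF R_lin svd1 that])
  have Ka: "K (a i) = R (a i)" if "enat i < N\<^sub>1" for i
    unfolding R[rule_format] by (subst a_span[OF that, symmetric]) (simp add: K.sum K.scaleR)
  have parseval: "(\<Sum>j<m. (h j \<bullet> a i)\<^sup>2) = 1" if "enat i < N\<^sub>1" for i
    using norm_sum_orthonormal[OF on, of "\<lambda>j. a i \<bullet> h j"] a_span[OF that] orthonormal_on_norm[OF on_a] that
    by (simp add: inner_commute)
  \<comment> \<open>Double counting of \<open>(h j \<bullet> a i)\<^sup>2\<close>: each
    \<open>a i\<close> contributes exactly 1 by Parseval, each \<open>h j\<close> at most 1 by
    Bessel. In particular \<open>R\<close> has finitely many singular values.\<close>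
  have card: "card F \<le> m" if "finite F" "F \<subseteq> {i. enat i < N\<^sub>1}" for F
  proof -
    have "real (card F) = (\<Sum>i\<in>F. \<Sum>j<m. (h j \<bullet> a i)\<^sup>2)" using that parseval by (simp add: subset_iff)
    also have "\<dots> = (\<Sum>j<m. \<Sum>i\<in>F. (h j \<bullet> a i)\<^sup>2)" by (rule sum.swap)
    also have "\<dots> \<le> (\<Sum>j<m. (norm (h j))\<^sup>2)"
      by (intro sum_mono bessel orthonormal_on_mono[OF on_a] that)
    also have "\<dots> = real m" using orthonormal_on_norm[OF on] by simp
    finally show ?thesis by simp
  qed
  obtain n where n: "N\<^sub>1 = enat n" using card[of "{..<Suc m}"] by (cases N\<^sub>1) auto
  have "n \<le> m" using card[of "{..<n}"] by (auto simp: n)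
  have a_in: "a i \<in> range WA" if "i < n" for i
  proof -
    have "(\<Sum>j<m. (a i \<bullet> h j) *\<^sub>R h j) \<in> range WA"
      using h_in subspace_range[OF WA] by (intro subspace_sum subspace_scale) auto
    then show ?thesis using a_span[of i] that by (simp only: n enat_ord_simps)
  qed
  have frame_a: "frame n a" using on_a a_in by (auto simp: frame_def n lessThan_def)
  \<comment> \<open>Passing from \<open>h\<close> to the singular vectors \<open>a\<close> of
    \<open>R\<close> preserves the energy, so \<open>a\<close> is a maximizing frame as well and can
    be rotated.\<close>
  have "energy m h = (\<Sum>j<m. \<Sum>i<n. (\<tau> i)\<^sup>2 * (h j \<bullet> a i)\<^sup>2)"
    unfolding energy_def
  proof (intro sum.cong refl)
    fix j assume "j \<in> {..<m}"
    then have "(norm (K (h j)))\<^sup>2 = (norm (R (h j)))\<^sup>2" by (simp add: Rh)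
    also have "\<dots> = (\<Sum>i<n. (\<tau> i)\<^sup>2 * (h j \<bullet> a i)\<^sup>2)"
    proof (rule has_sum_unique[OF _ has_sum_finite[OF finite_lessThan]])
      show "((\<lambda>i. (\<tau> i)\<^sup>2 * (h j \<bullet> a i)\<^sup>2) has_sum (norm (R (h j)))\<^sup>2) {..<n}"
        using has_sum_inner_self[OF svd1, of "h j"] by (simp add: n lessThan_def)
    qed
    finally show "(norm (K (h j)))\<^sup>2 = (\<Sum>i<n. (\<tau> i)\<^sup>2 * (h j \<bullet> a i)\<^sup>2)" .
  qed
  also have "\<dots> = (\<Sum>i<n. (\<tau> i)\<^sup>2 * (\<Sum>j<m. (h j \<bullet> a i)\<^sup>2))"
    by (subst sum.swap) (simp add: sum_distrib_left)
  also have "\<dots> = energy n a"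
    unfolding energy_def using orthonormal_on_norm[OF on_b]
    by (intro sum.cong) (auto simp: n parseval Ka Ra power_mult_distrib)
  finally have max_a: "energy m' h' \<le> energy n a" if "frame m' h'" "m' \<le> r" for m' h'
    using max[OF that] by simp
  define T where "T v = K v - R v" for v
  have T_lin: "bounded_linear T"
    unfolding T_def by (intro bounded_linear_sub K.bounded_linear_axioms R_lin)
  have "compact_op T"
    unfolding compact_op_def
  proof (intro conjI allI impI)
    fix \<epsilon> :: real assume "0 < \<epsilon>"
    then obtain F where F: "finite F" "\<And>v. (\<And>u. u \<in> F \<Longrightarrow> v \<bullet> u = 0) \<Longrightarrow> norm (K v) \<le> \<epsilon> * norm v"
      using compact_opD[OF K] by blast
    show "\<exists>F. finite F \<and> (\<forall>v. (\<forall>u\<in>F. v \<bullet> u = 0) \<longrightarrow> norm (T v) \<le> \<epsilon> * norm v)"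
      using F R_perp by (intro exI[of _ "F \<union> h ` {..<m}"]) (auto simp: T_def)
  qed (rule T_lin)
  then obtain N\<^sub>2 \<rho> c d where svd2: "is_svd T N\<^sub>2 \<rho> c d" using compact_op_svd by blast
  have on_c: "orthonormal_on {i. enat i < N\<^sub>2} c" using svd2 by (simp add: is_svd_def orthonormal_upto_iff)
  have \<rho>: "0 < \<rho> j" if "enat j < N\<^sub>2" for j using svd2 that by (simp add: is_svd_def)
  have c_perp: "c j \<bullet> v = 0" if "enat j < N\<^sub>2" "T v = 0" for j v
    using is_svd_inner_left[OF svd2 that(1), of v] that(2) \<rho>[OF that(1)] by (simp add: inner_commute)
  have ch: "c j \<bullet> h i = 0" if "enat j < N\<^sub>2" "i < m" for i j
    by (rule c_perp) (simp_all add: that T_def Rh)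
  have ca: "a i \<bullet> c j = 0" if "enat j < N\<^sub>2" "i < n" for i j
    using c_perp[of j "a i"] that Ka by (simp add: T_def n inner_commute)
  have c_in: "c j \<in> range WA" if j: "enat j < N\<^sub>2" for j
  proof -
    have "c j \<bullet> w = 0" if w: "w \<in> (range WA)\<^sup>\<bottom>" for w
    proof (rule c_perp[OF j])
      have "R w = 0" using w h_in unfolding orthogonal_comp_iff by (intro R_perp) blast
      then show "T w = 0" by (simp add: T_def K_perp[OF w])
    qed
    then have "c j \<in> (range WA)\<^sup>\<bottom>\<^sup>\<bottom>" by (simp add: orthogonal_comp_iff)
    then show ?thesis using orthogonal_comp_comp[OF subspace_range[OF WA] closed_range] by simp
  qed
  have Kc: "K (c j) = \<rho> j *\<^sub>R d j" if "enat j < N\<^sub>2" for j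
    using is_svd_apply[OF T_lin svd2 that] R_perp[of "c j"] ch[OF that] by (simp add: T_def)
  have norm_d: "norm (d j) = 1" if "enat j < N\<^sub>2" for j
    using svd2 that by (simp add: is_svd_def orthonormal_upto_def norm_eq_1)
  have norm_b: "norm (b i) = 1" if "i < n" for i using orthonormal_on_norm[OF on_b] that by (simp add: n)
  have Ka': "K (a i) = \<tau> i *\<^sub>R b i" if "i < n" for i using Ka Ra that by (simp add: n)
  have \<tau>': "0 < \<tau> i" if "i < n" for i using \<tau> that by (simp add: n)
  have rotate: "K (a i) \<bullet> K (c j) = 0" "norm (K (c j)) \<le> norm (K (a i))" if "i < n" "enat j < N\<^sub>2" for i j
    using energy_maximal_rotate[OF frame_a _ that(1) _ c_in[OF that(2)]] max_a \<open>n \<le> m\<close> m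
      orthonormal_on_norm[OF on_c] ca that by auto
  have svd: "is_svd K (enat n + N\<^sub>2) (\<lambda>i. if i < n then \<tau> i else \<rho> (i - n))
    (\<lambda>i. if i < n then a i else c (i - n)) (\<lambda>i. if i < n then b i else d (i - n))"
  proof (rule is_svd_append[OF _ svd1[unfolded n] svd2])
    fix i j assume ij: "i < n" "enat j < N\<^sub>2"
    show "\<rho> j \<le> \<tau> i"
      using rotate(2)[OF ij] norm_d[OF ij(2)] norm_b[OF ij(1)] \<rho>[OF ij(2)] \<tau>'[OF ij(1)]
      by (simp add: Ka'[OF ij(1)] Kc[OF ij(2)])
    show "b i \<bullet> d j = 0"
      using rotate(1)[OF ij] \<rho>[OF ij(2)] \<tau>'[OF ij(1)] by (simp add: Ka'[OF ij(1)] Kc[OF ij(2)])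
    show "a i \<bullet> c j = 0" by (rule ca[OF ij(2,1)])
  qed (simp add: T_def)
  \<comment> \<open>With room for another vector, appending \<open>c 0\<close> would raise the
    energy by \<open>(\<rho> 0)\<^sup>2\<close>.\<close>
  have "N\<^sub>2 = 0" if "n < r"
  proof (rule ccontr)
    assume "N\<^sub>2 \<noteq> 0"
    then have 0: "enat 0 < N\<^sub>2" by (simp add: enat_0)
    have "orthonormal_on {..<Suc n} (a(n := c 0))"
      using frame_a orthonormal_on_norm[OF on_c] ca[OF 0] 0
      by (intro orthonormal_on_extend) (auto simp: frame_def inner_commute)
    then have "frame (Suc n) (a(n := c 0))"
      using a_in c_in[OF 0] by (auto simp: frame_def less_Suc_eq)
    then have "energy (Suc n) (a(n := c 0)) \<le> energy n a" using that by (intro max_a) auto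
    moreover have "energy (Suc n) (a(n := c 0)) = energy n a + (\<rho> 0)\<^sup>2"
      using norm_d[OF 0] by (simp add: energy_def Kc[OF 0] lessThan_Suc)
    ultimately show False using \<rho>[OF 0] by simp
  qed
  then have set_eq: "{i. i < r \<and> enat i < enat n + N\<^sub>2} = {..<n}"
    using \<open>n \<le> m\<close> m by (cases "n < r"; cases N\<^sub>2) auto
  have "R v = (\<Sum>i<n. (\<tau> i * (v \<bullet> a i)) *\<^sub>R b i)" for v
  proof -
    have "((\<lambda>i. (\<tau> i * (v \<bullet> a i)) *\<^sub>R b i) has_sum R v) {..<n}"
      using svd1 by (simp add: is_svd_def n lessThan_def)
    then show ?thesis using has_sum_finite[of "{..<n}"] has_sum_unique by blast
  qed
  then have "R = (\<lambda>v. \<Sum>i | i < r \<and> enat i < enat n + N\<^sub>2. ((if i < n then \<tau> i else \<rho> (i - n)) *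
      (v \<bullet> (if i < n then a i else c (i - n)))) *\<^sub>R (if i < n then b i else d (i - n)))"
    unfolding set_eq by auto
  with svd show ?thesis unfolding is_truncated_svd_def by blast
qed

lemma solution_admissible:
  assumes "solution A"
  shows "admissible (reduced A)"
proof -
  obtain m h where "m \<le> r" "frame m h" "\<forall>v. reduced A v = (\<Sum>i<m. (v \<bullet> h i) *\<^sub>R K (h i))"
    "\<forall>m' h'. frame m' h' \<longrightarrow> m' \<le> r \<longrightarrow> energy m' h' \<le> energy m h"
    using assms by (rule solution_frame)
  then have "is_truncated_svd r K (reduced A)" by (intro maximal_frame_truncated_svd) auto
  then show ?thesis by (auto simp: reduced_def)
qed

text \<open>Here the targets satisfy \<open>S (p i) = K (e i)\<close> exactly, so the fitting error
  is zero while the energy is maximal; any competitor has a nonnegative error and at most this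
  energy.\<close>

lemma admissible_Ahat:
  assumes adm: "admissible R"
  shows "solution (Ahat R)" "minimal (Ahat R)" "reduced (Ahat R) = R"
proof -
  obtain k e where k: "k \<le> r" and frame: "frame k e" and R: "\<forall>v. R v = (\<Sum>i<k. (v \<bullet> e i) *\<^sub>R K (e i))"
    and max: "\<forall>m h. frame m h \<longrightarrow> m \<le> r \<longrightarrow> energy m h \<le> energy k e"
    using adm by (rule admissible_frame)
  have on: "orthonormal_on {..<k} e" using frame by (simp add: frame_def)
  have Re: "R (e i) = K (e i)" if "i < k" for i
  proof -
    have "R (e i) = (\<Sum>j<k. if j = i then K (e j) else 0)"
      unfolding R[rule_format] using orthonormal_onD[OF on] that by (intro sum.cong) auto
    then show ?thesis using that by simp
  qed
  then have Ke: "K (e i) \<in> range S" if "i < k" for i using adm that by (metis rangeI subsetD)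
  define p where "p i = mp_inv S (K (e i))" for i
  have Ahat: "Ahat R = synthesis k e p" unfolding p_def by (rule Ahat_eq_synthesis[OF R frame Ke])
  have Sp: "S (p i) = K (e i)" if "i < k" for i unfolding p_def by (rule apply_mp_inv[OF S Ke[OF that]])
  have p_in: "p i \<in> (ker S)\<^sup>\<bottom>" if "i < k" for i unfolding p_def by (rule mp_inv_in[OF S Ke[OF that]])
  show "reduced (Ahat R) = R"
    unfolding Ahat by (rule ext) (simp add: reduced_def adjoint_synthesis[OF frame] S.sum S.scaleR Sp R)
  have "loss (synthesis k e p) \<le> loss A" if A: "A \<in> bounded_rank_le r" for A
  proof -
    obtain m h where m: "m \<le> r" "frame m h"
      and "\<forall>v. reduced A v = (\<Sum>i<m. (v \<bullet> h i) *\<^sub>R reduced A (h i))"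
      and loss: "loss A = c\<^sub>0 + (\<Sum>i<m. (norm (reduced A (h i) - K (h i)))\<^sup>2) - energy m h"
      using A by (rule bounded_rank_frame)
    have "0 \<le> (\<Sum>i<m. (norm (reduced A (h i) - K (h i)))\<^sup>2)" by (simp add: sum_nonneg)
    moreover have "energy m h \<le> energy k e" using max m by blast
    ultimately show ?thesis using loss by (simp add: loss_synthesis[OF frame] Sp)
  qed
  then show "solution (Ahat R)"
    using synthesis_rank[OF k] unfolding Ahat is_arg_min_def by (auto simp: not_less)
  have "synthesis k e p z \<in> (ker WA)\<^sup>\<bottom>" for z
    unfolding synthesis_def
    by (intro subspace_sum subspace_scale subspace_orthogonal_comp frame_apply_mp_inv[OF frame]) simp
  moreover have "synthesis k e p (proj ((ker S)\<^sup>\<bottom>) z) = synthesis k e p z" for z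
    unfolding synthesis_def
    by (intro sum.cong) (auto simp: inner_proj_left subspace_orthogonal_comp closed_orthogonal_comp p_in)
  ultimately show "minimal (Ahat R)"
    unfolding Ahat by (auto simp: proj_id subspace_orthogonal_comp)
qed

text \<open>Minimality puts the values of \<open>A\<close> into
  \<open>(ker WA)\<^sup>\<bottom>\<close> and those of \<open>adjoint A \<circ> adjoint WA\<close>
  into \<open>(ker S)\<^sup>\<bottom>\<close>, where the Moore-Penrose inverses undo
  \<open>WA\<close> and \<open>S\<close>.\<close>

lemma minimal_Ahat_reduced:
  assumes "bounded_linear A" "minimal A"
  shows "Ahat (reduced A) = A"
proof -
  interpret A: bounded_linear A by fact
  have min: "proj ((ker WA)\<^sup>\<bottom>) (A (proj ((ker S)\<^sup>\<bottom>) z)) = A z" for z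
    using fun_cong[OF assms(2), of z] by simp
  have A_ker: "A z = 0" if "z \<in> ker S" for z
  proof -
    have "z \<in> (ker S)\<^sup>\<bottom>\<^sup>\<bottom>" using that orthogonal_comp_subset by blast
    then have "proj ((ker S)\<^sup>\<bottom>) z = 0" by (intro proj_zero subspace_orthogonal_comp)
    then show ?thesis using min[of z]
      by (simp add: A.zero proj_id subspace_orthogonal_comp subspace_0)
  qed
  have A_range: "A z \<in> (ker WA)\<^sup>\<bottom>" for z
    using proj_in[OF subspace_orthogonal_comp closed_orthogonal_comp] min by metis
  have adj: "adjoint A (adjoint WA v) \<bullet> z = v \<bullet> WA (A z)" for v z
    by (simp add: adjoint_inner[OF assms(1)] adjoint_inner[OF WA])
  have "adjoint A (adjoint WA v) \<in> (ker S)\<^sup>\<bottom>" for v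
    by (simp add: orthogonal_comp_iff adj A_ker WA.zero)
  then have "mp_inv S \<circ> reduced A = (\<lambda>v. adjoint A (adjoint WA v))"
    by (auto simp: reduced_def mp_inv_apply[OF S])
  moreover have "adjoint (\<lambda>v. adjoint A (adjoint WA v)) = (\<lambda>z. WA (A z))"
    by (rule adjoint_unique) (simp add: adj)
  ultimately show ?thesis by (auto simp: mp_inv_apply[OF WA A_range])
qed

text \<open>\<open>reduced\<close> and \<open>Ahat\<close> are mutually inverse between minimal
  solutions and admissible truncations, so uniqueness on one side is uniqueness on the
  other.\<close>

theorem solutions_characterization:
  "((\<exists>A. solution A) \<longleftrightarrow> (\<exists>R. admissible R)) \<and>
    (\<forall>R. admissible R \<longrightarrow> solution (Ahat R) \<and> minimal (Ahat R) \<and>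
      ((\<forall>A. solution A \<and> minimal A \<longrightarrow> A = Ahat R) \<longleftrightarrow> (\<forall>R'. admissible R' \<longrightarrow> R' = R)))"
proof -
  have "A = Ahat (reduced A)" if "solution A" "minimal A" for A
    using minimal_Ahat_reduced[OF _ that(2)] that(1) by (simp add: is_arg_min_def bounded_rank_le_def)
  then show ?thesis using solution_admissible admissible_Ahat by metis
qed

end

section \<open>Covariance operators\<close>

lemma subspace_closure:
  fixes W :: "'a::real_normed_vector set"
  assumes "subspace W"
  shows "subspace (closure W)"
proof (rule subspaceI)
  show "0 \<in> closure W" using subspace_0[OF assms] closure_subset by blast
  show "u + v \<in> closure W" if uv: "u \<in> closure W" "v \<in> closure W" for u v
  proof -
    obtain s t where "\<And>n. s n \<in> W" "s \<longlonglongrightarrow> u" "\<And>n. t n \<in> W" "t \<longlonglongrightarrow> v"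
      using uv unfolding closure_sequential by blast
    then show ?thesis
      unfolding closure_sequential using subspace_add[OF assms]
      by (intro exI[of _ "\<lambda>n. s n + t n"]) (auto intro: tendsto_add)
  qed
  show "c *\<^sub>R u \<in> closure W" if u: "u \<in> closure W" for c u
  proof -
    obtain s where "\<And>n. s n \<in> W" "s \<longlonglongrightarrow> u" using u unfolding closure_sequential by blast
    then show ?thesis
      unfolding closure_sequential using subspace_scale[OF assms]
      by (intro exI[of _ "\<lambda>n. c *\<^sub>R s n"]) (auto intro: tendsto_intros)
  qed
qed

text \<open>Douglas' lemma for one vector: \<open>Q g\<close> determines
  \<open>c \<bullet> g\<close> by the bound, and the Riesz representative \<open>v\<close> of this
  functional satisfies \<open>Q v = c\<close>. Lying in the closure of \<open>range Q\<close>, it is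
  orthogonal to \<open>ker Q\<close>, hence it is the Moore-Penrose preimage.\<close>

lemma
  fixes Q :: "'a::{real_inner, banach} \<Rightarrow> 'a"
  assumes Q: "bounded_linear Q" and sa: "\<And>u v. Q u \<bullet> v = u \<bullet> Q v"
    and "0 \<le> \<kappa>" and bound: "\<And>g. \<bar>c \<bullet> g\<bar> \<le> \<kappa> * norm (Q g)"
  shows douglas_range: "c \<in> range Q" and douglas_norm: "norm (mp_inv Q c) \<le> \<kappa>"
proof -
  interpret Q: bounded_linear Q by fact
  \<comment> \<open>The choice of the preimage is immaterial: \<open>c\<close> is orthogonal to
    \<open>ker Q\<close> by the bound.\<close>
  define \<phi> where "\<phi> w = c \<bullet> (SOME g. Q g = w)" for w
  have \<phi>: "\<phi> (Q g) = c \<bullet> g" for g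
  proof -
    define g' where "g' = (SOME g'. Q g' = Q g)"
    have "Q g' = Q g" unfolding g'_def by (rule someI) simp
    then have "\<bar>c \<bullet> (g' - g)\<bar> \<le> 0" using bound[of "g' - g"] by (simp add: Q.diff)
    then show ?thesis by (simp add: \<phi>_def g'_def inner_diff_right)
  qed
  have "\<exists>v\<in>closure (range Q). \<forall>w\<in>range Q. v \<bullet> w = \<phi> w"
  proof (rule riesz_on_subspace[OF subspace_range[OF Q]])
    fix u v assume "u \<in> range Q" "v \<in> range Q"
    then show "\<phi> (u + v) = \<phi> u + \<phi> v" by (auto simp: \<phi> inner_add_right simp flip: Q.add)
  next
    fix t u assume "u \<in> range Q"
    then show "\<phi> (t *\<^sub>R u) = t * \<phi> u" by (auto simp: \<phi> simp flip: Q.scaleR)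
  qed (use \<phi> bound in auto)
  then obtain v where v: "v \<in> closure (range Q)" and v\<phi>: "\<And>g. v \<bullet> Q g = c \<bullet> g"
    using \<phi> by fastforce
  have Qv: "Q v = c" by (subst vector_eq_rdot[symmetric]) (simp add: sa v\<phi>)
  then show "c \<in> range Q" by auto
  have "v \<bullet> k = 0" if "k \<in> ker Q" for k
    by (rule inner_closure_zero[OF v]) (use that sa in \<open>auto simp: ker_def\<close>)
  then have "v \<in> (ker Q)\<^sup>\<bottom>" by (simp add: orthogonal_comp_iff)
  then have "mp_inv Q c = v" using mp_inv_apply[OF Q] Qv by metis
  moreover have "norm v \<le> \<kappa>"
  proof -
    have "closure (range Q) \<subseteq> {w. v \<bullet> w \<le> \<kappa> * norm w}"
      using v\<phi> bound by (intro closure_minimal closed_Collect_le continuous_intros) (auto intro: abs_le_D1)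
    then have "v \<bullet> v \<le> \<kappa> * norm v" using v by auto
    then have "norm v * norm v \<le> \<kappa> * norm v" by (metis power2_eq_square power2_norm_eq_inner)
    then show ?thesis using \<open>0 \<le> \<kappa>\<close> by (cases "v = 0") auto
  qed
  ultimately show "norm (mp_inv Q c) \<le> \<kappa>" by simp
qed

section \<open>Square-integrable variables and their second moments\<close>

lemma square_integrable_measurable: "square_integrable M z \<Longrightarrow> z \<in> borel_measurable M"
  by (simp add: square_integrable_def)

lemma square_integrable_integrable: "square_integrable M z \<Longrightarrow> integrable M (\<lambda>\<omega>. (norm (z \<omega>))\<^sup>2)"
  by (simp add: square_integrable_def)

lemma square_integrable_norm_mult:
  assumes "square_integrable M z" "square_integrable M w"
  shows "integrable M (\<lambda>\<omega>. norm (z \<omega>) * norm (w \<omega>))"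
proof (rule Bochner_Integration.integrable_bound)
  show "integrable M (\<lambda>\<omega>. (norm (z \<omega>))\<^sup>2 + (norm (w \<omega>))\<^sup>2)"
    using assms by (intro Bochner_Integration.integrable_add square_integrable_integrable)
  show "(\<lambda>\<omega>. norm (z \<omega>) * norm (w \<omega>)) \<in> borel_measurable M"
    using assms[THEN square_integrable_measurable] by measurable
  have "a * b \<le> a\<^sup>2 + b\<^sup>2" if "0 \<le> a" "0 \<le> b" for a b :: real
  proof -
    have "2 * (a * b) \<le> a\<^sup>2 + b\<^sup>2" using sum_squares_bound[of a b] by (simp add: mult.assoc)
    moreover have "0 \<le> a * b" using that by simp
    ultimately show ?thesis by linarith
  qed
  then show "AE \<omega> in M. norm (norm (z \<omega>) * norm (w \<omega>)) \<le> norm ((norm (z \<omega>))\<^sup>2 + (norm (w \<omega>))\<^sup>2)"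
    by (simp add: abs_mult)
qed

lemma square_integrable_bound:
  assumes "square_integrable M z" "w \<in> borel_measurable M" "\<And>\<omega>. \<omega> \<in> space M \<Longrightarrow> norm (w \<omega>) \<le> K * norm (z \<omega>)"
  shows "square_integrable M w"
  unfolding square_integrable_def
proof
  show "integrable M (\<lambda>\<omega>. (norm (w \<omega>))\<^sup>2)"
  proof (rule Bochner_Integration.integrable_bound)
    show "integrable M (\<lambda>\<omega>. K\<^sup>2 * (norm (z \<omega>))\<^sup>2)"
      using square_integrable_integrable[OF assms(1)] by simp
    show "(\<lambda>\<omega>. (norm (w \<omega>))\<^sup>2) \<in> borel_measurable M" using assms(2) by measurable
    have "(norm (w \<omega>))\<^sup>2 \<le> (K * norm (z \<omega>))\<^sup>2" if "\<omega> \<in> space M" for \<omega>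
      using assms(3)[OF that] by (intro power_mono) auto
    then show "AE \<omega> in M. norm ((norm (w \<omega>))\<^sup>2) \<le> norm (K\<^sup>2 * (norm (z \<omega>))\<^sup>2)"
      by (auto simp: power_mult_distrib)
  qed
qed (rule assms)

lemma square_integrable_bounded_linear:
  assumes "square_integrable M z" "bounded_linear T"
  shows "square_integrable M (\<lambda>\<omega>. T (z \<omega>))"
proof -
  interpret T: bounded_linear T by fact
  obtain K where K: "\<And>v. norm (T v) \<le> norm v * K" using T.bounded by blast
  have "T \<in> borel_measurable borel"
    by (intro borel_measurable_continuous_onI linear_continuous_on assms)
  from measurable_compose[OF square_integrable_measurable[OF assms(1)] this]
  show ?thesis using K by (intro square_integrable_bound[OF assms(1), of _ K]) (simp_all add: mult.commute)
qed

lemma square_integrable_inner: "square_integrable M z \<Longrightarrow> square_integrable M (\<lambda>\<omega>. z \<omega> \<bullet> e)"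
  by (rule square_integrable_bounded_linear[OF _ bounded_linear_inner_left])

lemma square_integrable_mult:
  fixes f g :: "'w \<Rightarrow> real"
  assumes "square_integrable M f" "square_integrable M g"
  shows "integrable M (\<lambda>\<omega>. f \<omega> * g \<omega>)"
  using assms[THEN square_integrable_measurable]
  by (intro Bochner_Integration.integrable_bound[OF square_integrable_norm_mult[OF assms]]) (auto simp: abs_mult)

lemma cauchy_schwarz_integral:
  fixes f g :: "'w \<Rightarrow> real"
  assumes f: "square_integrable M f" and g: "square_integrable M g"
  shows "\<bar>\<integral>\<omega>. f \<omega> * g \<omega> \<partial>M\<bar> \<le> sqrt (\<integral>\<omega>. (f \<omega>)\<^sup>2 \<partial>M) * sqrt (\<integral>\<omega>. (g \<omega>)\<^sup>2 \<partial>M)"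
proof -
  define F P G where "F = (\<integral>\<omega>. (f \<omega>)\<^sup>2 \<partial>M)" and "P = (\<integral>\<omega>. f \<omega> * g \<omega> \<partial>M)" and "G = (\<integral>\<omega>. (g \<omega>)\<^sup>2 \<partial>M)"
  have int: "integrable M (\<lambda>\<omega>. (f \<omega>)\<^sup>2)" "integrable M (\<lambda>\<omega>. (g \<omega>)\<^sup>2)" "integrable M (\<lambda>\<omega>. f \<omega> * g \<omega>)"
    using square_integrable_integrable[OF f] square_integrable_integrable[OF g] square_integrable_mult[OF f g]
    by simp_all
  have quad: "0 \<le> F + 2 * t * P + t\<^sup>2 * G" for t
  proof -
    have "0 \<le> (\<integral>\<omega>. (f \<omega> + t * g \<omega>)\<^sup>2 \<partial>M)" by (intro integral_nonneg_AE) simp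
    also have "\<dots> = (\<integral>\<omega>. (f \<omega>)\<^sup>2 + 2 * t * (f \<omega> * g \<omega>) + t\<^sup>2 * (g \<omega>)\<^sup>2 \<partial>M)"
      by (intro Bochner_Integration.integral_cong) (simp_all add: power2_sum power_mult_distrib algebra_simps)
    also have "\<dots> = F + 2 * t * P + t\<^sup>2 * G"
      using int by (simp add: F_def P_def G_def)
    finally show ?thesis .
  qed
  have "0 \<le> F" "0 \<le> G" by (simp_all add: F_def G_def)
  have "P\<^sup>2 \<le> F * G"
  proof (cases "G = 0")
    case True
    have "P = 0"
    proof (rule ccontr)
      assume "P \<noteq> 0"
      \<comment> \<open>For \<open>G = 0\<close> the expression is affine in \<open>t\<close>, and
        this \<open>t\<close> gives it the value -1.\<close>
      then show False using quad[of "- (F + 1) / (2 * P)"] True by (simp add: field_simps)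
    qed
    then show ?thesis using \<open>0 \<le> F\<close> True by simp
  next
    case False
    then have "0 < G" using \<open>0 \<le> G\<close> by simp
    \<comment> \<open>\<open>t = - P / G\<close> minimizes the quadratic.\<close>
    have "0 \<le> F + 2 * (- P / G) * P + (- P / G)\<^sup>2 * G" by (rule quad)
    also have "\<dots> = F - P\<^sup>2 / G" using False by (simp add: field_simps power2_eq_square)
    finally show ?thesis using \<open>0 < G\<close> by (simp add: field_simps)
  qed
  then have "sqrt (P\<^sup>2) \<le> sqrt (F * G)" by (rule real_sqrt_le_mono)
  then show ?thesis by (simp add: real_sqrt_mult F_def P_def G_def)
qed

lemma
  fixes w :: "'w \<Rightarrow> 'b::{real_inner, banach, second_countable_topology}"
    and z :: "'w \<Rightarrow> 'a::{real_inner, banach, second_countable_topology}"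
  assumes w: "square_integrable M w" and z: "square_integrable M z"
  shows bounded_linear_covariance: "bounded_linear (covariance M w z)"
    and inner_covariance: "covariance M w z e \<bullet> f = (\<integral>\<omega>. (w \<omega> \<bullet> f) * (e \<bullet> z \<omega>) \<partial>M)"
proof -
  define a where "a e f = (\<integral>\<omega>. (w \<omega> \<bullet> f) * (e \<bullet> z \<omega>) \<partial>M)" for e f
  have int: "integrable M (\<lambda>\<omega>. (w \<omega> \<bullet> f) * (e \<bullet> z \<omega>))" for e f
    using square_integrable_mult[OF square_integrable_inner[OF w, of f] square_integrable_inner[OF z, of e]]
    by (simp add: inner_commute)
  obtain C where C: "bounded_linear C" "\<And>e f. C e \<bullet> f = a e f"
  proof (rule bounded_form_representation[of a "\<integral>\<omega>. norm (w \<omega>) * norm (z \<omega>) \<partial>M"])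
    show "\<bar>a e f\<bar> \<le> (\<integral>\<omega>. norm (w \<omega>) * norm (z \<omega>) \<partial>M) * norm e * norm f" for e f
    proof -
      have "\<bar>a e f\<bar> \<le> (\<integral>\<omega>. \<bar>(w \<omega> \<bullet> f) * (e \<bullet> z \<omega>)\<bar> \<partial>M)" unfolding a_def by (rule integral_abs_bound)
      also have "\<dots> \<le> (\<integral>\<omega>. (norm (w \<omega>) * norm (z \<omega>)) * (norm e * norm f) \<partial>M)"
      proof (rule integral_mono)
        fix \<omega>
        have "\<bar>w \<omega> \<bullet> f\<bar> * \<bar>e \<bullet> z \<omega>\<bar> \<le> (norm (w \<omega>) * norm f) * (norm e * norm (z \<omega>))"
          by (intro mult_mono Cauchy_Schwarz_ineq2) auto
        then show "\<bar>(w \<omega> \<bullet> f) * (e \<bullet> z \<omega>)\<bar> \<le> norm (w \<omega>) * norm (z \<omega>) * (norm e * norm f)"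
          by (simp add: abs_mult mult_ac)
      qed (use int square_integrable_norm_mult[OF w z] in auto)
      also have "\<dots> = (\<integral>\<omega>. norm (w \<omega>) * norm (z \<omega>) \<partial>M) * norm e * norm f" by (simp flip: mult.assoc)
      finally show ?thesis .
    qed
  qed (auto simp: a_def inner_add_left inner_add_right distrib_left distrib_right int mult.left_commute mult.assoc)
  have "covariance M w z = C"
    unfolding covariance_def
  proof (rule the_equality)
    show "bounded_linear C \<and> (\<forall>e f. C e \<bullet> f = (\<integral>\<omega>. (w \<omega> \<bullet> f) * (e \<bullet> z \<omega>) \<partial>M))"
      using C by (simp add: a_def)
    fix D assume "bounded_linear D \<and> (\<forall>e f. D e \<bullet> f = (\<integral>\<omega>. (w \<omega> \<bullet> f) * (e \<bullet> z \<omega>) \<partial>M))"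
    then have "D e \<bullet> f = C e \<bullet> f" for e f using C by (simp add: a_def)
    then show "D = C" using vector_eq_rdot by blast
  qed
  with C show "bounded_linear (covariance M w z)" "covariance M w z e \<bullet> f = (\<integral>\<omega>. (w \<omega> \<bullet> f) * (e \<bullet> z \<omega>) \<partial>M)"
    by (simp_all add: a_def)
qed

lemma second_moment_le:
  assumes "square_integrable M z"
  shows "(\<integral>\<omega>. (z \<omega> \<bullet> v)\<^sup>2 \<partial>M) \<le> (\<integral>\<omega>. (norm (z \<omega>))\<^sup>2 \<partial>M) * (norm v)\<^sup>2"
proof -
  have "(\<integral>\<omega>. (z \<omega> \<bullet> v)\<^sup>2 \<partial>M) \<le> (\<integral>\<omega>. (norm (z \<omega>))\<^sup>2 * (norm v)\<^sup>2 \<partial>M)"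
  proof (rule integral_mono)
    fix \<omega>
    have "\<bar>z \<omega> \<bullet> v\<bar>\<^sup>2 \<le> (norm (z \<omega>) * norm v)\<^sup>2" by (intro power_mono Cauchy_Schwarz_ineq2) simp
    then show "(z \<omega> \<bullet> v)\<^sup>2 \<le> (norm (z \<omega>))\<^sup>2 * (norm v)\<^sup>2" by (simp add: power_mult_distrib)
  qed (use square_integrable_integrable[OF square_integrable_inner[OF assms, of v]] square_integrable_integrable[OF assms] in auto)
  then show ?thesis by simp
qed

text \<open>Approximating \<open>z\<close> in \<open>L\<^sup>2\<close> by a simple function \<open>s\<close>, whose finitely many values form \<open>F\<close>: on the
  orthogonal complement of \<open>F\<close>, \<open>z \<omega> \<bullet> v = (z \<omega> - s \<omega>) \<bullet> v\<close>.\<close>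

lemma second_moment_tail:
  fixes z :: "'w \<Rightarrow> 'a::{real_inner, banach, second_countable_topology}"
  assumes z: "square_integrable M z" and "0 < \<epsilon>"
  obtains F where "finite F" "\<forall>v. (\<forall>u\<in>F. v \<bullet> u = 0) \<longrightarrow> (\<integral>\<omega>. (z \<omega> \<bullet> v)\<^sup>2 \<partial>M) \<le> \<epsilon> * (norm v)\<^sup>2"
proof -
  have [measurable]: "z \<in> borel_measurable M" by (rule square_integrable_measurable[OF z])
  obtain s where s: "\<And>i. simple_function M (s i)" "\<And>\<omega>. \<omega> \<in> space M \<Longrightarrow> (\<lambda>i. s i \<omega>) \<longlonglongrightarrow> z \<omega>"
    and bound: "\<And>i \<omega>. \<omega> \<in> space M \<Longrightarrow> norm (s i \<omega>) \<le> 2 * norm (z \<omega>)"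
    using borel_measurable_implies_sequence_metric[OF square_integrable_measurable[OF z], of 0]
    unfolding dist_0_norm dist_norm diff_0_right by blast
  have [measurable]: "s i \<in> borel_measurable M" for i by (rule borel_measurable_simple_function[OF s(1)])
  have diff: "norm (z \<omega> - s i \<omega>) \<le> 3 * norm (z \<omega>)" if "\<omega> \<in> space M" for i \<omega>
    using norm_triangle_ineq4[of "z \<omega>" "s i \<omega>"] bound[OF that, of i] by linarith
  have sq: "square_integrable M (\<lambda>\<omega>. z \<omega> - s i \<omega>)" for i
    by (rule square_integrable_bound[OF z _ diff]) measurable
  have "(\<lambda>i. \<integral>\<omega>. (norm (z \<omega> - s i \<omega>))\<^sup>2 \<partial>M) \<longlonglongrightarrow> (\<integral>\<omega>. 0 \<partial>M)"
  proof (rule integral_dominated_convergence)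
    show "integrable M (\<lambda>\<omega>. 9 * (norm (z \<omega>))\<^sup>2)" using square_integrable_integrable[OF z] by simp
    show "AE \<omega> in M. (\<lambda>i. (norm (z \<omega> - s i \<omega>))\<^sup>2) \<longlonglongrightarrow> 0"
    proof (rule AE_I2)
      fix \<omega> assume "\<omega> \<in> space M"
      then have "(\<lambda>i. (norm (z \<omega> - s i \<omega>))\<^sup>2) \<longlonglongrightarrow> (norm (z \<omega> - z \<omega>))\<^sup>2"
        by (intro tendsto_intros s(2))
      then show "(\<lambda>i. (norm (z \<omega> - s i \<omega>))\<^sup>2) \<longlonglongrightarrow> 0" by simp
    qed
    show "AE \<omega> in M. norm ((norm (z \<omega> - s i \<omega>))\<^sup>2) \<le> 9 * (norm (z \<omega>))\<^sup>2" for i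
    proof (rule AE_I2)
      fix \<omega> assume "\<omega> \<in> space M"
      then have "(norm (z \<omega> - s i \<omega>))\<^sup>2 \<le> (3 * norm (z \<omega>))\<^sup>2" by (intro power_mono diff) auto
      then show "norm ((norm (z \<omega> - s i \<omega>))\<^sup>2) \<le> 9 * (norm (z \<omega>))\<^sup>2" by (simp add: power_mult_distrib)
    qed
  qed auto
  then have "\<forall>\<^sub>F i in sequentially. (\<integral>\<omega>. (norm (z \<omega> - s i \<omega>))\<^sup>2 \<partial>M) < \<epsilon>"
    using \<open>0 < \<epsilon>\<close> by (intro order_tendstoD) auto
  then obtain i where i: "(\<integral>\<omega>. (norm (z \<omega> - s i \<omega>))\<^sup>2 \<partial>M) < \<epsilon>"
    unfolding eventually_sequentially by blast
  have "(\<integral>\<omega>. (z \<omega> \<bullet> v)\<^sup>2 \<partial>M) \<le> \<epsilon> * (norm v)\<^sup>2" if v: "\<forall>u\<in>s i ` space M. v \<bullet> u = 0" for v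
  proof -
    have "(\<integral>\<omega>. (z \<omega> \<bullet> v)\<^sup>2 \<partial>M) = (\<integral>\<omega>. ((z \<omega> - s i \<omega>) \<bullet> v)\<^sup>2 \<partial>M)"
      using v by (intro Bochner_Integration.integral_cong) (auto simp: inner_diff_right inner_commute[of _ v])
    also have "\<dots> \<le> (\<integral>\<omega>. (norm (z \<omega> - s i \<omega>))\<^sup>2 \<partial>M) * (norm v)\<^sup>2" by (rule second_moment_le[OF sq])
    also have "\<dots> \<le> \<epsilon> * (norm v)\<^sup>2" using i by (intro mult_right_mono) auto
    finally show ?thesis .
  qed
  moreover have "finite (s i ` space M)" using s(1) by (rule simple_functionD)
  ultimately show ?thesis using that by blast
qed

section \<open>The regression problem as an instance of low-rank approximation\<close>

locale reduced_rank_regression = prob_space M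
  for M :: "'w measure" +
  fixes x :: "'w \<Rightarrow> 'f::{real_inner, banach, second_countable_topology}"
    and y :: "'w \<Rightarrow> 'g::{real_inner, banach, second_countable_topology}"
    and Wx :: "'f \<Rightarrow> 'h1::{real_inner, banach, second_countable_topology}"
    and WA :: "'h2::{real_inner, banach, second_countable_topology} \<Rightarrow> 'h1"
    and Wy :: "'g \<Rightarrow> 'h3::{real_inner, banach, second_countable_topology}"
  assumes x: "square_integrable M x" and y: "square_integrable M y"
    and Wx: "bounded_linear Wx" and WA: "bounded_linear WA" and Wy: "bounded_linear Wy"
    and closed_range: "closed (range WA)"
begin

definition Q :: "'g \<Rightarrow> 'g" where "Q = sqrt_op (covariance M y y)"

definition S :: "'h3 \<Rightarrow> 'g" where "S = Q \<circ> adjoint Wy"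

definition D :: "'f \<Rightarrow> 'g" where "D = mp_inv Q \<circ> covariance M y x"

definition K :: "'h1 \<Rightarrow> 'g" where
  "K = proj (closure (range S)) \<circ> D \<circ> adjoint Wx \<circ> proj (range WA)"

definition loss :: "('h3 \<Rightarrow> 'h2) \<Rightarrow> real" where
  "loss A = (\<integral>\<omega>. (norm (Wx (x \<omega>) - WA (A (Wy (y \<omega>)))))\<^sup>2 \<partial>M)"

lemma covariance_self_adjoint: "covariance M y y u \<bullet> v = u \<bullet> covariance M y y v"
  by (simp add: inner_covariance[OF y y] inner_commute[of u "covariance M y y v"])
    (simp add: inner_commute mult.commute)

lemma inner_covariance_self: "covariance M y y u \<bullet> u = (\<integral>\<omega>. (y \<omega> \<bullet> u)\<^sup>2 \<partial>M)"
  unfolding inner_covariance[OF y y] by (simp add: power2_eq_square inner_commute)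

lemma compact_op_covariance: "compact_op (covariance M y y)"
  unfolding compact_op_def
proof (intro conjI allI impI bounded_linear_covariance y)
  fix \<epsilon> :: real assume "0 < \<epsilon>"
  define E where "E = (\<integral>\<omega>. (norm (y \<omega>))\<^sup>2 \<partial>M)"
  have "0 \<le> E" by (simp add: E_def)
  \<comment> \<open>Chosen to make \<open>sqrt (E * \<delta>) \<le> \<epsilon>\<close>; the 1 covers
    \<open>E = 0\<close>.\<close>
  define \<delta> where "\<delta> = \<epsilon>\<^sup>2 / (E + 1)"
  have "0 < \<delta>" using \<open>0 < \<epsilon>\<close> \<open>0 \<le> E\<close> by (simp add: \<delta>_def)
  then obtain F where F: "finite F" "\<forall>v. (\<forall>u\<in>F. v \<bullet> u = 0) \<longrightarrow> (\<integral>\<omega>. (y \<omega> \<bullet> v)\<^sup>2 \<partial>M) \<le> \<delta> * (norm v)\<^sup>2"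
    by (rule second_moment_tail[OF y])
  have "norm (covariance M y y v) \<le> \<epsilon> * norm v" if v: "\<forall>u\<in>F. v \<bullet> u = 0" for v
  proof -
    \<comment> \<open>Testing the image against itself gives \<open>(norm c)\<^sup>2\<close> as an
      integral. Cauchy-Schwarz splits it into a factor linear in \<open>norm c\<close>, which
      cancels, and the small second moment along \<open>v\<close>.\<close>
    define c where "c = covariance M y y v"
    have "norm c * norm c = c \<bullet> c" by (simp flip: power2_eq_square power2_norm_eq_inner)
    also have "c \<bullet> c = (\<integral>\<omega>. (y \<omega> \<bullet> c) * (y \<omega> \<bullet> v) \<partial>M)"
      unfolding c_def inner_covariance[OF y y] by (simp add: inner_commute)
    also have "\<dots> \<le> sqrt (\<integral>\<omega>. (y \<omega> \<bullet> c)\<^sup>2 \<partial>M) * sqrt (\<integral>\<omega>. (y \<omega> \<bullet> v)\<^sup>2 \<partial>M)"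
      using cauchy_schwarz_integral[OF square_integrable_inner[OF y] square_integrable_inner[OF y], of c v] by simp
    also have "\<dots> \<le> sqrt (E * (norm c)\<^sup>2) * sqrt (\<delta> * (norm v)\<^sup>2)"
      using second_moment_le[OF y] F(2) v by (intro mult_mono real_sqrt_le_mono) (auto simp: E_def)
    also have "\<dots> = sqrt (E * \<delta>) * norm v * norm c" by (simp add: real_sqrt_mult)
    also have "\<dots> \<le> \<epsilon> * norm v * norm c"
    proof (intro mult_right_mono)
      have "E * \<delta> \<le> \<epsilon>\<^sup>2" using \<open>0 \<le> E\<close> by (simp add: \<delta>_def field_simps)
      then show "sqrt (E * \<delta>) \<le> \<epsilon>" using \<open>0 < \<epsilon>\<close> by (intro real_le_lsqrt) auto
    qed auto
    finally show ?thesis using \<open>0 < \<epsilon>\<close> by (cases "c = 0") (auto simp: c_def)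
  qed
  then show "\<exists>F. finite F \<and> (\<forall>v. (\<forall>u\<in>F. v \<bullet> u = 0) \<longrightarrow> norm (covariance M y y v) \<le> \<epsilon> * norm v)"
    using F(1) by blast
qed

lemma Q: "bounded_linear Q" "Q u \<bullet> v = u \<bullet> Q v" "Q (Q u) = covariance M y y u"
proof -
  have pos: "0 \<le> covariance M y y u \<bullet> u" for u by (simp add: inner_covariance_self)
  note sqrt = compact_op_covariance covariance_self_adjoint pos
  show "bounded_linear Q" "Q u \<bullet> v = u \<bullet> Q v" "Q (Q u) = covariance M y y u"
    unfolding Q_def
    by (rule bounded_linear_sqrt_op[OF sqrt], rule sqrt_op_self_adjoint[OF sqrt], rule sqrt_op_square[OF sqrt])
qed

lemma norm_Q: "(norm (Q u))\<^sup>2 = (\<integral>\<omega>. (y \<omega> \<bullet> u)\<^sup>2 \<partial>M)"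
  using inner_covariance_self[of u] by (simp add: power2_norm_eq_inner Q(2) Q(3) inner_commute)

text \<open>The hypothesis of Douglas' lemma. Keeping the second moment of \<open>x\<close> along
  \<open>a\<close>, instead of a multiple of \<open>norm a\<close>, lets tail estimates for
  \<open>x\<close> pass to \<open>D\<close> and thus yields compactness of \<open>K\<close>.\<close>

lemma covariance_bound: "\<bar>covariance M y x a \<bullet> g\<bar> \<le> sqrt (\<integral>\<omega>. (x \<omega> \<bullet> a)\<^sup>2 \<partial>M) * norm (Q g)"
proof -
  have "norm (Q g) = sqrt (\<integral>\<omega>. (y \<omega> \<bullet> g)\<^sup>2 \<partial>M)" by (simp flip: norm_Q)
  then show ?thesis
    using cauchy_schwarz_integral[OF square_integrable_inner[OF y] square_integrable_inner[OF x], of g a]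
    unfolding inner_covariance[OF y x] by (simp add: inner_commute mult.commute)
qed

lemma covariance_in_range: "covariance M y x a \<in> range Q"
  by (rule douglas_range[OF Q(1,2) _ covariance_bound]) simp

lemma norm_D_le: "norm (D a) \<le> sqrt (\<integral>\<omega>. (x \<omega> \<bullet> a)\<^sup>2 \<partial>M)"
  unfolding D_def comp_apply by (rule douglas_norm[OF Q(1,2) _ covariance_bound]) simp

lemma Q_D: "Q (D a) = covariance M y x a"
  unfolding D_def comp_apply by (rule apply_mp_inv[OF Q(1) covariance_in_range])

lemma bounded_linear_D: "bounded_linear D"
proof -
  define E where "E = (\<integral>\<omega>. (norm (x \<omega>))\<^sup>2 \<partial>M)"
  have "linear D"
    unfolding D_def
    using covariance_in_range bounded_linear_covariance[OF y x]
    by (intro linear_mp_inv[OF Q(1)] bounded_linear.linear) auto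
  moreover have "norm (D a) \<le> norm a * sqrt E" for a
  proof -
    have "norm (D a) \<le> sqrt (E * (norm a)\<^sup>2)"
      using order_trans[OF norm_D_le real_sqrt_le_mono[OF second_moment_le[OF x]]] by (simp add: E_def)
    then show ?thesis by (simp add: real_sqrt_mult mult.commute)
  qed
  ultimately show ?thesis
    by (intro bounded_linear_intro[where K = "sqrt E"]) (auto simp: linear_add linear_scale)
qed

lemma bounded_linear_S: "bounded_linear S"
  unfolding S_def comp_def by (intro bounded_linear_compose[OF Q(1)] bounded_linear_adjoint Wy)

lemma closure_range_S: "subspace (closure (range S))" "closed (closure (range S))"
  by (simp_all add: subspace_closure subspace_range bounded_linear_S)

lemma range_WA: "subspace (range WA)" "closed (range WA)"
  by (simp_all add: subspace_range WA closed_range)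

lemma bounded_linear_K: "bounded_linear K"
  unfolding K_def comp_def
  by (intro bounded_linear_compose[OF bounded_linear_proj[OF closure_range_S]] bounded_linear_compose[OF bounded_linear_D]
      bounded_linear_compose[OF bounded_linear_adjoint[OF Wx]] bounded_linear_proj range_WA)

text \<open>A tail set \<open>F\<close> for \<open>x\<close> is pulled forward to the vectors
  \<open>proj (range WA) (Wx u)\<close>: orthogonality of \<open>v\<close> to these makes
  \<open>adjoint Wx (proj (range WA) v)\<close> orthogonal to \<open>F\<close>, where
  \<open>norm_D_le\<close> is small.\<close>

lemma compact_op_K: "compact_op K"
  unfolding compact_op_def
proof (intro conjI allI impI bounded_linear_K)
  fix \<epsilon> :: real assume "0 < \<epsilon>"
  let ?P = "proj (range WA)"
  obtain B where "0 < B" and B: "\<And>u. norm (adjoint Wx u) \<le> norm u * B"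
    using bounded_linear.pos_bounded[OF bounded_linear_adjoint[OF Wx]] by blast
  \<comment> \<open>Compensates the bound \<open>B\<close> of \<open>adjoint Wx\<close>.\<close>
  define \<delta> where "\<delta> = (\<epsilon> / B)\<^sup>2"
  have "0 < \<delta>" using \<open>0 < \<epsilon>\<close> \<open>0 < B\<close> by (simp add: \<delta>_def)
  then obtain F where F: "finite F" "\<forall>v. (\<forall>u\<in>F. v \<bullet> u = 0) \<longrightarrow> (\<integral>\<omega>. (x \<omega> \<bullet> v)\<^sup>2 \<partial>M) \<le> \<delta> * (norm v)\<^sup>2"
    by (rule second_moment_tail[OF x])
  have "norm (K v) \<le> \<epsilon> * norm v" if v: "\<forall>u\<in>(\<lambda>u. ?P (Wx u)) ` F. v \<bullet> u = 0" for v
  proof -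
    define a where "a = adjoint Wx (?P v)"
    have "a \<bullet> u = 0" if "u \<in> F" for u
    proof -
      have "a \<bullet> u = ?P v \<bullet> Wx u" by (simp add: a_def adjoint_inner[OF Wx])
      also have "\<dots> = ?P v \<bullet> ?P (Wx u)"
        using inner_proj_left[OF range_WA proj_in[OF range_WA], of "Wx u" v] by (simp add: inner_commute)
      also have "\<dots> = v \<bullet> ?P (Wx u)" by (rule inner_proj_left[OF range_WA proj_in[OF range_WA]])
      finally show ?thesis using v that by simp
    qed
    then have tail: "(\<integral>\<omega>. (x \<omega> \<bullet> a)\<^sup>2 \<partial>M) \<le> \<delta> * (norm a)\<^sup>2" using F(2) by blast
    have "norm (K v) \<le> norm (D a)" by (simp add: K_def a_def norm_proj_le[OF closure_range_S])
    also have "\<dots> \<le> sqrt (\<delta> * (norm a)\<^sup>2)" using order_trans[OF norm_D_le real_sqrt_le_mono[OF tail]] .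
    also have "\<dots> = \<epsilon> / B * norm a" using \<open>0 < \<epsilon>\<close> \<open>0 < B\<close> by (simp add: \<delta>_def real_sqrt_mult)
    also have "\<dots> \<le> \<epsilon> / B * (norm v * B)"
    proof (rule mult_left_mono)
      have "norm a \<le> norm (?P v) * B" by (simp add: a_def B)
      also have "\<dots> \<le> norm v * B" using \<open>0 < B\<close> by (intro mult_right_mono norm_proj_le range_WA) simp
      finally show "norm a \<le> norm v * B" .
    qed (use \<open>0 < \<epsilon>\<close> \<open>0 < B\<close> in simp)
    finally show ?thesis using \<open>0 < B\<close> by simp
  qed
  then show "\<exists>F. finite F \<and> (\<forall>v. (\<forall>u\<in>F. v \<bullet> u = 0) \<longrightarrow> norm (K v) \<le> \<epsilon> * norm v)"
    using F(1) by (intro exI[of _ "(\<lambda>u. ?P (Wx u)) ` F"]) auto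
qed

text \<open>Expanding \<open>WA (A (Wy (y \<omega>)))\<close> in the frame leaves one quadratic and
  one cross term per \<open>h i\<close>. Their integrals are the squared norm of the reduced image
  and its inner product with \<open>K (h i)\<close>, so the square can be completed
  termwise.\<close>

lemma loss_eq:
  assumes A: "bounded_linear A" and h: "orthonormal_on {..<m::nat} h" "h ` {..<m} \<subseteq> range WA"
    and expand: "\<And>z. (\<Sum>i<m. (WA (A z) \<bullet> h i) *\<^sub>R h i) = WA (A z)"
  shows "loss A = (\<integral>\<omega>. (norm (Wx (x \<omega>)))\<^sup>2 \<partial>M) +
    (\<Sum>i<m. (norm (S (adjoint A (adjoint WA (h i))) - K (h i)))\<^sup>2 - (norm (K (h i)))\<^sup>2)"
proof -
  define a where "a i = adjoint Wx (h i)" for i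
  define b where "b i = adjoint Wy (adjoint A (adjoint WA (h i)))" for i
  have yb: "WA (A (Wy v)) \<bullet> h i = v \<bullet> b i" for v i
    by (simp add: b_def inner_adjoint[OF WA] inner_adjoint[OF A] inner_adjoint[OF Wy])
  have xa: "Wx v \<bullet> h i = v \<bullet> a i" for v i by (simp add: a_def inner_adjoint[OF Wx])
  have Qb: "Q (b i) = S (adjoint A (adjoint WA (h i)))" for i by (simp add: S_def b_def)
  have pointwise: "(norm (Wx (x \<omega>) - WA (A (Wy (y \<omega>)))))\<^sup>2
      = (norm (Wx (x \<omega>)))\<^sup>2 + (\<Sum>i<m. (y \<omega> \<bullet> b i)\<^sup>2 - 2 * ((y \<omega> \<bullet> b i) * (x \<omega> \<bullet> a i)))" for \<omega>
  proof -
    define u w where "u = Wx (x \<omega>)" and "w = WA (A (Wy (y \<omega>)))"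
    have w: "w = (\<Sum>i<m. (w \<bullet> h i) *\<^sub>R h i)" by (simp add: w_def expand)
    have "(norm w)\<^sup>2 = (\<Sum>i<m. (w \<bullet> h i)\<^sup>2)"
      using norm_sum_orthonormal[OF h(1), of "\<lambda>i. w \<bullet> h i"] by (simp flip: w)
    moreover have "u \<bullet> w = (\<Sum>i<m. (w \<bullet> h i) * (u \<bullet> h i))" by (subst w) (simp add: inner_sum_right)
    moreover have "(norm (u - w))\<^sup>2 = (norm u)\<^sup>2 + ((norm w)\<^sup>2 - 2 * (u \<bullet> w))"
      unfolding power2_norm_eq_inner by (simp add: inner_diff_left inner_diff_right inner_commute)
    ultimately show ?thesis
      by (simp add: sum_subtractf sum_distrib_left u_def w_def yb xa)
  qed
  have int: "integrable M (\<lambda>\<omega>. (y \<omega> \<bullet> b i)\<^sup>2)" "integrable M (\<lambda>\<omega>. (y \<omega> \<bullet> b i) * (x \<omega> \<bullet> a i))" for i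
    using square_integrable_integrable[OF square_integrable_inner[OF y, of "b i"]]
      square_integrable_mult[OF square_integrable_inner[OF y] square_integrable_inner[OF x]] by simp_all
  have "integrable M (\<lambda>\<omega>. (norm (Wx (x \<omega>)))\<^sup>2)"
    by (rule square_integrable_integrable[OF square_integrable_bounded_linear[OF x Wx]])
  then have "loss A = (\<integral>\<omega>. (norm (Wx (x \<omega>)))\<^sup>2 \<partial>M) +
      (\<Sum>i<m. (\<integral>\<omega>. (y \<omega> \<bullet> b i)\<^sup>2 \<partial>M) - 2 * (\<integral>\<omega>. (y \<omega> \<bullet> b i) * (x \<omega> \<bullet> a i) \<partial>M))"
    using int by (simp add: loss_def pointwise)
  also have "(\<Sum>i<m. (\<integral>\<omega>. (y \<omega> \<bullet> b i)\<^sup>2 \<partial>M) - 2 * (\<integral>\<omega>. (y \<omega> \<bullet> b i) * (x \<omega> \<bullet> a i) \<partial>M))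
      = (\<Sum>i<m. (norm (S (adjoint A (adjoint WA (h i))) - K (h i)))\<^sup>2 - (norm (K (h i)))\<^sup>2)"
  proof (intro sum.cong refl)
    fix i assume "i \<in> {..<m}"
    then have "proj (range WA) (h i) = h i" using h(2) by (intro proj_id range_WA) auto
    then have Kh: "K (h i) = proj (closure (range S)) (D (a i))" by (simp add: K_def a_def)
    define R where "R = S (adjoint A (adjoint WA (h i)))"
    \<comment> \<open>This is why the outer projector in \<open>K\<close> costs nothing: against
      vectors of \<open>range S\<close>, \<open>K (h i)\<close> acts like the unprojected
      \<open>D (a i)\<close>.\<close>
    have "R \<in> closure (range S)" using closure_subset by (fastforce simp: R_def)
    then have "K (h i) \<bullet> R = D (a i) \<bullet> Q (b i)"
      unfolding Kh using inner_proj_left[OF closure_range_S] by (simp add: Qb R_def)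
    also have "\<dots> = covariance M y x (a i) \<bullet> b i" by (simp flip: Q(2) Q_D)
    also have "\<dots> = (\<integral>\<omega>. (y \<omega> \<bullet> b i) * (x \<omega> \<bullet> a i) \<partial>M)"
      unfolding inner_covariance[OF y x] by (simp add: inner_commute)
    finally have "(\<integral>\<omega>. (y \<omega> \<bullet> b i) * (x \<omega> \<bullet> a i) \<partial>M) = K (h i) \<bullet> R" ..
    moreover have "(\<integral>\<omega>. (y \<omega> \<bullet> b i)\<^sup>2 \<partial>M) = (norm R)\<^sup>2" by (simp add: R_def flip: norm_Q Qb)
    ultimately show "(\<integral>\<omega>. (y \<omega> \<bullet> b i)\<^sup>2 \<partial>M) - 2 * (\<integral>\<omega>. (y \<omega> \<bullet> b i) * (x \<omega> \<bullet> a i) \<partial>M)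
        = (norm (S (adjoint A (adjoint WA (h i))) - K (h i)))\<^sup>2 - (norm (K (h i)))\<^sup>2"
      unfolding R_def[symmetric] power2_norm_eq_inner
      by (simp add: inner_diff_left inner_diff_right inner_commute)
  qed
  finally show ?thesis .
qed

sublocale reduced_rank_problem K S WA loss "\<integral>\<omega>. (norm (Wx (x \<omega>)))\<^sup>2 \<partial>M" r for r
proof (rule reduced_rank_problem.intro)
  show "K v \<in> closure (range S)" for v unfolding K_def comp_apply by (rule proj_in[OF closure_range_S])
  show "K v = 0" if "v \<in> (range WA)\<^sup>\<bottom>" for v
    using proj_zero[OF range_WA(1) that] bounded_linear_K
      linear_0[OF bounded_linear.linear[OF bounded_linear_adjoint[OF Wx]]]
      linear_0[OF bounded_linear.linear[OF bounded_linear_D]]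
      linear_0[OF bounded_linear.linear[OF bounded_linear_proj[OF closure_range_S]]]
    by (simp add: K_def)
qed (rule compact_op_K bounded_linear_S WA closed_range loss_eq | assumption)+

end

theorem proposition6p3:
  fixes M :: "'w measure"
    and x :: "'w \<Rightarrow> 'f::{real_inner, banach, second_countable_topology}"
    and y :: "'w \<Rightarrow> 'g::{real_inner, banach, second_countable_topology}"
    and Wx :: "'f \<Rightarrow> 'h1::{real_inner, banach, second_countable_topology}"
    and WA :: "'h2::{real_inner, banach, second_countable_topology} \<Rightarrow> 'h1"
    and Wy :: "'g \<Rightarrow> 'h3::{real_inner, banach, second_countable_topology}"
    and r :: nat
  assumes "prob_space M" and "countably_generated M"
    and "square_integrable M x" and "square_integrable M y"
    and "bounded_linear Wx" and "bounded_linear WA" and "bounded_linear Wy"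
    and "closed (range WA)"
  shows
    "let sqrtCy = sqrt_op (covariance M y y);
         S = sqrtCy \<circ> adjoint Wy;
         K = proj (closure (range S)) \<circ> mp_inv sqrtCy \<circ> covariance M y x \<circ> adjoint Wx
               \<circ> proj (range WA);
         solution = is_arg_min (\<lambda>A. \<integral>\<omega>. (norm (Wx (x \<omega>) - WA (A (Wy (y \<omega>)))))\<^sup>2 \<partial>M)
               (\<lambda>A. A \<in> bounded_rank_le r);
         minimal = (\<lambda>A. proj ((ker WA)\<^sup>\<bottom>) \<circ> A \<circ> proj ((ker S)\<^sup>\<bottom>) = A);
         admissible = (\<lambda>R. is_truncated_svd r K R \<and> range R \<subseteq> range S);
         Ahat = (\<lambda>R. mp_inv WA \<circ> adjoint (mp_inv S \<circ> R))
     in ((\<exists>A. solution A) \<longleftrightarrow> (\<exists>R. admissible R)) \<and>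
        (\<forall>R. admissible R \<longrightarrow>
           solution (Ahat R) \<and> minimal (Ahat R) \<and>
           ((\<forall>A. solution A \<and> minimal A \<longrightarrow> A = Ahat R) \<longleftrightarrow>
            (\<forall>R'. admissible R' \<longrightarrow> R' = R)))"
proof -
  interpret reduced_rank_regression M x y Wx WA Wy
    using assms by (simp add: reduced_rank_regression_def reduced_rank_regression_axioms_def)
  have "loss = (\<lambda>A. \<integral>\<omega>. (norm (Wx (x \<omega>) - WA (A (Wy (y \<omega>)))))\<^sup>2 \<partial>M)" by (simp add: loss_def fun_eq_iff)
  then show ?thesis
    using solutions_characterization[of r]
    unfolding Let_def K_def D_def S_def Q_def comp_assoc by simp
qed

end
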